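(* Let $(\mathcal{B},\mathbb{E},\mathfrak{s})$ be a Krull-Schmidt extriangulated category and let $((\mathcal{S},\mathcal{T}),(\mathcal{U},\mathcal{V}))$ be a twin cotorsion pair on $\mathcal{B}$ with heart $\underline{\mathcal{H}}$. Then there is a one-to-one correspondence, up to equivalence, between the almost split sequences in the extriangulated category $(\mathcal{H},\mathbb{F},\mathfrak{s}|_{\mathbb{F}})$ and the almost split sequences in the exact category $(\underline{\mathcal{H}},\underline{\mathfrak{F}})$.
   Context: Extriangulated categories (Nakaoka–Palu). Let $\mathcal{B}$ be an additive category with an additive bifunctor $\mathbb{E}:\mathcal{B}^{\mathrm{op}}\times\mathcal{B}\to\mathbf{Ab}$. For $\delta\in\mathbb{E}(C,A)$, $a:A\to A'$, $c:C'\to C$ write $a_*\delta=\mathbb{E}(C,a)(\delta)$, $c^*\delta=\mathbb{E}(c,A)(\delta)$. A morphism from $\delta\in\mathbb{E}(C,A)$ to $\delta'\in\mathbb{E}(C',A')$ is a pair $(a:A\to A',c:C\to C')$ with $a_*\delta=c^*\delta'$. Sequences $A\xrightarrow{x}B\xrightarrow{y}C$ and $A\xrightarrow{x'}B'\xrightarrow{y'}C$ are equivalent if there is an isomorphism $b:B\to B'$ with $bx=x'$, $y'b=y$. $\mathfrak{s}$ assigns to each $\delta\in\mathbb{E}(C,A)$ an equivalence class $\mathfrak{s}(\delta)=[A\xrightarrow{x}B\xrightarrow{y}C]$ such that every morphism $(a,c):\delta\to\delta'$ admits $b:B\to B'$ with $bx=x'a$, $y'b=cy$; moreover $\mathfrak{s}(0)=[A\to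 A\oplus C\to C]$ and $\mathfrak{s}(\delta\oplus\delta')=\mathfrak{s}(\delta)\oplus\mathfrak{s}(\delta')$. $(\mathcal{B},\mathbb{E},\mathfrak{s})$ is extriangulated if also: (ET3) given $\delta,\delta'$ realized by $A\xrightarrow{x}B\xrightarrow{y}C$, $A'\xrightarrow{x'}B'\xrightarrow{y'}C'$ and $a,b$ with $bx=x'a$, there is $c$ with $cy=y'b$ and $a_*\delta=c^*\delta'$; (ET4) if $\delta\in\mathbb{E}(D,A)$, $\delta'\in\mathbb{E}(F,B)$ are realized by $A\xrightarrow{f}B\xrightarrow{f'}D$, $B\xrightarrow{g}C\xrightarrow{g'}F$, there are an object $E$, morphisms $d:D\to E$, $e:E\to F$, $h':C\to E$ and $\delta''\in\mathbb{E}(E,A)$ realized by $A\xrightarrow{gf}C\xrightarrow{h'}E$ with $h'g=df'$, $eh'=g'$, $D\xrightarrow{d}E\xrightarrow{e}F$ realizing $f'_*\delta'$, $d^*\delta''=\delta$, $f_*\delta''=e^*\delta'$; and the duals (ET3)$^{\mathrm{op}}$, (ET4)$^{\mathrm{op}}$. If $\mathfrak{s}(\delta)=[A\xrightarrow{x}B\xrightarrow{y}C]$, then $A\xrightarrow{x}B\xrightarrow{y}C\overset{\delta}{\dashrightarrow}$ is called an $\mathbb{E}$-triangle. Twin cotorsion pairs and hearts. Subcategories are full and closed under isomorphisms. A cotorsion pair $(\mathcal{U},\mathcal{V})$ on $\mathcal{B}$ consists of two subcategories closed under direct summands with $\mathbb{E}(\mathcal{U},\mathcal{V})=0$ such that every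 $B\in\mathcal{B}$ has $\mathbb{E}$-triangles $V_B\to U_B\to B\dashrightarrow$ and $B\to V^B\to U^B\dashrightarrow$ with $U_B,U^B\in\mathcal{U}$, $V_B,V^B\in\mathcal{V}$. A twin cotorsion pair is a pair of cotorsion pairs $((\mathcal{S},\mathcal{T}),(\mathcal{U},\mathcal{V}))$ with $\mathcal{S}\subseteq\mathcal{U}$. Put $\mathcal{W}=\mathcal{T}\cap\mathcal{U}$. For a subcategory $\mathcal{D}\supseteq\mathcal{W}$, the ideal quotient $\mathcal{D}/\mathcal{W}$ has the objects of $\mathcal{D}$ and morphisms those of $\mathcal{D}$ modulo morphisms factoring through objects of $\mathcal{W}$; the image of $f$ is denoted $\underline{f}$. Let $\mathcal{B}^+$ be the class of $X\in\mathcal{B}$ having an $\mathbb{E}$-triangle $V\to W\to X\dashrightarrow$ with $V\in\mathcal{V}$, $W\in\mathcal{W}$; $\mathcal{B}^-$ the class of $Y\in\mathcal{B}$ having an $\mathbb{E}$-triangle $Y\to W'\to S\dashrightarrow$ with $S\in\mathcal{S}$, $W'\in\mathcal{W}$; $\mathcal{H}=\mathcal{B}^+\cap\mathcal{B}^-$. The heart of the twin cotorsion pair is $\underline{\mathcal{H}}=\mathcal{H}/\mathcal{W}$. Exact structures. $\mathbb{E}_1(C,A)\subseteq\mathbb{E}(C,A)$ is the subset of those $\delta$ realized by an $\mathbb{E}$-triangle $A\xrightarrow{x}B\xrightarrow{y}C\overset{\delta}{\dashrightarrow}$ with $x$ $\mathcal{W}$-monic (every morphism from $A$ to an object of $\mathcal{W}$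 factors through $x$) and $y$ $\mathcal{W}$-epic (every morphism from an object of $\mathcal{W}$ to $C$ factors through $y$). $\mathbb{F}=\mathbb{E}_1|_{\mathcal{H}}$ is the restriction of $\mathbb{E}_1$ to $\mathcal{H}^{\mathrm{op}}\times\mathcal{H}$, $\mathfrak{s}|_{\mathbb{F}}$ the restriction of $\mathfrak{s}$, and $\mathbb{F}$-triangles are the $\mathbb{E}$-triangles realizing elements of $\mathbb{F}(C,A)$, $A,C\in\mathcal{H}$ (their middle terms lie in $\mathcal{H}$, and $(\mathcal{H},\mathbb{F},\mathfrak{s}|_{\mathbb{F}})$ is an extriangulated category). $\underline{\mathfrak{F}}$ is the class of sequences in $\underline{\mathcal{H}}$ isomorphic to images $A\xrightarrow{\underline{x}}B\xrightarrow{\underline{y}}C$ of $\mathbb{F}$-triangles; it is the class of short exact sequences of an exact structure on $\underline{\mathcal{H}}$. Almost split sequences. In a Krull-Schmidt extriangulated category (in particular an exact category, whose $\mathbb{E}$-triangles are its short exact sequences), an $\mathbb{E}$-triangle $A\xrightarrow{x}B\xrightarrow{y}C\dashrightarrow$ is an almost split sequence if it is nonsplit, every morphism $A\to M$ that is not a section factors through $x$, and every morphism $N\to C$ that is not a retraction factors through $y$. Two $\mathbb{E}$-triangles $A\xrightarrow{x}B\xrightarrow{y}C\dashrightarrow$ and $A\xrightarrow{x'}B'\xrightarrow{y'}C\dashrightarrow$ are called equivalent if there is a commutative diagram of $\mathbb{E}$-triangles (i.e. a morphism of the underlying extensions) between them which is the identity on $A$ and consists of isomorphisms $B\cong B'$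 and $C\cong C$. Since $\mathcal{B}$ is Krull-Schmidt, every object of $\underline{\mathcal{H}}$ is isomorphic to one having no nonzero direct summand in $\mathcal{W}$; the end terms of almost split sequences in $\underline{\mathcal{H}}$ are taken to be represented by such objects. *)

theory Defs
  imports "HOL-Algebra.Coset" "HOL-Algebra.FiniteProduct"
begin

section \<open>Additive categories\<close>

text \<open>Following HOL-Algebra, abelian groups are \<^const>\<open>comm_group\<close>s in multiplicative notation:
  in \<open>Hom K A B\<close> (and in the groups \<open>Ext K C A\<close> below) the operation \<open>\<otimes>\<close> is addition and \<open>\<one>\<close> is the
  zero element.\<close>

record ('o, 'm) addcat =
  Obj :: "'o set"
  Hom :: "'o \<Rightarrow> 'o \<Rightarrow> 'm monoid"
  Cmp :: "'m \<Rightarrow> 'm \<Rightarrow> 'm"  (infixl "\<cdot>\<index>" 75)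
  Idn :: "'o \<Rightarrow> 'm"

abbreviation mor :: "('o, 'm, 'z) addcat_scheme \<Rightarrow> 'o \<Rightarrow> 'o \<Rightarrow> 'm set" where
  "mor K A B \<equiv> carrier (Hom K A B)"

definition zero_object :: "('o, 'm, 'z) addcat_scheme \<Rightarrow> 'o \<Rightarrow> bool" where
  "zero_object K Z \<longleftrightarrow> Z \<in> Obj K \<and>
     (\<forall>A\<in>Obj K. (\<exists>!f. f \<in> mor K A Z) \<and> (\<exists>!f. f \<in> mor K Z A))"

text \<open>\<open>X\<close> is the direct sum of \<open>A\<close> and \<open>B\<close>, with inclusions \<open>i\<close>, \<open>j\<close> and projections \<open>p\<close>, \<open>q\<close>.\<close>

definition is_biproduct ::
  "('o, 'm, 'z) addcat_scheme \<Rightarrow> 'o \<Rightarrow> 'o \<Rightarrow> 'o \<Rightarrow> 'm \<Rightarrow> 'm \<Rightarrow> 'm \<Rightarrow> 'm \<Rightarrow> bool" where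
  "is_biproduct K X A B i j p q \<longleftrightarrow>
     X \<in> Obj K \<and> A \<in> Obj K \<and> B \<in> Obj K \<and>
     i \<in> mor K A X \<and> j \<in> mor K B X \<and> p \<in> mor K X A \<and> q \<in> mor K X B \<and>
     p \<cdot>\<^bsub>K\<^esub> i = Idn K A \<and> q \<cdot>\<^bsub>K\<^esub> j = Idn K B \<and>
     p \<cdot>\<^bsub>K\<^esub> j = \<one>\<^bsub>Hom K B A\<^esub> \<and> q \<cdot>\<^bsub>K\<^esub> i = \<one>\<^bsub>Hom K A B\<^esub> \<and>
     (i \<cdot>\<^bsub>K\<^esub> p) \<otimes>\<^bsub>Hom K X X\<^esub> (j \<cdot>\<^bsub>K\<^esub> q) = Idn K X"

locale additive_category =
  fixes K :: "('o, 'm, 'z) addcat_scheme" (structure)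
  assumes Hom_disjoint: "\<lbrakk>A \<in> Obj K; B \<in> Obj K; A' \<in> Obj K; B' \<in> Obj K;
      f \<in> mor K A B; f \<in> mor K A' B'\<rbrakk> \<Longrightarrow> A = A' \<and> B = B'"
    and Idn_closed: "A \<in> Obj K \<Longrightarrow> Idn K A \<in> mor K A A"
    and Cmp_closed: "\<lbrakk>A \<in> Obj K; B \<in> Obj K; C \<in> Obj K; f \<in> mor K A B; g \<in> mor K B C\<rbrakk>
      \<Longrightarrow> g \<cdot> f \<in> mor K A C"
    and Idn_left: "\<lbrakk>A \<in> Obj K; B \<in> Obj K; f \<in> mor K A B\<rbrakk> \<Longrightarrow> Idn K B \<cdot> f = f"
    and Idn_right: "\<lbrakk>A \<in> Obj K; B \<in> Obj K; f \<in> mor K A B\<rbrakk> \<Longrightarrow> f \<cdot> Idn K A = f"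
    and Cmp_assoc: "\<lbrakk>A \<in> Obj K; B \<in> Obj K; C \<in> Obj K; D \<in> Obj K;
      f \<in> mor K A B; g \<in> mor K B C; h \<in> mor K C D\<rbrakk> \<Longrightarrow> (h \<cdot> g) \<cdot> f = h \<cdot> (g \<cdot> f)"
    and Hom_comm_group: "\<lbrakk>A \<in> Obj K; B \<in> Obj K\<rbrakk> \<Longrightarrow> comm_group (Hom K A B)"
    and Cmp_add_right: "\<lbrakk>A \<in> Obj K; B \<in> Obj K; C \<in> Obj K;
      f \<in> mor K A B; f' \<in> mor K A B; g \<in> mor K B C\<rbrakk>
      \<Longrightarrow> g \<cdot> (f \<otimes>\<^bsub>Hom K A B\<^esub> f') = (g \<cdot> f) \<otimes>\<^bsub>Hom K A C\<^esub> (g \<cdot> f')"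
    and Cmp_add_left: "\<lbrakk>A \<in> Obj K; B \<in> Obj K; C \<in> Obj K;
      f \<in> mor K A B; g \<in> mor K B C; g' \<in> mor K B C\<rbrakk>
      \<Longrightarrow> (g \<otimes>\<^bsub>Hom K B C\<^esub> g') \<cdot> f = (g \<cdot> f) \<otimes>\<^bsub>Hom K A C\<^esub> (g' \<cdot> f)"
    and ex_zero_object: "\<exists>Z. zero_object K Z"
    and ex_biproduct: "\<lbrakk>A \<in> Obj K; B \<in> Obj K\<rbrakk> \<Longrightarrow> \<exists>X i j p q. is_biproduct K X A B i j p q"

definition is_iso :: "('o, 'm, 'z) addcat_scheme \<Rightarrow> 'o \<Rightarrow> 'o \<Rightarrow> 'm \<Rightarrow> bool" where
  "is_iso K A B f \<longleftrightarrow> f \<in> mor K A B \<and>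
     (\<exists>g\<in>mor K B A. g \<cdot>\<^bsub>K\<^esub> f = Idn K A \<and> f \<cdot>\<^bsub>K\<^esub> g = Idn K B)"

definition is_section :: "('o, 'm, 'z) addcat_scheme \<Rightarrow> 'o \<Rightarrow> 'o \<Rightarrow> 'm \<Rightarrow> bool" where
  "is_section K A B f \<longleftrightarrow> f \<in> mor K A B \<and> (\<exists>r\<in>mor K B A. r \<cdot>\<^bsub>K\<^esub> f = Idn K A)"

definition is_retraction :: "('o, 'm, 'z) addcat_scheme \<Rightarrow> 'o \<Rightarrow> 'o \<Rightarrow> 'm \<Rightarrow> bool" where
  "is_retraction K A B f \<longleftrightarrow> f \<in> mor K A B \<and> (\<exists>t\<in>mor K B A. f \<cdot>\<^bsub>K\<^esub> t = Idn K B)"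

definition direct_summand :: "('o, 'm, 'z) addcat_scheme \<Rightarrow> 'o \<Rightarrow> 'o \<Rightarrow> bool" where
  "direct_summand K Y X \<longleftrightarrow> (\<exists>Z i j p q. is_biproduct K X Y Z i j p q)"

text \<open>A ring is local if it is nonzero and its non-units are closed under addition; the units of
  \<open>End(Y)\<close> are the automorphisms of \<open>Y\<close>.\<close>

definition local_end :: "('o, 'm, 'z) addcat_scheme \<Rightarrow> 'o \<Rightarrow> bool" where
  "local_end K Y \<longleftrightarrow> Idn K Y \<noteq> \<one>\<^bsub>Hom K Y Y\<^esub> \<and>
     (\<forall>f\<in>mor K Y Y. \<forall>g\<in>mor K Y Y. \<not> is_iso K Y Y f \<longrightarrow> \<not> is_iso K Y Y g
        \<longrightarrow> \<not> is_iso K Y Y (f \<otimes>\<^bsub>Hom K Y Y\<^esub> g))"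

definition krull_schmidt :: "('o, 'm, 'z) addcat_scheme \<Rightarrow> bool" where
  "krull_schmidt K \<longleftrightarrow> (\<forall>X\<in>Obj K. \<exists>(n::nat) Y i p.
     (\<forall>k<n. Y k \<in> Obj K \<and> local_end K (Y k) \<and> i k \<in> mor K (Y k) X \<and> p k \<in> mor K X (Y k)) \<and>
     (\<forall>k<n. \<forall>l<n. p k \<cdot>\<^bsub>K\<^esub> i l = (if k = l then Idn K (Y k) else \<one>\<^bsub>Hom K (Y l) (Y k)\<^esub>)) \<and>
     (\<Otimes>\<^bsub>Hom K X X\<^esub>k\<in>{..<n}. i k \<cdot>\<^bsub>K\<^esub> p k) = Idn K X)"

text \<open>Full subcategories closed under isomorphisms are given by their objects.\<close>

definition subcategory :: "('o, 'm, 'z) addcat_scheme \<Rightarrow> 'o set \<Rightarrow> bool" where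
  "subcategory K D \<longleftrightarrow> D \<subseteq> Obj K \<and> (\<forall>X\<in>D. \<forall>Y\<in>Obj K. \<forall>f. is_iso K X Y f \<longrightarrow> Y \<in> D)"

definition summand_closed :: "('o, 'm, 'z) addcat_scheme \<Rightarrow> 'o set \<Rightarrow> bool" where
  "summand_closed K D \<longleftrightarrow> (\<forall>X\<in>D. \<forall>Y. direct_summand K Y X \<longrightarrow> Y \<in> D)"


section \<open>Ideal quotients\<close>

definition factors_through ::
  "('o, 'm, 'z) addcat_scheme \<Rightarrow> 'o set \<Rightarrow> 'o \<Rightarrow> 'o \<Rightarrow> 'm set" where
  "factors_through K W A B =
     {f \<in> mor K A B. \<exists>X\<in>W. \<exists>h\<in>mor K A X. \<exists>g\<in>mor K X B. f = g \<cdot>\<^bsub>K\<^esub> h}"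

definition quot_class ::
  "('o, 'm, 'z) addcat_scheme \<Rightarrow> 'o set \<Rightarrow> 'o \<Rightarrow> 'o \<Rightarrow> 'm \<Rightarrow> 'm set" where
  "quot_class K W A B f = factors_through K W A B #>\<^bsub>Hom K A B\<^esub> f"

text \<open>The category \<open>D/W\<close>. As morphism sets are disjoint, the objects in the definition of the
  composite are determined by the two cosets.\<close>

definition ideal_quotient ::
  "('o, 'm, 'z) addcat_scheme \<Rightarrow> 'o set \<Rightarrow> 'o set \<Rightarrow> ('o, 'm set) addcat" where
  "ideal_quotient K D W =
     \<lparr>Obj = D,
      Hom = (\<lambda>A B. Hom K A B Mod factors_through K W A B),
      Cmp = (\<lambda>G F. \<Union>{quot_class K W A C (g \<cdot>\<^bsub>K\<^esub> f) | A B C f g.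
               A \<in> D \<and> B \<in> D \<and> C \<in> D \<and> f \<in> F \<inter> mor K A B \<and> g \<in> G \<inter> mor K B C}),
      Idn = (\<lambda>A. quot_class K W A A (Idn K A))\<rparr>"


section \<open>Extriangulated categories\<close>

text \<open>A sequence \<open>A \<rightarrow> B \<rightarrow> C\<close> with fixed end terms is a triple \<open>(x, B, y)\<close>.\<close>

definition sequences :: "('o, 'm, 'z) addcat_scheme \<Rightarrow> 'o \<Rightarrow> 'o \<Rightarrow> ('m \<times> 'o \<times> 'm) set" where
  "sequences K A C = {(x, B, y). B \<in> Obj K \<and> x \<in> mor K A B \<and> y \<in> mor K B C}"

definition sequence_equiv ::
  "('o, 'm, 'z) addcat_scheme \<Rightarrow> 'o \<Rightarrow> 'o \<Rightarrow> ('m \<times> 'o \<times> 'm) rel" where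
  "sequence_equiv K A C =
     {((x, B, y), (x', B', y')).
        (x, B, y) \<in> sequences K A C \<and> (x', B', y') \<in> sequences K A C \<and>
        (\<exists>b. is_iso K B B' b \<and> b \<cdot>\<^bsub>K\<^esub> x = x' \<and> y' \<cdot>\<^bsub>K\<^esub> b = y)}"

text \<open>\<open>Ext K C A\<close> is \<open>\<E>(C,A)\<close>, \<open>ExtMap K c a\<close> is \<open>\<E>(c,a)\<close>, and \<open>Rlz K C A \<delta>\<close> is the equivalence class
  \<open>\<s>(\<delta>)\<close> for \<open>\<delta> \<in> \<E>(C,A)\<close>.\<close>

record ('o, 'm, 'e) extricat = "('o, 'm) addcat" +
  Ext :: "'o \<Rightarrow> 'o \<Rightarrow> 'e monoid"
  ExtMap :: "'m \<Rightarrow> 'm \<Rightarrow> 'e \<Rightarrow> 'e"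
  Rlz :: "'o \<Rightarrow> 'o \<Rightarrow> 'e \<Rightarrow> ('m \<times> 'o \<times> 'm) set"

abbreviation ext :: "('o, 'm, 'e, 'z) extricat_scheme \<Rightarrow> 'o \<Rightarrow> 'o \<Rightarrow> 'e set" where
  "ext K C A \<equiv> carrier (Ext K C A)"

text \<open>\<open>push K C a \<delta>\<close> is \<open>a\<^sub>*\<delta> = \<E>(C,a)(\<delta>)\<close> and \<open>pull K c A \<delta>\<close> is \<open>c\<^sup>*\<delta> = \<E>(c,A)(\<delta>)\<close>.\<close>

abbreviation push :: "('o, 'm, 'e, 'z) extricat_scheme \<Rightarrow> 'o \<Rightarrow> 'm \<Rightarrow> 'e \<Rightarrow> 'e" where
  "push K C a \<delta> \<equiv> ExtMap K (Idn K C) a \<delta>"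

abbreviation pull :: "('o, 'm, 'e, 'z) extricat_scheme \<Rightarrow> 'm \<Rightarrow> 'o \<Rightarrow> 'e \<Rightarrow> 'e" where
  "pull K c A \<delta> \<equiv> ExtMap K c (Idn K A) \<delta>"

definition etriangle ::
  "('o, 'm, 'e, 'z) extricat_scheme \<Rightarrow> 'o \<Rightarrow> 'm \<Rightarrow> 'o \<Rightarrow> 'm \<Rightarrow> 'o \<Rightarrow> 'e \<Rightarrow> bool" where
  "etriangle K A x B y C \<delta> \<longleftrightarrow>
     A \<in> Obj K \<and> C \<in> Obj K \<and> \<delta> \<in> ext K C A \<and> (x, B, y) \<in> Rlz K C A \<delta>"

locale extriangulated_category = additive_category K
  for K :: "('o, 'm, 'e, 'z) extricat_scheme" (structure) +
  assumes Ext_comm_group: "\<lbrakk>A \<in> Obj K; C \<in> Obj K\<rbrakk> \<Longrightarrow> comm_group (Ext K C A)"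
    and ExtMap_hom: "\<lbrakk>A \<in> Obj K; A' \<in> Obj K; C \<in> Obj K; C' \<in> Obj K; c \<in> mor K C' C; a \<in> mor K A A'\<rbrakk>
      \<Longrightarrow> ExtMap K c a \<in> hom (Ext K C A) (Ext K C' A')"
    and ExtMap_Idn: "\<lbrakk>A \<in> Obj K; C \<in> Obj K; \<delta> \<in> ext K C A\<rbrakk>
      \<Longrightarrow> ExtMap K (Idn K C) (Idn K A) \<delta> = \<delta>"
    and ExtMap_Cmp: "\<lbrakk>A \<in> Obj K; A' \<in> Obj K; A'' \<in> Obj K; C \<in> Obj K; C' \<in> Obj K; C'' \<in> Obj K;
      c \<in> mor K C' C; c' \<in> mor K C'' C'; a \<in> mor K A A'; a' \<in> mor K A' A''; \<delta> \<in> ext K C A\<rbrakk>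
      \<Longrightarrow> ExtMap K (c \<cdot> c') (a' \<cdot> a) \<delta> = ExtMap K c' a' (ExtMap K c a \<delta>)"
    and ExtMap_add_right: "\<lbrakk>A \<in> Obj K; A' \<in> Obj K; C \<in> Obj K; C' \<in> Obj K;
      c \<in> mor K C' C; a \<in> mor K A A'; a' \<in> mor K A A'; \<delta> \<in> ext K C A\<rbrakk>
      \<Longrightarrow> ExtMap K c (a \<otimes>\<^bsub>Hom K A A'\<^esub> a') \<delta>
          = ExtMap K c a \<delta> \<otimes>\<^bsub>Ext K C' A'\<^esub> ExtMap K c a' \<delta>"
    and ExtMap_add_left: "\<lbrakk>A \<in> Obj K; A' \<in> Obj K; C \<in> Obj K; C' \<in> Obj K;
      c \<in> mor K C' C; c' \<in> mor K C' C; a \<in> mor K A A'; \<delta> \<in> ext K C A\<rbrakk>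
      \<Longrightarrow> ExtMap K (c \<otimes>\<^bsub>Hom K C' C\<^esub> c') a \<delta>
          = ExtMap K c a \<delta> \<otimes>\<^bsub>Ext K C' A'\<^esub> ExtMap K c' a \<delta>"
    and Rlz_class: "\<lbrakk>A \<in> Obj K; C \<in> Obj K; \<delta> \<in> ext K C A\<rbrakk>
      \<Longrightarrow> Rlz K C A \<delta> \<in> sequences K A C // sequence_equiv K A C"
    and Rlz_morphism: "\<lbrakk>etriangle K A x B y C \<delta>; etriangle K A' x' B' y' C' \<delta>';
      a \<in> mor K A A'; c \<in> mor K C C'; push K C a \<delta> = pull K c A' \<delta>'\<rbrakk>
      \<Longrightarrow> \<exists>b\<in>mor K B B'. b \<cdot> x = x' \<cdot> a \<and> y' \<cdot> b = c \<cdot> y"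
    and Rlz_zero: "is_biproduct K X A C i j p q \<Longrightarrow> etriangle K A i X q C \<one>\<^bsub>Ext K C A\<^esub>"
    \<comment> \<open>\<open>\<delta> \<oplus> \<delta>'\<close> is the element of \<open>\<E>(C \<oplus> C', A \<oplus> A')\<close> with components \<open>\<delta>, 0, 0, \<delta>'\<close>.\<close>
    and Rlz_sum: "\<lbrakk>etriangle K A x B y C \<delta>; etriangle K A' x' B' y' C' \<delta>';
      is_biproduct K AA A A' iA iA' pA pA';
      is_biproduct K BB B B' iB iB' pB pB';
      is_biproduct K CC C C' iC iC' pC pC'\<rbrakk>
      \<Longrightarrow> etriangle K
            AA ((iB \<cdot> x \<cdot> pA) \<otimes>\<^bsub>Hom K AA BB\<^esub> (iB' \<cdot> x' \<cdot> pA'))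
            BB ((iC \<cdot> y \<cdot> pB) \<otimes>\<^bsub>Hom K BB CC\<^esub> (iC' \<cdot> y' \<cdot> pB'))
            CC (ExtMap K pC iA \<delta> \<otimes>\<^bsub>Ext K CC AA\<^esub> ExtMap K pC' iA' \<delta>')"
    and ET3: "\<lbrakk>etriangle K A x B y C \<delta>; etriangle K A' x' B' y' C' \<delta>';
      a \<in> mor K A A'; b \<in> mor K B B'; b \<cdot> x = x' \<cdot> a\<rbrakk>
      \<Longrightarrow> \<exists>c\<in>mor K C C'. c \<cdot> y = y' \<cdot> b \<and> push K C a \<delta> = pull K c A' \<delta>'"
    and ET3op: "\<lbrakk>etriangle K A x B y C \<delta>; etriangle K A' x' B' y' C' \<delta>';
      b \<in> mor K B B'; c \<in> mor K C C'; y' \<cdot> b = c \<cdot> y\<rbrakk>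
      \<Longrightarrow> \<exists>a\<in>mor K A A'. b \<cdot> x = x' \<cdot> a \<and> push K C a \<delta> = pull K c A' \<delta>'"
    and ET4: "\<lbrakk>etriangle K A f B f' D \<delta>; etriangle K B g C g' F \<delta>'\<rbrakk>
      \<Longrightarrow> \<exists>E\<in>Obj K. \<exists>d\<in>mor K D E. \<exists>e\<in>mor K E F. \<exists>h'\<in>mor K C E. \<exists>\<delta>''\<in>ext K E A.
            etriangle K A (g \<cdot> f) C h' E \<delta>'' \<and> h' \<cdot> g = d \<cdot> f' \<and> e \<cdot> h' = g' \<and>
            etriangle K D d E e F (push K F f' \<delta>') \<and>
            pull K d A \<delta>'' = \<delta> \<and> push K E f \<delta>'' = pull K e B \<delta>'"
    and ET4op: "\<lbrakk>etriangle K D f' B f A \<delta>; etriangle K F g' C g B \<delta>'\<rbrakk>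
      \<Longrightarrow> \<exists>E\<in>Obj K. \<exists>d\<in>mor K E D. \<exists>e\<in>mor K F E. \<exists>h'\<in>mor K E C. \<exists>\<delta>''\<in>ext K A E.
            etriangle K E h' C (f \<cdot> g) A \<delta>'' \<and> g \<cdot> h' = f' \<cdot> d \<and> h' \<cdot> e = g' \<and>
            etriangle K F e E d D (pull K f' F \<delta>') \<and>
            push K A d \<delta>'' = \<delta> \<and> pull K f E \<delta>'' = push K B e \<delta>'"


section \<open>Twin cotorsion pairs and their hearts\<close>

locale cotorsion_pair =
  fixes K :: "('o, 'm, 'e, 'z) extricat_scheme" and U V :: "'o set"
  assumes subcategories: "subcategory K U" "subcategory K V"
    and summands: "summand_closed K U" "summand_closed K V"
    and Ext_vanish: "\<lbrakk>X \<in> U; Y \<in> V\<rbrakk> \<Longrightarrow> ext K X Y = {\<one>\<^bsub>Ext K X Y\<^esub>}"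
    and approx_right: "B \<in> Obj K \<Longrightarrow> \<exists>Y\<in>V. \<exists>X\<in>U. \<exists>x y \<delta>. etriangle K Y x X y B \<delta>"
    and approx_left: "B \<in> Obj K \<Longrightarrow> \<exists>Y\<in>V. \<exists>X\<in>U. \<exists>x y \<delta>. etriangle K B x Y y X \<delta>"

locale twin_cotorsion_pair =
  fixes K :: "('o, 'm, 'e, 'z) extricat_scheme" and S T U V :: "'o set"
  assumes first_pair: "cotorsion_pair K S T"
    and second_pair: "cotorsion_pair K U V"
    and S_subset_U: "S \<subseteq> U"

definition B_plus :: "('o, 'm, 'e, 'z) extricat_scheme \<Rightarrow> 'o set \<Rightarrow> 'o set \<Rightarrow> 'o set" where
  "B_plus K V W = {X \<in> Obj K. \<exists>Y\<in>V. \<exists>Z\<in>W. \<exists>x y \<delta>. etriangle K Y x Z y X \<delta>}"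

definition B_minus :: "('o, 'm, 'e, 'z) extricat_scheme \<Rightarrow> 'o set \<Rightarrow> 'o set \<Rightarrow> 'o set" where
  "B_minus K S W = {Y \<in> Obj K. \<exists>Z\<in>W. \<exists>X\<in>S. \<exists>x y \<delta>. etriangle K Y x Z y X \<delta>}"

text \<open>The objects of \<open>\<H>\<close>.\<close>

definition heart_obj ::
  "('o, 'm, 'e, 'z) extricat_scheme \<Rightarrow> 'o set \<Rightarrow> 'o set \<Rightarrow> 'o set \<Rightarrow> 'o set \<Rightarrow> 'o set" where
  "heart_obj K S T U V = B_plus K V (T \<inter> U) \<inter> B_minus K S (T \<inter> U)"

definition heart ::
  "('o, 'm, 'e, 'z) extricat_scheme \<Rightarrow> 'o set \<Rightarrow> 'o set \<Rightarrow> 'o set \<Rightarrow> 'o set \<Rightarrow> ('o, 'm set) addcat" where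
  "heart K S T U V = ideal_quotient K (heart_obj K S T U V) (T \<inter> U)"


section \<open>The structures on \<open>\<H>\<close> and on the heart\<close>

definition W_monic :: "('o, 'm, 'z) addcat_scheme \<Rightarrow> 'o set \<Rightarrow> 'o \<Rightarrow> 'o \<Rightarrow> 'm \<Rightarrow> bool" where
  "W_monic K W A B x \<longleftrightarrow> (\<forall>X\<in>W. \<forall>f\<in>mor K A X. \<exists>g\<in>mor K B X. f = g \<cdot>\<^bsub>K\<^esub> x)"

definition W_epic :: "('o, 'm, 'z) addcat_scheme \<Rightarrow> 'o set \<Rightarrow> 'o \<Rightarrow> 'o \<Rightarrow> 'm \<Rightarrow> bool" where
  "W_epic K W B C y \<longleftrightarrow> (\<forall>X\<in>W. \<forall>f\<in>mor K X C. \<exists>g\<in>mor K X B. f = y \<cdot>\<^bsub>K\<^esub> g)"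

definition E1 :: "('o, 'm, 'e, 'z) extricat_scheme \<Rightarrow> 'o set \<Rightarrow> 'o \<Rightarrow> 'o \<Rightarrow> 'e set" where
  "E1 K W C A = {\<delta>. \<exists>x B y. etriangle K A x B y C \<delta> \<and> W_monic K W A B x \<and> W_epic K W B C y}"

text \<open>The extriangulated category \<open>(\<H>, \<F>, \<s>|\<^sub>\<F>)\<close>; its \<open>\<E>\<close>-triangles are the \<open>\<F>\<close>-triangles.\<close>

definition heart_extri ::
  "('o, 'm, 'e) extricat \<Rightarrow> 'o set \<Rightarrow> 'o set \<Rightarrow> 'o set \<Rightarrow> 'o set \<Rightarrow> ('o, 'm, 'e) extricat" where
  "heart_extri K S T U V =
     K\<lparr>Obj := heart_obj K S T U V,
       Ext := (\<lambda>C A. (Ext K C A)\<lparr>carrier := E1 K (T \<inter> U) C A\<rparr>)\<rparr>"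

type_synonym ('o, 'm) ses = "'o \<times> 'm \<times> 'o \<times> 'm \<times> 'o"

definition heart_image ::
  "('o, 'm, 'e) extricat \<Rightarrow> 'o set \<Rightarrow> 'o set \<Rightarrow> 'o set \<Rightarrow> 'o set \<Rightarrow>
     ('o, 'm) ses \<times> 'e \<Rightarrow> ('o, 'm set) ses" where
  "heart_image K S T U V =
     (\<lambda>((A, x, B, y, C), \<delta>). (A, quot_class K (T \<inter> U) A B x, B, quot_class K (T \<inter> U) B C y, C))"

definition ses_isomorphic ::
  "('o, 'm, 'z) addcat_scheme \<Rightarrow> ('o, 'm) ses \<Rightarrow> ('o, 'm) ses \<Rightarrow> bool" where
  "ses_isomorphic K = (\<lambda>(A, x, B, y, C) (A', x', B', y', C').
     \<exists>a b c. is_iso K A A' a \<and> is_iso K B B' b \<and> is_iso K C C' c \<and>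
       b \<cdot>\<^bsub>K\<^esub> x = x' \<cdot>\<^bsub>K\<^esub> a \<and> c \<cdot>\<^bsub>K\<^esub> y = y' \<cdot>\<^bsub>K\<^esub> b)"

text \<open>The short exact sequences of the exact structure on the heart.\<close>

definition heart_ses ::
  "('o, 'm, 'e) extricat \<Rightarrow> 'o set \<Rightarrow> 'o set \<Rightarrow> 'o set \<Rightarrow> 'o set \<Rightarrow> ('o, 'm set) ses set" where
  "heart_ses K S T U V =
     {(A, x, B, y, C). A \<in> Obj (heart K S T U V) \<and> C \<in> Obj (heart K S T U V) \<and>
        (x, B, y) \<in> sequences (heart K S T U V) A C \<and>
        (\<exists>A' x' B' y' C' \<delta>. etriangle (heart_extri K S T U V) A' x' B' y' C' \<delta> \<and>
           ses_isomorphic (heart K S T U V)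
             (heart_image K S T U V ((A', x', B', y', C'), \<delta>)) (A, x, B, y, C))}"


section \<open>Almost split sequences\<close>

definition left_factoring :: "('o, 'm, 'z) addcat_scheme \<Rightarrow> 'o \<Rightarrow> 'o \<Rightarrow> 'm \<Rightarrow> bool" where
  "left_factoring K A B x \<longleftrightarrow>
     (\<forall>M\<in>Obj K. \<forall>f\<in>mor K A M. \<not> is_section K A M f \<longrightarrow> (\<exists>g\<in>mor K B M. f = g \<cdot>\<^bsub>K\<^esub> x))"

definition right_factoring :: "('o, 'm, 'z) addcat_scheme \<Rightarrow> 'o \<Rightarrow> 'o \<Rightarrow> 'm \<Rightarrow> bool" where
  "right_factoring K B C y \<longleftrightarrow>
     (\<forall>N\<in>Obj K. \<forall>f\<in>mor K N C. \<not> is_retraction K N C f \<longrightarrow> (\<exists>g\<in>mor K N B. f = y \<cdot>\<^bsub>K\<^esub> g))"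

text \<open>In an extriangulated category, an \<open>\<E>\<close>-triangle is split when its extension \<open>\<delta>\<close> is zero.\<close>

definition almost_split_triangles ::
  "('o, 'm, 'e, 'z) extricat_scheme \<Rightarrow> (('o, 'm) ses \<times> 'e) set" where
  "almost_split_triangles K =
     {((A, x, B, y, C), \<delta>). etriangle K A x B y C \<delta> \<and> \<delta> \<noteq> \<one>\<^bsub>Ext K C A\<^esub> \<and>
        left_factoring K A B x \<and> right_factoring K B C y}"

definition triangle_equiv ::
  "('o, 'm, 'e, 'z) extricat_scheme \<Rightarrow> (('o, 'm) ses \<times> 'e) rel" where
  "triangle_equiv K =
     {(((A, x, B, y, C), \<delta>), ((A', x', B', y', C'), \<delta>')).
        etriangle K A x B y C \<delta> \<and> etriangle K A' x' B' y' C' \<delta>' \<and> A' = A \<and> C' = C \<and>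
        (\<exists>b c. is_iso K B B' b \<and> is_iso K C C c \<and>
           b \<cdot>\<^bsub>K\<^esub> x = x' \<and> y' \<cdot>\<^bsub>K\<^esub> b = c \<cdot>\<^bsub>K\<^esub> y \<and> push K C (Idn K A) \<delta> = pull K c A \<delta>')}"

text \<open>For an exact category, given by an additive category \<open>K\<close> and its class \<open>X\<close> of short exact
  sequences, a sequence is split when it is of the form \<open>A \<rightarrow> A \<oplus> C \<rightarrow> C\<close>.\<close>

definition split_ses :: "('o, 'm, 'z) addcat_scheme \<Rightarrow> 'o \<Rightarrow> 'm \<Rightarrow> 'o \<Rightarrow> 'm \<Rightarrow> 'o \<Rightarrow> bool" where
  "split_ses K A x B y C \<longleftrightarrow> (\<exists>t r. is_biproduct K B A C x t r y)"

definition almost_split_ses ::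
  "('o, 'm, 'z) addcat_scheme \<Rightarrow> ('o, 'm) ses set \<Rightarrow> ('o, 'm) ses set" where
  "almost_split_ses K X =
     {(A, x, B, y, C). (A, x, B, y, C) \<in> X \<and> \<not> split_ses K A x B y C \<and>
        left_factoring K A B x \<and> right_factoring K B C y}"

definition ses_equiv ::
  "('o, 'm, 'z) addcat_scheme \<Rightarrow> ('o, 'm) ses set \<Rightarrow> ('o, 'm) ses rel" where
  "ses_equiv K X =
     {((A, x, B, y, C), (A', x', B', y', C')).
        (A, x, B, y, C) \<in> X \<and> (A', x', B', y', C') \<in> X \<and> A' = A \<and> C' = C \<and>
        (\<exists>b c. is_iso K B B' b \<and> is_iso K C C c \<and>
           b \<cdot>\<^bsub>K\<^esub> x = x' \<and> y' \<cdot>\<^bsub>K\<^esub> b = c \<cdot>\<^bsub>K\<^esub> y)}"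

definition no_summand_in :: "('o, 'm, 'z) addcat_scheme \<Rightarrow> 'o set \<Rightarrow> 'o \<Rightarrow> bool" where
  "no_summand_in K W X \<longleftrightarrow> (\<forall>Y\<in>W. direct_summand K Y X \<longrightarrow> zero_object K Y)"

text \<open>Almost split sequences in the heart, with end terms represented by objects of \<open>\<H>\<close> having no
  nonzero direct summand in \<open>\<W> = \<T> \<inter> \<U>\<close> (taken in the ambient category, not in the heart, where
  the objects of \<open>\<W>\<close> are zero).\<close>

definition heart_almost_split ::
  "('o, 'm, 'e) extricat \<Rightarrow> 'o set \<Rightarrow> 'o set \<Rightarrow> 'o set \<Rightarrow> 'o set \<Rightarrow> ('o, 'm set) ses set" where
  "heart_almost_split K S T U V =
     {(A, x, B, y, C). (A, x, B, y, C) \<in> almost_split_ses (heart K S T U V) (heart_ses K S T U V) \<and>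
        no_summand_in K (T \<inter> U) A \<and> no_summand_in K (T \<inter> U) C}"

end

theory Submission
  imports Defs
begin

text \<open>Put \<open>W = T \<inter> U\<close>. In the heart exactly the morphisms through \<open>W\<close> become zero, and the
  \<open>\<F>\<close>-triangles \<open>A \<rightarrow> B \<rightarrow> C\<close> are those along which such morphisms can be absorbed: a morphism from \<open>A\<close>
  to an object of \<open>W\<close> extends along \<open>x\<close>, and a morphism from an object of \<open>W\<close> to \<open>C\<close> lifts along \<open>y\<close>.
  Therefore a factorization through \<open>x\<close> or \<open>y\<close> that exists in the heart can be corrected by a
  morphism through \<open>W\<close> to one in \<open>\<H>\<close> (\<open>W_monic_factor\<close>, \<open>W_epic_factor\<close>).

  The second ingredient is the Krull-Schmidt property. If \<open>A\<close> has no nonzero summand in \<open>W\<close>, then an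
  endomorphism \<open>w\<close> of \<open>A\<close> through \<open>W\<close> is radical: otherwise an indecomposable summand of \<open>A\<close> would be
  a retract of an object of \<open>W\<close>. Hence \<open>1 + w\<close> is an automorphism (\<open>one_plus_W_iso\<close>), so a morphism out
  of \<open>A\<close> is a section, and a morphism into \<open>A\<close> a retraction, in \<open>\<H>\<close> if and only if it is one in the heart.
  Therefore an \<open>\<F>\<close>-triangle with such end terms is almost split if and only if its image in the heart is
  (\<open>image_almost_split\<close>). The end terms of an almost split \<open>\<F>\<close>-triangle are automatically of this
  kind: if \<open>A = Y \<oplus> Z\<close> with \<open>Y\<close> in \<open>W\<close>, then both idempotents of \<open>A\<close> would kill the extension
  (\<open>almost_split_no_summand\<close>).

  The correspondence is injective because an isomorphism between the images of two almost split
  triangles can be corrected to a \<open>b\<close> with \<open>b x = x'\<close>. The third axiom completes it by an endomorphism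
  \<open>c\<close> of \<open>C\<close> with \<open>c\<^sup>*\<delta>' = \<delta>\<close>. As \<open>\<delta>\<close> is nonzero, \<open>c\<close> does not factor through \<open>y'\<close>, and almost
  splitness forces it to be an automorphism (\<open>almost_split_end_iso\<close>).

  It is surjective because a short exact sequence of the heart is isomorphic to the image of an
  \<open>\<F>\<close>-triangle with possibly different end terms \<open>A'\<close> and \<open>C'\<close>. If \<open>A\<close> and \<open>C\<close> have no nonzero summand
  in \<open>W\<close>, they are retracts of \<open>A'\<close> and \<open>C'\<close> by morphisms that are invertible in the heart. Pushing the
  extension out to \<open>A\<close> and pulling it back to \<open>C\<close> replaces the end terms, and the comparison maps of
  the middle terms stay invertible in the heart (\<open>F_triangle_push\<close>, \<open>F_triangle_pull\<close>).

  The middle terms of \<open>\<F>\<close>-triangles lie in \<open>\<H>\<close> by a horseshoe argument for approximations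
  (\<open>B_plus_extension\<close>). Many statements come in dual pairs. One of them is often obtained from the
  other in the opposite category, whose twin cotorsion pair is \<open>((V, U), (T, S))\<close>.\<close>

section \<open>Calculating in a preadditive category\<close>

text \<open>These are the axioms of an additive category without zero object and biproducts. They hold
  for an additive category and for its ideal quotients, so that the calculus developed from them can
  be used before and after passing to the heart.\<close>

locale preadditive =
  fixes K :: "('o, 'm, 'z) addcat_scheme" (structure)
  assumes hom_disjoint: "\<lbrakk>A \<in> Obj K; B \<in> Obj K; A' \<in> Obj K; B' \<in> Obj K;
      f \<in> mor K A B; f \<in> mor K A' B'\<rbrakk> \<Longrightarrow> A = A' \<and> B = B'"
    and id_mor: "A \<in> Obj K \<Longrightarrow> Idn K A \<in> mor K A A"
    and comp_mor: "\<lbrakk>A \<in> Obj K; B \<in> Obj K; C \<in> Obj K; f \<in> mor K A B; g \<in> mor K B C\<rbrakk>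
      \<Longrightarrow> g \<cdot> f \<in> mor K A C"
    and id_comp: "\<lbrakk>A \<in> Obj K; B \<in> Obj K; f \<in> mor K A B\<rbrakk> \<Longrightarrow> Idn K B \<cdot> f = f"
    and comp_id: "\<lbrakk>A \<in> Obj K; B \<in> Obj K; f \<in> mor K A B\<rbrakk> \<Longrightarrow> f \<cdot> Idn K A = f"
    and comp_assoc: "\<lbrakk>A \<in> Obj K; B \<in> Obj K; C \<in> Obj K; D \<in> Obj K;
      f \<in> mor K A B; g \<in> mor K B C; h \<in> mor K C D\<rbrakk> \<Longrightarrow> (h \<cdot> g) \<cdot> f = h \<cdot> (g \<cdot> f)"
    and hom_comm_group: "\<lbrakk>A \<in> Obj K; B \<in> Obj K\<rbrakk> \<Longrightarrow> comm_group (Hom K A B)"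
    and comp_add_right: "\<lbrakk>A \<in> Obj K; B \<in> Obj K; C \<in> Obj K;
      f \<in> mor K A B; f' \<in> mor K A B; g \<in> mor K B C\<rbrakk>
      \<Longrightarrow> g \<cdot> (f \<otimes>\<^bsub>Hom K A B\<^esub> f') = (g \<cdot> f) \<otimes>\<^bsub>Hom K A C\<^esub> (g \<cdot> f')"
    and comp_add_left: "\<lbrakk>A \<in> Obj K; B \<in> Obj K; C \<in> Obj K;
      f \<in> mor K A B; g \<in> mor K B C; g' \<in> mor K B C\<rbrakk>
      \<Longrightarrow> (g \<otimes>\<^bsub>Hom K B C\<^esub> g') \<cdot> f = (g \<cdot> f) \<otimes>\<^bsub>Hom K A C\<^esub> (g' \<cdot> f)"
begin

text \<open>Morphism sets are disjoint, so a morphism determines its source and target. Taking these as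
  functions makes addition an operation without object indices, and turns the laws of composition and
  addition into conditional rewrite rules whose side conditions have no additional variables. The
  simplifier can then check by itself that the morphisms in an expression are composable.\<close>

definition arr :: "'m \<Rightarrow> bool" where
  "arr f \<longleftrightarrow> (\<exists>A\<in>Obj K. \<exists>B\<in>Obj K. f \<in> mor K A B)"

definition src :: "'m \<Rightarrow> 'o" where
  "src f = (THE A. A \<in> Obj K \<and> (\<exists>B\<in>Obj K. f \<in> mor K A B))"

definition trg :: "'m \<Rightarrow> 'o" where
  "trg f = (THE B. B \<in> Obj K \<and> (\<exists>A\<in>Obj K. f \<in> mor K A B))"

definition add :: "'m \<Rightarrow> 'm \<Rightarrow> 'm"  (infixl "\<oplus>" 65) where
  "f \<oplus> g = f \<otimes>\<^bsub>Hom K (src f) (trg f)\<^esub> g"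

definition neg :: "'m \<Rightarrow> 'm" where
  "neg f = inv\<^bsub>Hom K (src f) (trg f)\<^esub> f"

abbreviation zero :: "'o \<Rightarrow> 'o \<Rightarrow> 'm" where
  "zero A B \<equiv> \<one>\<^bsub>Hom K A B\<^esub>"

lemma src_eq: "\<lbrakk>A \<in> Obj K; B \<in> Obj K; f \<in> mor K A B\<rbrakk> \<Longrightarrow> src f = A"
  unfolding src_def using hom_disjoint by (intro the_equality) blast+

lemma trg_eq: "\<lbrakk>A \<in> Obj K; B \<in> Obj K; f \<in> mor K A B\<rbrakk> \<Longrightarrow> trg f = B"
  unfolding trg_def using hom_disjoint by (intro the_equality) blast+

lemma mor_iff: "\<lbrakk>A \<in> Obj K; B \<in> Obj K\<rbrakk> \<Longrightarrow> f \<in> mor K A B \<longleftrightarrow> arr f \<and> src f = A \<and> trg f = B"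
  using src_eq trg_eq unfolding arr_def by blast

lemma arrE: "arr f \<Longrightarrow> f \<in> mor K (src f) (trg f) \<and> src f \<in> Obj K \<and> trg f \<in> Obj K"
  unfolding arr_def using src_eq trg_eq by blast

lemma src_obj [simp]: "arr f \<Longrightarrow> src f \<in> Obj K"
  and trg_obj [simp]: "arr f \<Longrightarrow> trg f \<in> Obj K"
  using arrE by blast+

lemma arrI: "\<lbrakk>A \<in> Obj K; B \<in> Obj K; f \<in> mor K A B\<rbrakk> \<Longrightarrow> arr f \<and> src f = A \<and> trg f = B"
  using mor_iff by blast

lemma comp_arr [simp]:
  assumes "arr f" "arr g" "src g = trg f"
  shows "arr (g \<cdot> f)" "src (g \<cdot> f) = src f" "trg (g \<cdot> f) = trg g"
  using arrI[OF _ _ comp_mor[of "src f" "trg f" "trg g" f g]] arrE assms by metis+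

lemma id_arr [simp]:
  assumes "A \<in> Obj K"
  shows "arr (Idn K A)" "src (Idn K A) = A" "trg (Idn K A) = A"
  using arrI[OF _ _ id_mor] assms by blast+

lemma zero_arr [simp]:
  assumes "A \<in> Obj K" "B \<in> Obj K"
  shows "arr (zero A B)" "src (zero A B) = A" "trg (zero A B) = B"
proof -
  interpret comm_group "Hom K A B" using hom_comm_group assms by blast
  show "arr (zero A B)" "src (zero A B) = A" "trg (zero A B) = B"
    using arrI[of A B] assms by blast+
qed

lemma add_arr [simp]:
  assumes "arr f" "arr g" "src g = src f" "trg g = trg f"
  shows "arr (f \<oplus> g)" "src (f \<oplus> g) = src f" "trg (f \<oplus> g) = trg f"
proof -
  interpret comm_group "Hom K (src f) (trg f)" using hom_comm_group assms by simp
  have "f \<oplus> g \<in> mor K (src f) (trg f)"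
    unfolding add_def using arrE[of f] arrE[of g] assms by auto
  then show "arr (f \<oplus> g)" "src (f \<oplus> g) = src f" "trg (f \<oplus> g) = trg f"
    using arrI assms by (metis src_obj trg_obj)+
qed

lemma neg_arr [simp]:
  assumes "arr f"
  shows "arr (neg f)" "src (neg f) = src f" "trg (neg f) = trg f"
proof -
  interpret comm_group "Hom K (src f) (trg f)" using hom_comm_group assms by simp
  have "neg f \<in> mor K (src f) (trg f)"
    unfolding neg_def using arrE[of f] assms by auto
  then show "arr (neg f)" "src (neg f) = src f" "trg (neg f) = trg f"
    using arrI assms by (metis src_obj trg_obj)+
qed

lemma comp_id_arr [simp]: "\<lbrakk>arr f; A = src f\<rbrakk> \<Longrightarrow> f \<cdot> Idn K A = f"
  and id_comp_arr [simp]: "\<lbrakk>arr f; A = trg f\<rbrakk> \<Longrightarrow> Idn K A \<cdot> f = f"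
  using arrE[of f] comp_id[of "src f" "trg f" f] id_comp[of "src f" "trg f" f] by auto

lemma comp_assoc_arr:
  "\<lbrakk>arr f; arr g; arr h; src g = trg f; src h = trg g\<rbrakk> \<Longrightarrow> (h \<cdot> g) \<cdot> f = h \<cdot> (g \<cdot> f)"
  using comp_assoc arrE by metis

lemma add_assoc_arr:
  assumes "arr f" "arr g" "arr h" "src g = src f" "trg g = trg f" "src h = src f" "trg h = trg f"
  shows "(f \<oplus> g) \<oplus> h = f \<oplus> (g \<oplus> h)"
proof -
  interpret comm_group "Hom K (src f) (trg f)" using hom_comm_group assms by simp
  show ?thesis using assms arrE[of f] arrE[of g] arrE[of h] by (simp add: add_def[of f] add_def[of g] 
        add_def[of "f \<otimes>\<^bsub>Hom K (src f) (trg f)\<^esub> g"] add_arr(2,3)[of f g, unfolded add_def] m_assoc)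
qed

lemma add_comm_arr:
  assumes "arr f" "arr g" "src g = src f" "trg g = trg f"
  shows "f \<oplus> g = g \<oplus> f"
proof -
  interpret comm_group "Hom K (src f) (trg f)" using hom_comm_group assms by simp
  show ?thesis using assms arrE[of f] arrE[of g] by (simp add: add_def m_comm)
qed

lemma add_left_comm_arr:
  assumes "arr f" "arr g" "arr h" "src g = src f" "trg g = trg f" "src h = src f" "trg h = trg f"
  shows "f \<oplus> (g \<oplus> h) = g \<oplus> (f \<oplus> h)"
  using assms add_assoc_arr[of f g h] add_assoc_arr[of g f h] add_comm_arr[of f g] by simp

lemma add_zero [simp]:
  assumes "arr f" "A = src f" "B = trg f"
  shows "f \<oplus> zero A B = f" "zero A B \<oplus> f = f"
proof -
  interpret comm_group "Hom K (src f) (trg f)" using hom_comm_group assms by simp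
  show 1: "f \<oplus> zero A B = f" using assms arrE[of f] by (simp add: add_def)
  show "zero A B \<oplus> f = f" using assms 1 add_comm_arr[of f "zero A B"] by simp
qed

lemma add_neg [simp]:
  assumes "arr f"
  shows "f \<oplus> neg f = zero (src f) (trg f)" "neg f \<oplus> f = zero (src f) (trg f)"
proof -
  interpret comm_group "Hom K (src f) (trg f)" using hom_comm_group assms by simp
  show 1: "f \<oplus> neg f = zero (src f) (trg f)" using assms arrE[of f] by (simp add: add_def neg_def)
  show "neg f \<oplus> f = zero (src f) (trg f)" using assms 1 add_comm_arr[of f "neg f"] by simp
qed

lemma add_neg_cancel [simp]:
  assumes "arr f" "arr h" "src h = src f" "trg h = trg f"
  shows "f \<oplus> (neg f \<oplus> h) = h" "neg f \<oplus> (f \<oplus> h) = h"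
  using assms add_assoc_arr[of f "neg f" h] add_assoc_arr[of "neg f" f h] by simp_all

lemma neg_unique:
  assumes "arr f" "arr g" "src g = src f" "trg g = trg f" "f \<oplus> g = zero (src f) (trg f)"
  shows "g = neg f"
proof -
  have "g = neg f \<oplus> (f \<oplus> g)" using assms(1-4) by simp
  also have "\<dots> = neg f \<oplus> zero (src f) (trg f)" by (simp only: assms(5))
  also have "\<dots> = neg f" using assms(1-4) by simp
  finally show ?thesis .
qed

lemma neg_neg [simp]: "arr f \<Longrightarrow> neg (neg f) = f"
  by (rule neg_unique[symmetric]) simp_all

lemma neg_add:
  assumes "arr f" "arr g" "src g = src f" "trg g = trg f"
  shows "neg (f \<oplus> g) = neg f \<oplus> neg g"
  using assms by (intro neg_unique[symmetric])
    (simp_all add: add_assoc_arr add_left_comm_arr[of g "neg f"])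

lemma neg_zero [simp]: "\<lbrakk>A \<in> Obj K; B \<in> Obj K\<rbrakk> \<Longrightarrow> neg (zero A B) = zero A B"
  by (rule neg_unique[symmetric]) simp_all

lemma comp_add [simp]:
  assumes "arr f" "arr f'" "arr g" "src f' = src f" "trg f' = trg f" "src g = trg f"
  shows "g \<cdot> (f \<oplus> f') = (g \<cdot> f) \<oplus> (g \<cdot> f')"
proof -
  have "g \<cdot> (f \<otimes>\<^bsub>Hom K (src f) (trg f)\<^esub> f')
      = (g \<cdot> f) \<otimes>\<^bsub>Hom K (src f) (trg g)\<^esub> (g \<cdot> f')"
    using assms arrE[of f] arrE[of f'] arrE[of g] by (intro comp_add_right) auto
  then show ?thesis using assms by (simp add: add_def)
qed

lemma add_comp [simp]:
  assumes "arr f" "arr g" "arr g'" "src g' = src g" "trg g' = trg g" "src g = trg f"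
  shows "(g \<oplus> g') \<cdot> f = (g \<cdot> f) \<oplus> (g' \<cdot> f)"
proof -
  have "(g \<otimes>\<^bsub>Hom K (src g) (trg g)\<^esub> g') \<cdot> f
      = (g \<cdot> f) \<otimes>\<^bsub>Hom K (src f) (trg g)\<^esub> (g' \<cdot> f)"
    using assms arrE[of f] arrE[of g] arrE[of g'] by (intro comp_add_left) auto
  then show ?thesis using assms by (simp add: add_def)
qed

lemma add_left_cancel:
  assumes "arr f" "arr g" "arr h" "src g = src f" "trg g = trg f" "src h = src f" "trg h = trg f"
    and "f \<oplus> g = f \<oplus> h"
  shows "g = h"
proof -
  have "g = neg f \<oplus> (f \<oplus> g)" using assms(1-7) by simp
  also have "\<dots> = neg f \<oplus> (f \<oplus> h)" by (simp only: assms(8))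
  also have "\<dots> = h" using assms(1-7) by simp
  finally show ?thesis .
qed

lemma comp_zero [simp]:
  assumes "arr f" "B = trg f" "C \<in> Obj K"
  shows "zero B C \<cdot> f = zero (src f) C"
proof (rule add_left_cancel[of "zero B C \<cdot> f"])
  have "zero B C \<cdot> f \<oplus> zero B C \<cdot> f = (zero B C \<oplus> zero B C) \<cdot> f"
    using assms by (intro add_comp[symmetric]) simp_all
  also have "\<dots> = zero B C \<cdot> f \<oplus> zero (src f) C" using assms by simp
  finally show "zero B C \<cdot> f \<oplus> zero B C \<cdot> f = zero B C \<cdot> f \<oplus> zero (src f) C" .
qed (use assms in simp_all)

lemma zero_comp [simp]:
  assumes "arr f" "B = src f" "A \<in> Obj K"
  shows "f \<cdot> zero A B = zero A (trg f)"
proof (rule add_left_cancel[of "f \<cdot> zero A B"])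
  have "f \<cdot> zero A B \<oplus> f \<cdot> zero A B = f \<cdot> (zero A B \<oplus> zero A B)"
    using assms by (intro comp_add[symmetric]) simp_all
  also have "\<dots> = f \<cdot> zero A B \<oplus> zero A (trg f)" using assms by simp
  finally show "f \<cdot> zero A B \<oplus> f \<cdot> zero A B = f \<cdot> zero A B \<oplus> zero A (trg f)" .
qed (use assms in simp_all)

lemma comp_neg [simp]:
  assumes "arr f" "arr g" "src g = trg f"
  shows "g \<cdot> neg f = neg (g \<cdot> f)" "neg g \<cdot> f = neg (g \<cdot> f)"
proof -
  have "g \<cdot> f \<oplus> g \<cdot> neg f = zero (src (g \<cdot> f)) (trg (g \<cdot> f))"
    using assms by (subst comp_add[symmetric]) simp_all
  then show "g \<cdot> neg f = neg (g \<cdot> f)"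
    using assms by (intro neg_unique) simp_all
  have "g \<cdot> f \<oplus> neg g \<cdot> f = zero (src (g \<cdot> f)) (trg (g \<cdot> f))"
    using assms by (subst add_comp[symmetric]) simp_all
  then show "neg g \<cdot> f = neg (g \<cdot> f)"
    using assms by (intro neg_unique) simp_all
qed

lemmas arith = comp_assoc_arr add_assoc_arr add_comm_arr add_left_comm_arr neg_add

end

section \<open>Isomorphisms and Krull-Schmidt decompositions\<close>

context preadditive
begin

lemma add_neg_cancel_mid [simp]:
  assumes "arr f" "arr h" "src h = src f" "trg h = trg f"
  shows "f \<oplus> (h \<oplus> neg f) = h"
proof -
  have "f \<oplus> (h \<oplus> neg f) = f \<oplus> (neg f \<oplus> h)"
    by (subst add_comm_arr[of h]) (use assms in simp_all)
  then show ?thesis using assms by simp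
qed

lemma hom_mult_eq_add:
  "\<lbrakk>A \<in> Obj K; B \<in> Obj K; f \<in> mor K A B\<rbrakk> \<Longrightarrow> f \<otimes>\<^bsub>Hom K A B\<^esub> g = f \<oplus> g"
  by (simp add: mor_iff add_def)

lemma is_isoI:
  assumes "A \<in> Obj K" "B \<in> Obj K" "f \<in> mor K A B"
    and "l \<in> mor K B A" "l \<cdot> f = Idn K A" "r \<in> mor K B A" "f \<cdot> r = Idn K B"
  shows "is_iso K A B f"
proof -
  have "l = l \<cdot> (f \<cdot> r)" using assms by (simp add: mor_iff)
  also have "\<dots> = (l \<cdot> f) \<cdot> r" using assms(1-4,6) by (simp add: mor_iff comp_assoc_arr)
  also have "\<dots> = r" using assms by (simp add: mor_iff)
  finally show ?thesis using assms unfolding is_iso_def by blast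
qed

lemma is_isoE:
  assumes "is_iso K A B f"
  obtains g where "f \<in> mor K A B" "g \<in> mor K B A" "g \<cdot> f = Idn K A" "f \<cdot> g = Idn K B"
    "is_iso K B A g"
  using assms unfolding is_iso_def by blast

lemma is_iso_Idn: "A \<in> Obj K \<Longrightarrow> is_iso K A A (Idn K A)"
  by (rule is_isoI[where l = "Idn K A" and r = "Idn K A"]) (simp_all add: mor_iff)

lemma is_iso_comp:
  assumes "A \<in> Obj K" "B \<in> Obj K" "C \<in> Obj K" "is_iso K A B f" "is_iso K B C g"
  shows "is_iso K A C (g \<cdot> f)"
proof -
  obtain f' where f: "f \<in> mor K A B" "f' \<in> mor K B A" "f' \<cdot> f = Idn K A" "f \<cdot> f' = Idn K B"
    using assms(4) by (rule is_isoE)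
  obtain g' where g: "g \<in> mor K B C" "g' \<in> mor K C B" "g' \<cdot> g = Idn K B" "g \<cdot> g' = Idn K C"
    using assms(5) by (rule is_isoE)
  note ar = f(1,2) g(1,2)
  have "(f' \<cdot> g') \<cdot> (g \<cdot> f) = f' \<cdot> ((g' \<cdot> g) \<cdot> f)" "(g \<cdot> f) \<cdot> (f' \<cdot> g') = g \<cdot> ((f \<cdot> f') \<cdot> g')"
    using ar assms(1-3) by (simp_all add: mor_iff comp_assoc_arr)
  then show ?thesis
    using f g assms(1-3)
    by (intro is_isoI[where l = "f' \<cdot> g'" and r = "f' \<cdot> g'"]) (simp_all add: mor_iff)
qed

lemma is_iso_unipotent:
  assumes "B \<in> Obj K" "k \<in> mor K B B" "k \<cdot> k = zero B B"
  shows "is_iso K B B (Idn K B \<oplus> k)"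
  using assms by (intro is_isoI[where l = "Idn K B \<oplus> neg k" and r = "Idn K B \<oplus> neg k"])
    (simp_all add: mor_iff arith)

lemma is_iso_neg:
  assumes "A \<in> Obj K" "B \<in> Obj K" "is_iso K A B f"
  shows "is_iso K A B (neg f)"
proof -
  obtain g where "f \<in> mor K A B" "g \<in> mor K B A" "g \<cdot> f = Idn K A" "f \<cdot> g = Idn K B"
    using assms(3) by (rule is_isoE)
  then show ?thesis using assms(1,2)
    by (intro is_isoI[where l = "neg g" and r = "neg g"]) (simp_all add: mor_iff)
qed

text \<open>The identity is the sum of \<open>1 + f\<close> and \<open>-f\<close>, so in a local ring these are not both
  non-units.\<close>

lemma local_end_one_plus:
  assumes "Y \<in> Obj K" "local_end K Y" "f \<in> mor K Y Y" "\<not> is_iso K Y Y f"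
  shows "is_iso K Y Y (Idn K Y \<oplus> f)"
proof (rule ccontr)
  assume "\<not> is_iso K Y Y (Idn K Y \<oplus> f)"
  moreover have "\<not> is_iso K Y Y (neg f)"
    using is_iso_neg[of Y Y "neg f"] assms(1,3,4) by (auto simp: mor_iff)
  moreover have "(Idn K Y \<oplus> f) \<otimes>\<^bsub>Hom K Y Y\<^esub> neg f = Idn K Y"
    using assms(1,3) by (subst hom_mult_eq_add) (simp_all add: mor_iff arith)
  moreover have "Idn K Y \<oplus> f \<in> mor K Y Y" "neg f \<in> mor K Y Y"
    using assms(1,3) by (simp_all add: mor_iff)
  ultimately show False
    using assms(1,2) is_iso_Idn unfolding local_end_def by metis
qed

lemma comp_finprod:
  assumes "A \<in> Obj K" "B \<in> Obj K" "C \<in> Obj K" "g \<in> mor K B C" "finite I"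
    and "\<And>l. l \<in> I \<Longrightarrow> f l \<in> mor K A B"
  shows "g \<cdot> (\<Otimes>\<^bsub>Hom K A B\<^esub>l\<in>I. f l) = (\<Otimes>\<^bsub>Hom K A C\<^esub>l\<in>I. g \<cdot> f l)"
proof -
  interpret AB: comm_group "Hom K A B" using hom_comm_group assms by simp
  interpret AC: comm_group "Hom K A C" using hom_comm_group assms by simp
  show ?thesis using assms(5,6)
  proof (induction I)
    case empty
    then show ?case using assms(1-4) by (simp add: mor_iff)
  next
    case (insert m I)
    have "(\<lambda>l. g \<cdot> f l) \<in> insert m I \<rightarrow> mor K A C"
      using insert.prems assms(1-4) comp_mor by blast
    then show ?case
      using insert assms(1-4) by (simp add: comp_add_right Pi_def AB.finprod_closed)
  qed
qed

lemma finprod_comp: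
  assumes "A \<in> Obj K" "B \<in> Obj K" "C \<in> Obj K" "g \<in> mor K A B" "finite I"
    and "\<And>l. l \<in> I \<Longrightarrow> f l \<in> mor K B C"
  shows "(\<Otimes>\<^bsub>Hom K B C\<^esub>l\<in>I. f l) \<cdot> g = (\<Otimes>\<^bsub>Hom K A C\<^esub>l\<in>I. f l \<cdot> g)"
proof -
  interpret BC: comm_group "Hom K B C" using hom_comm_group assms by simp
  interpret AC: comm_group "Hom K A C" using hom_comm_group assms by simp
  show ?thesis using assms(5,6)
  proof (induction I)
    case empty
    then show ?case using assms(1-4) by (simp add: mor_iff)
  next
    case (insert m I)
    have "(\<lambda>l. f l \<cdot> g) \<in> insert m I \<rightarrow> mor K A C"
      using insert.prems assms(1-4) comp_mor by blast
    then show ?case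
      using insert assms(1-4) by (simp add: comp_add_left Pi_def BC.finprod_closed)
  qed
qed

definition decomposition :: "'o \<Rightarrow> 'i set \<Rightarrow> ('i \<Rightarrow> 'o) \<Rightarrow> ('i \<Rightarrow> 'm) \<Rightarrow> ('i \<Rightarrow> 'm) \<Rightarrow> bool" where
  "decomposition X I Y i p \<longleftrightarrow> X \<in> Obj K \<and> finite I \<and>
     (\<forall>k\<in>I. Y k \<in> Obj K \<and> i k \<in> mor K (Y k) X \<and> p k \<in> mor K X (Y k)) \<and>
     (\<forall>k\<in>I. \<forall>l\<in>I. p k \<cdot> i l = (if k = l then Idn K (Y k) else zero (Y l) (Y k))) \<and>
     (\<Otimes>\<^bsub>Hom K X X\<^esub>k\<in>I. i k \<cdot> p k) = Idn K X"

lemma decomposition_ext: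
  assumes "decomposition X I Y i p" "C \<in> Obj K" "f \<in> mor K X C" "g \<in> mor K X C"
    and "\<And>k. k \<in> I \<Longrightarrow> f \<cdot> i k = g \<cdot> i k"
  shows "f = g"
proof -
  interpret comm_group "Hom K X C"
    using hom_comm_group assms(1,2) unfolding decomposition_def by simp
  have 1: "h = (\<Otimes>\<^bsub>Hom K X C\<^esub>k\<in>I. h \<cdot> (i k \<cdot> p k))" if "h \<in> mor K X C" for h
  proof -
    have "i k \<cdot> p k \<in> mor K X X" if "k \<in> I" for k
      using assms(1) that comp_mor unfolding decomposition_def by blast
    then have "h \<cdot> (\<Otimes>\<^bsub>Hom K X X\<^esub>k\<in>I. i k \<cdot> p k) = (\<Otimes>\<^bsub>Hom K X C\<^esub>k\<in>I. h \<cdot> (i k \<cdot> p k))"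
      using that assms(1,2) unfolding decomposition_def by (intro comp_finprod) auto
    then show ?thesis using that assms(1,2) comp_id unfolding decomposition_def by simp
  qed
  have "f \<cdot> (i k \<cdot> p k) = g \<cdot> (i k \<cdot> p k)" if "k \<in> I" for k
  proof -
    have "X \<in> Obj K" "Y k \<in> Obj K" "i k \<in> mor K (Y k) X" "p k \<in> mor K X (Y k)"
      using assms(1) that unfolding decomposition_def by auto
    then show ?thesis
      using assms(2-4) assms(5)[OF that] by (simp add: mor_iff comp_assoc_arr[symmetric])
  qed
  then have "(\<Otimes>\<^bsub>Hom K X C\<^esub>k\<in>I. f \<cdot> (i k \<cdot> p k)) = (\<Otimes>\<^bsub>Hom K X C\<^esub>k\<in>I. g \<cdot> (i k \<cdot> p k))"
  proof (intro finprod_cong'[OF refl])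
    show "(\<lambda>k. g \<cdot> (i k \<cdot> p k)) \<in> I \<rightarrow> mor K X C"
    proof
      fix k assume "k \<in> I"
      then have "X \<in> Obj K" "Y k \<in> Obj K" "i k \<in> mor K (Y k) X" "p k \<in> mor K X (Y k)"
        using assms(1) unfolding decomposition_def by auto
      then show "g \<cdot> (i k \<cdot> p k) \<in> mor K X C" using assms(2,4) by (simp add: mor_iff)
    qed
  qed
  then show ?thesis using 1[OF assms(3)] 1[OF assms(4)] by metis
qed

text \<open>Membership in the Jacobson radical of \<open>End(X)\<close> can be tested on the diagonal entries with
  respect to a decomposition into objects with local endomorphism rings. The proof is Gaussian
  elimination on \<open>1 + w\<close>: the pivot \<open>1 + p\<^sub>k w i\<^sub>k\<close> is invertible because \<open>p\<^sub>k w i\<^sub>k\<close> is a non-unit of a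
  local ring, and all row operations are of the form \<open>1 + j\<close> with \<open>j\<close> in the ideal \<open>J\<close>. So \<open>1 + w\<close> has
  a left inverse of the form \<open>1 + j\<close>, which in turn has a left inverse for the same reason.\<close>

lemma is_iso_one_plus_radical:
  assumes dec: "decomposition X I Y i p" and loc: "\<And>k. k \<in> I \<Longrightarrow> local_end K (Y k)"
    and J: "J \<subseteq> mor K X X" "\<And>f g. f \<in> J \<Longrightarrow> g \<in> J \<Longrightarrow> f \<oplus> g \<in> J"
      "\<And>f g. f \<in> mor K X X \<Longrightarrow> g \<in> J \<Longrightarrow> f \<cdot> g \<in> J"
      "\<And>f g. f \<in> J \<Longrightarrow> g \<in> mor K X X \<Longrightarrow> f \<cdot> g \<in> J"
    and rad: "\<And>w k. w \<in> J \<Longrightarrow> k \<in> I \<Longrightarrow> \<not> is_iso K (Y k) (Y k) (p k \<cdot> w \<cdot> i k)"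
    and w: "w \<in> J"
  shows "is_iso K X X (Idn K X \<oplus> w)"
proof -
  have X: "X \<in> Obj K" and fin: "finite I"
    and Y: "\<And>k. k \<in> I \<Longrightarrow> Y k \<in> Obj K" "\<And>k. k \<in> I \<Longrightarrow> i k \<in> mor K (Y k) X"
      "\<And>k. k \<in> I \<Longrightarrow> p k \<in> mor K X (Y k)"
    and orth: "\<And>k l. k \<in> I \<Longrightarrow> l \<in> I \<Longrightarrow>
      p k \<cdot> i l = (if k = l then Idn K (Y k) else zero (Y l) (Y k))"
    using dec unfolding decomposition_def by blast+
  note [simp] = X
  have JD: "arr f" "src f = X" "trg f = X" if "f \<in> J" for f
    using that J(1) by (auto simp: mor_iff)
  have YD: "arr (i k)" "src (i k) = Y k" "trg (i k) = X" "arr (p k)" "src (p k) = X" "trg (p k) = Y k"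
    if "k \<in> I" for k using Y[OF that] by (simp_all add: mor_iff)
  have neg_J: "neg f \<in> J" if "f \<in> J" for f
    using J(3)[OF _ that, of "neg (Idn K X)"] JD[OF that] by (simp add: mor_iff)
  \<comment> \<open>After the step for \<open>k\<close> the product fixes the inclusion of \<open>Y\<^sub>k\<close> as well as all earlier ones.\<close>
  have left_inverse: "\<exists>j\<in>J. (Idn K X \<oplus> j) \<cdot> (Idn K X \<oplus> w) = Idn K X" if w: "w \<in> J" for w
  proof -
    have "\<exists>j\<in>J. \<forall>l\<in>I'. ((Idn K X \<oplus> j) \<cdot> (Idn K X \<oplus> w)) \<cdot> i l = i l"
      if "finite I'" "I' \<subseteq> I" for I'
      using that
    proof (induction I')
      case empty
      show ?case using w by blast
    next
      case (insert k I')
      then obtain j where j: "j \<in> J" "\<And>l. l \<in> I' \<Longrightarrow> ((Idn K X \<oplus> j) \<cdot> (Idn K X \<oplus> w)) \<cdot> i l = i l"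
        by auto
      have k: "k \<in> I" and sub: "I' \<subseteq> I" using insert.prems by auto
      define w' where "w' = j \<oplus> (w \<oplus> j \<cdot> w)"
      have w': "w' \<in> J"
        unfolding w'_def using j(1) w J(1) by (intro J(2,3)) auto
      have jw: "(Idn K X \<oplus> j) \<cdot> (Idn K X \<oplus> w) = Idn K X \<oplus> w'"
        unfolding w'_def using JD[OF w] JD[OF j(1)] by (simp add: arith)
      have w'_i: "w' \<cdot> i l = zero (Y l) X" if "l \<in> I'" for l
      proof (rule add_left_cancel[of "i l"])
        show "i l \<oplus> w' \<cdot> i l = i l \<oplus> zero (Y l) X"
          using j(2)[OF that] that sub JD[OF w'] YD[of l] Y(1) unfolding jw by auto
      qed (use that sub JD[OF w'] YD[of l] Y(1) in auto)
      define \<phi> where "\<phi> = Idn K (Y k) \<oplus> p k \<cdot> w' \<cdot> i k"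
      have "is_iso K (Y k) (Y k) \<phi>"
        unfolding \<phi>_def
        using loc[OF k] rad[OF w' k] Y(1)[OF k] JD[OF w'] YD[OF k]
        by (intro local_end_one_plus) (simp_all add: mor_iff)
      then obtain \<psi> where \<psi>: "\<psi> \<in> mor K (Y k) (Y k)" "\<psi> \<cdot> \<phi> = Idn K (Y k)"
        by (rule is_isoE)
      have \<psi>': "arr \<psi>" "src \<psi> = Y k" "trg \<psi> = Y k"
        using \<psi>(1) Y(1)[OF k] by (simp_all add: mor_iff)
      note ar = JD[OF w'] YD[OF k] \<psi>' Y(1)[OF k]
      define t where "t = neg (w' \<cdot> (i k \<cdot> \<psi> \<cdot> p k))"
      have t: "t \<in> J"
        unfolding t_def by (rule neg_J, rule J(4)[OF w']) (use ar in \<open>simp add: mor_iff\<close>)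
      have pk: "p k \<cdot> ((Idn K X \<oplus> w') \<cdot> i k) = \<phi>"
        unfolding \<phi>_def using ar orth[OF k k] by (simp add: comp_assoc_arr)
      have elim: "((Idn K X \<oplus> t) \<cdot> (Idn K X \<oplus> w')) \<cdot> i l = i l" if l: "l \<in> insert k I'" for l
      proof (cases "l = k")
        case True
        have "t \<cdot> ((Idn K X \<oplus> w') \<cdot> i k) = neg (w' \<cdot> (i k \<cdot> (\<psi> \<cdot> (p k \<cdot> ((Idn K X \<oplus> w') \<cdot> i k)))))"
          unfolding t_def using ar by (simp add: arith)
        also have "\<dots> = neg (w' \<cdot> i k)"
          unfolding pk \<psi>(2) using ar by simp
        finally have "t \<cdot> ((Idn K X \<oplus> w') \<cdot> i k) = neg (w' \<cdot> i k)" .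
        moreover have "((Idn K X \<oplus> t) \<cdot> (Idn K X \<oplus> w')) \<cdot> i k
            = (Idn K X \<oplus> w') \<cdot> i k \<oplus> t \<cdot> ((Idn K X \<oplus> w') \<cdot> i k)"
          using ar JD[OF t] by (simp add: arith)
        ultimately show ?thesis using ar True by (simp add: arith)
      next
        case False
        then have l': "l \<in> I'" and lI: "l \<in> I" using l sub by auto
        have "t \<cdot> i l = neg (w' \<cdot> (i k \<cdot> (\<psi> \<cdot> (p k \<cdot> i l))))"
          unfolding t_def using ar YD[OF lI] by (simp add: arith)
        also have "\<dots> = zero (Y l) X"
          using orth[OF k lI] False ar YD[OF lI] Y(1)[OF lI] by simp
        finally have "t \<cdot> i l = zero (Y l) X" .
        moreover have "((Idn K X \<oplus> t) \<cdot> (Idn K X \<oplus> w')) \<cdot> i l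
            = i l \<oplus> t \<cdot> i l \<oplus> (w' \<cdot> i l \<oplus> t \<cdot> (w' \<cdot> i l))"
          using ar JD[OF t] YD[OF lI] by (simp add: arith)
        ultimately show ?thesis using w'_i[OF l'] YD[OF lI] Y(1)[OF lI] JD[OF t] by simp
      qed
      have "t \<oplus> (j \<oplus> t \<cdot> j) \<in> J" using t j(1) J(1) by (intro J(2,3)) auto
      moreover have "((Idn K X \<oplus> (t \<oplus> (j \<oplus> t \<cdot> j))) \<cdot> (Idn K X \<oplus> w)) = (Idn K X \<oplus> t) \<cdot> (Idn K X \<oplus> w')"
        unfolding jw[symmetric] using JD[OF t] JD[OF j(1)] JD[OF w] by (simp add: arith)
      ultimately show ?case using elim by metis
    qed
    from this[OF fin subset_refl] obtain j where
      j: "j \<in> J" "\<And>l. l \<in> I \<Longrightarrow> ((Idn K X \<oplus> j) \<cdot> (Idn K X \<oplus> w)) \<cdot> i l = i l" by blast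
    have "(Idn K X \<oplus> j) \<cdot> (Idn K X \<oplus> w) = Idn K X"
      by (rule decomposition_ext[OF dec X]) (use j JD[OF w] JD[OF j(1)] YD in \<open>simp_all add: mor_iff\<close>)
    then show ?thesis using j(1) by blast
  qed
  obtain j where j: "j \<in> J" "(Idn K X \<oplus> j) \<cdot> (Idn K X \<oplus> w) = Idn K X"
    using left_inverse[OF w] by blast
  obtain j' where j': "j' \<in> J" "(Idn K X \<oplus> j') \<cdot> (Idn K X \<oplus> j) = Idn K X"
    using left_inverse[OF j(1)] by blast
  have "is_iso K X X (Idn K X \<oplus> j)"
    by (rule is_isoI[where l = "Idn K X \<oplus> j'" and r = "Idn K X \<oplus> w"])
      (use j(2) j'(2) JD[OF w] JD[OF j(1)] JD[OF j'(1)] in \<open>simp_all add: mor_iff\<close>)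
  then obtain v where v: "v \<in> mor K X X" "v \<cdot> (Idn K X \<oplus> j) = Idn K X" "(Idn K X \<oplus> j) \<cdot> v = Idn K X"
    by (rule is_isoE)
  have v': "arr v" "src v = X" "trg v = X" using v(1) by (simp_all add: mor_iff)
  have "Idn K X \<oplus> w = (v \<cdot> (Idn K X \<oplus> j)) \<cdot> (Idn K X \<oplus> w)"
    unfolding v(2) using JD[OF w] by simp
  also have "\<dots> = v \<cdot> ((Idn K X \<oplus> j) \<cdot> (Idn K X \<oplus> w))"
    using v' JD[OF w] JD[OF j(1)] by (intro comp_assoc_arr) simp_all
  also have "\<dots> = v" unfolding j(2) using v' by simp
  finally have "Idn K X \<oplus> w = v" .
  moreover have "is_iso K X X v"
    by (rule is_isoI[where l = "Idn K X \<oplus> j" and r = "Idn K X \<oplus> j"])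
      (use v v' JD[OF j(1)] in \<open>simp_all add: mor_iff\<close>)
  ultimately show ?thesis by simp
qed

end

sublocale additive_category \<subseteq> preadditive K
  by (rule preadditive.intro; (rule Hom_disjoint Idn_closed Cmp_closed Idn_left Idn_right Cmp_assoc
      Hom_comm_group Cmp_add_right Cmp_add_left; assumption))

context additive_category
begin

lemma zero_object_Idn:
  assumes "zero_object K Z"
  shows "Idn K Z = zero Z Z"
  using assms unfolding zero_object_def by (metis id_mor mor_iff zero_arr)

text \<open>The data of a Krull-Schmidt decomposition do not include an object complementary to one
  summand. It is built from the other summands one at a time; the object obtained so far is
  characterized as splitting the sum of their idempotents, since this determines how it interacts with
  the next summand.\<close>

lemma split_summands:
  assumes "X \<in> Obj K" "finite I"
    and "\<And>l. l \<in> I \<Longrightarrow> Y l \<in> Obj K \<and> i l \<in> mor K (Y l) X \<and> p l \<in> mor K X (Y l)"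
    and "\<And>k l. k \<in> I \<Longrightarrow> l \<in> I \<Longrightarrow> p k \<cdot> i l = (if k = l then Idn K (Y k) else zero (Y l) (Y k))"
  shows "\<exists>Z\<in>Obj K. \<exists>j\<in>mor K Z X. \<exists>q\<in>mor K X Z.
    q \<cdot> j = Idn K Z \<and> j \<cdot> q = (\<Otimes>\<^bsub>Hom K X X\<^esub>l\<in>I. i l \<cdot> p l)"
  using assms(2-)
proof (induction I)
  case empty
  have cm: "comm_monoid (Hom K X X)" by (rule comm_group.axioms(1)[OF hom_comm_group[OF assms(1) assms(1)]])
  obtain Z where Z: "zero_object K Z" using ex_zero_object by blast
  then have Z0: "Z \<in> Obj K" unfolding zero_object_def by blast
  have "zero Z X \<in> mor K Z X" "zero X Z \<in> mor K X Z" "zero X Z \<cdot> zero Z X = Idn K Z"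
    "zero Z X \<cdot> zero X Z = (\<Otimes>\<^bsub>Hom K X X\<^esub>l\<in>{}. i l \<cdot> p l)"
    using zero_object_Idn[OF Z] assms(1) Z0
    by (simp_all add: mor_iff comm_monoid.finprod_empty[OF cm])
  then show ?case using Z0 by blast
next
  case (insert m I)
  have cm: "comm_monoid (Hom K X X)" by (rule comm_group.axioms(1)[OF hom_comm_group[OF assms(1) assms(1)]])
  have ty: "Y l \<in> Obj K" "arr (i l)" "src (i l) = Y l" "trg (i l) = X"
     "arr (p l)" "src (p l) = X" "trg (p l) = Y l" if "l \<in> insert m I" for l
    using insert.prems(1)[OF that] assms(1) by (auto simp: mor_iff)
  obtain Z j q where Z: "Z \<in> Obj K" "j \<in> mor K Z X" "q \<in> mor K X Z" "q \<cdot> j = Idn K Z"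
    and jq: "j \<cdot> q = (\<Otimes>\<^bsub>Hom K X X\<^esub>l\<in>I. i l \<cdot> p l)"
    using insert.IH[OF insert.prems(1) insert.prems(2)] by auto
  have ip: "i l \<cdot> p l \<in> mor K X X" if "l \<in> insert m I" for l
    using ty[OF that] assms(1) by (simp add: mor_iff)
  have Zt: "arr j" "src j = Z" "trg j = X" "arr q" "src q = X" "trg q = Z"
    using Z assms(1) by (simp_all add: mor_iff)
  note tm = ty[OF insertI1]
  have cm': "comm_monoid (Hom K A B)" if "A \<in> Obj K" "B \<in> Obj K" for A B
    by (rule comm_group.axioms(1)[OF hom_comm_group[OF that]])
  have "i l \<cdot> p l \<cdot> i m = zero (Y m) X" if "l \<in> I" for l
    using that insert.hyps(2) insert.prems(2)[of l m] ty[of l] tm assms(1)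
    by (auto simp: comp_assoc_arr)
  then have jqi: "j \<cdot> q \<cdot> i m = zero (Y m) X"
    unfolding jq using insert assms(1) ip
    by (subst finprod_comp[of "Y m" X X "i m"]) (auto intro!: comm_monoid.finprod_one_eqI[OF cm'] simp: tm)
  have "p m \<cdot> (i l \<cdot> p l) = zero X (Y m)" if "l \<in> I" for l
    using that insert.hyps(2) insert.prems(2)[of m l] ty[of l] tm assms(1)
    by (auto simp: comp_assoc_arr[symmetric])
  then have pjq: "p m \<cdot> (j \<cdot> q) = zero X (Y m)"
    unfolding jq using insert assms(1) ip
    by (subst comp_finprod[of X X "Y m" "p m"]) (auto intro!: comm_monoid.finprod_one_eqI[OF cm'] simp: tm)
  have "q \<cdot> i m = q \<cdot> (j \<cdot> q \<cdot> i m)"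
    using Zt tm Z(4) by (simp add: comp_assoc_arr[symmetric])
  then have qi: "q \<cdot> i m = zero (Y m) Z" using jqi Zt tm Z(1) by simp
  have "p m \<cdot> j = p m \<cdot> (j \<cdot> q) \<cdot> j"
    using Zt tm Z(4) by (simp add: comp_assoc_arr)
  then have pj: "p m \<cdot> j = zero Z (Y m)" using pjq Zt tm Z(1) by simp
  obtain Z' iz iy pz py where "is_biproduct K Z' Z (Y m) iz iy pz py"
    using ex_biproduct[OF Z(1) tm(1)] by blast
  then have Z': "Z' \<in> Obj K" "iz \<in> mor K Z Z'" "iy \<in> mor K (Y m) Z'" "pz \<in> mor K Z' Z"
      "py \<in> mor K Z' (Y m)" "pz \<cdot> iz = Idn K Z" "py \<cdot> iy = Idn K (Y m)" "pz \<cdot> iy = zero (Y m) Z"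
      "py \<cdot> iz = zero Z (Y m)" and sum: "(iz \<cdot> pz) \<otimes>\<^bsub>Hom K Z' Z'\<^esub> (iy \<cdot> py) = Idn K Z'"
    unfolding is_biproduct_def by auto
  then have Z't: "arr iz" "src iz = Z" "trg iz = Z'" "arr iy" "src iy = Y m" "trg iy = Z'"
      "arr pz" "src pz = Z'" "trg pz = Z" "arr py" "src py = Z'" "trg py = Y m"
    using Z(1) tm(1) by (simp_all add: mor_iff)
  have sum': "(iz \<cdot> pz) \<oplus> (iy \<cdot> py) = Idn K Z'" using sum Z't by (simp add: add_def)
  define j' where "j' = j \<cdot> pz \<oplus> i m \<cdot> py"
  define q' where "q' = iz \<cdot> q \<oplus> iy \<cdot> p m"
  note t = Zt tm Z't Z(1) Z'(1)
  have "q' \<cdot> j' = iz \<cdot> (q \<cdot> j) \<cdot> pz \<oplus> (iz \<cdot> (q \<cdot> i m) \<cdot> py \<oplus>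
      (iy \<cdot> (p m \<cdot> j) \<cdot> pz \<oplus> iy \<cdot> (p m \<cdot> i m) \<cdot> py))"
    unfolding j'_def q'_def using t by (simp add: arith)
  also have "\<dots> = iz \<cdot> pz \<oplus> iy \<cdot> py"
    using t Z(4) qi pj insert.prems(2)[of m m] by simp
  finally have qj': "q' \<cdot> j' = Idn K Z'" using sum' by simp
  have "j' \<cdot> q' = j \<cdot> (pz \<cdot> iz) \<cdot> q \<oplus> (j \<cdot> (pz \<cdot> iy) \<cdot> p m \<oplus>
      (i m \<cdot> (py \<cdot> iz) \<cdot> q \<oplus> i m \<cdot> (py \<cdot> iy) \<cdot> p m))"
    unfolding j'_def q'_def using t by (simp add: arith)
  also have "\<dots> = j \<cdot> q \<oplus> i m \<cdot> p m"
    using t Z'(6-9) assms(1) by simp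
  also have "\<dots> = i m \<cdot> p m \<oplus> j \<cdot> q" using t by (intro add_comm_arr) simp_all
  also have "\<dots> = (\<Otimes>\<^bsub>Hom K X X\<^esub>l\<in>insert m I. i l \<cdot> p l)"
    using insert.hyps ip t by (simp add: jq[symmetric] add_def Pi_def comm_monoid.finprod_insert[OF cm])
  finally have "j' \<cdot> q' = (\<Otimes>\<^bsub>Hom K X X\<^esub>l\<in>insert m I. i l \<cdot> p l)" .
  moreover have "j' \<in> mor K Z' X" "q' \<in> mor K X Z'"
    using t assms(1) by (simp_all add: mor_iff j'_def q'_def)
  ultimately show ?case using qj' Z'(1) by blast
qed

lemma decomposition_summand:
  assumes dec: "decomposition X I Y i p" and k: "k \<in> I"
  shows "direct_summand K (Y k) X"
proof -
  have X: "X \<in> Obj K" and fin: "finite I"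
    and Y: "\<And>k. k \<in> I \<Longrightarrow> Y k \<in> Obj K \<and> i k \<in> mor K (Y k) X \<and> p k \<in> mor K X (Y k)"
    and orth: "\<And>k l. k \<in> I \<Longrightarrow> l \<in> I \<Longrightarrow>
      p k \<cdot> i l = (if k = l then Idn K (Y k) else zero (Y l) (Y k))"
    and sum: "(\<Otimes>\<^bsub>Hom K X X\<^esub>k\<in>I. i k \<cdot> p k) = Idn K X"
    using dec unfolding decomposition_def by blast+
  have cm: "comm_monoid (Hom K X X)" by (rule comm_group.axioms(1)[OF hom_comm_group[OF X X]])
  obtain Z j q where Z: "Z \<in> Obj K" "j \<in> mor K Z X" "q \<in> mor K X Z" "q \<cdot> j = Idn K Z"
    and jq: "j \<cdot> q = (\<Otimes>\<^bsub>Hom K X X\<^esub>l\<in>I - {k}. i l \<cdot> p l)"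
    using split_summands[of X "I - {k}" Y i p] X fin Y orth by auto
  have ip: "i l \<cdot> p l \<in> mor K X X" if "l \<in> I" for l
    using Y[OF that] X comp_mor by blast
  have sum': "(i k \<cdot> p k) \<otimes>\<^bsub>Hom K X X\<^esub> (j \<cdot> q) = Idn K X"
  proof -
    have "(\<Otimes>\<^bsub>Hom K X X\<^esub>l\<in>insert k (I - {k}). i l \<cdot> p l) = (i k \<cdot> p k) \<otimes>\<^bsub>Hom K X X\<^esub> (j \<cdot> q)"
      unfolding jq using fin ip k by (intro comm_monoid.finprod_insert[OF cm]) auto
    then show ?thesis using sum k by (simp add: insert_absorb)
  qed
  have t: "Y k \<in> Obj K" "arr (i k)" "src (i k) = Y k" "trg (i k) = X"
     "arr (p k)" "src (p k) = X" "trg (p k) = Y k"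
     "arr j" "src j = Z" "trg j = X" "arr q" "src q = X" "trg q = Z"
    using Y[OF k] Z X by (auto simp: mor_iff)
  have sum2: "i k \<cdot> p k \<oplus> j \<cdot> q = Idn K X" using sum' t by (simp add: add_def)
  have pi: "p k \<cdot> i k = Idn K (Y k)" using orth[OF k k] by simp
  have pj: "p k \<cdot> j = zero Z (Y k)"
  proof -
    have "p k \<oplus> p k \<cdot> (j \<cdot> q) = p k \<cdot> (i k \<cdot> p k \<oplus> j \<cdot> q)"
      using t pi by (simp add: comp_assoc_arr[symmetric])
    also have "\<dots> = p k \<oplus> zero X (Y k)" unfolding sum2 using t X by simp
    finally have "p k \<cdot> (j \<cdot> q) = zero X (Y k)"
      by (rule add_left_cancel[rotated 7]) (use t X in simp_all)
    moreover have "p k \<cdot> j = p k \<cdot> (j \<cdot> q) \<cdot> j" using t Z(4) by (simp add: comp_assoc_arr)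
    ultimately show ?thesis using t Z(1) by simp
  qed
  have qi: "q \<cdot> i k = zero (Y k) Z"
  proof -
    have "i k \<oplus> (j \<cdot> q) \<cdot> i k = (i k \<cdot> p k \<oplus> j \<cdot> q) \<cdot> i k"
      using t pi by (simp add: comp_assoc_arr)
    also have "\<dots> = i k \<oplus> zero (Y k) X" unfolding sum2 using t X by simp
    finally have "(j \<cdot> q) \<cdot> i k = zero (Y k) X"
      by (rule add_left_cancel[rotated 7]) (use t X in simp_all)
    moreover have "q \<cdot> i k = q \<cdot> ((j \<cdot> q) \<cdot> i k)" using t Z(4) by (simp add: comp_assoc_arr[symmetric])
    ultimately show ?thesis using t Z(1) by simp
  qed
  have "is_biproduct K X (Y k) Z (i k) j (p k) q"
    unfolding is_biproduct_def using X Z Y[OF k] pi pj qi sum' by blast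
  then show ?thesis unfolding direct_summand_def by blast
qed

end

section \<open>Exact sequences of an extension\<close>

lemma sequence_equiv_iff:
  "((x, B, y), (x', B', y')) \<in> sequence_equiv K A C \<longleftrightarrow>
     (B \<in> Obj K \<and> x \<in> mor K A B \<and> y \<in> mor K B C) \<and>
     (B' \<in> Obj K \<and> x' \<in> mor K A B' \<and> y' \<in> mor K B' C) \<and>
     (\<exists>b. is_iso K B B' b \<and> b \<cdot>\<^bsub>K\<^esub> x = x' \<and> y' \<cdot>\<^bsub>K\<^esub> b = y)"
  unfolding sequence_equiv_def sequences_def by simp

lemma (in additive_category) sequence_equiv_inverse:
  assumes "A \<in> Obj K" "C \<in> Obj K" "((x, B, y), (x', B', y')) \<in> sequence_equiv K A C"
  shows "\<exists>b. is_iso K B' B b \<and> b \<cdot> x' = x \<and> y \<cdot> b = y'"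
proof -
  obtain b where b: "is_iso K B B' b" "b \<cdot> x = x'" "y' \<cdot> b = y"
    and ty: "B \<in> Obj K" "x \<in> mor K A B" "y \<in> mor K B C" "B' \<in> Obj K" "x' \<in> mor K A B'" "y' \<in> mor K B' C"
    using assms(3) unfolding sequence_equiv_iff by auto
  obtain c where c: "b \<in> mor K B B'" "c \<in> mor K B' B" "c \<cdot> b = Idn K B" "b \<cdot> c = Idn K B'"
      "is_iso K B' B c"
    using b(1) by (rule is_isoE)
  have "c \<cdot> x' = (c \<cdot> b) \<cdot> x" unfolding b(2)[symmetric] using assms(1,2) ty c(1,2)
    by (simp add: mor_iff comp_assoc_arr)
  moreover have "y \<cdot> c = y' \<cdot> (b \<cdot> c)" unfolding b(3)[symmetric] using assms(1,2) ty c(1,2)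
    by (simp add: mor_iff comp_assoc_arr)
  ultimately show ?thesis using c ty assms(1,2) by (auto simp: mor_iff)
qed

lemma (in preadditive) is_biproduct_swap:
  assumes "is_biproduct K X A B i j p q"
  shows "is_biproduct K X B A j i q p"
proof -
  have ty: "X \<in> Obj K" "A \<in> Obj K" "B \<in> Obj K"
    "i \<in> mor K A X" "j \<in> mor K B X" "p \<in> mor K X A" "q \<in> mor K X B"
    and sum: "(i \<cdot> p) \<otimes>\<^bsub>Hom K X X\<^esub> (j \<cdot> q) = Idn K X"
    using assms unfolding is_biproduct_def by auto
  have "i \<cdot> p \<in> mor K X X" "j \<cdot> q \<in> mor K X X" using ty by (simp_all add: mor_iff)
  then have "(j \<cdot> q) \<otimes>\<^bsub>Hom K X X\<^esub> (i \<cdot> p) = Idn K X"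
    using sum comm_monoid.m_comm[OF comm_group.axioms(1)[OF hom_comm_group[OF ty(1) ty(1)]]] by metis
  then show ?thesis using assms unfolding is_biproduct_def by blast
qed

context extriangulated_category
begin

lemma etriangleD:
  assumes "etriangle K A x B y C \<delta>"
  shows "A \<in> Obj K" "B \<in> Obj K" "C \<in> Obj K" "x \<in> mor K A B" "y \<in> mor K B C" "\<delta> \<in> ext K C A"
proof -
  show obj: "A \<in> Obj K" "C \<in> Obj K" and \<delta>: "\<delta> \<in> ext K C A"
    using assms unfolding etriangle_def by auto
  have R: "(x, B, y) \<in> Rlz K C A \<delta>"
    using assms unfolding etriangle_def by auto
  obtain s where "Rlz K C A \<delta> = sequence_equiv K A C `` {s}"
    using Rlz_class[OF obj \<delta>] by (rule quotientE)
  then have "(x, B, y) \<in> sequences K A C" using R unfolding sequence_equiv_def by auto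
  then show "B \<in> Obj K" "x \<in> mor K A B" "y \<in> mor K B C" unfolding sequences_def by auto
qed

lemma ex_etriangle:
  assumes "A \<in> Obj K" "C \<in> Obj K" "\<delta> \<in> ext K C A"
  shows "\<exists>x B y. etriangle K A x B y C \<delta>"
proof -
  obtain s where s: "s \<in> sequences K A C" "Rlz K C A \<delta> = sequence_equiv K A C `` {s}"
    using Rlz_class[OF assms] by (rule quotientE)
  obtain x B y where s': "s = (x, B, y)" by (cases s) auto
  have ty: "B \<in> Obj K" "x \<in> mor K A B" "y \<in> mor K B C"
    using s(1) unfolding s' sequences_def by auto
  then have "(s, s) \<in> sequence_equiv K A C"
    unfolding s' sequence_equiv_iff using is_iso_Idn[OF ty(1)] assms(1,2)
    by (auto intro!: exI[of _ "Idn K B"] simp: mor_iff)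
  then show ?thesis using assms s(2) s' unfolding etriangle_def by auto
qed

lemma etriangle_unique:
  assumes "etriangle K A x B y C \<delta>" "etriangle K A x' B' y' C \<delta>"
  shows "\<exists>b. is_iso K B B' b \<and> b \<cdot> x = x' \<and> y' \<cdot> b = y"
proof -
  note ty = etriangleD[OF assms(1)] etriangleD[OF assms(2)]
  obtain s where s: "s \<in> sequences K A C" "Rlz K C A \<delta> = sequence_equiv K A C `` {s}"
    using Rlz_class[OF ty(1,3,6)] by (rule quotientE)
  obtain x0 B0 y0 where s': "s = (x0, B0, y0)" by (cases s) auto
  have 1: "((x0, B0, y0), (x, B, y)) \<in> sequence_equiv K A C"
    and 2: "((x0, B0, y0), (x', B', y')) \<in> sequence_equiv K A C"
    using assms s' s(2) unfolding etriangle_def by auto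
  obtain b where b: "is_iso K B B0 b" "b \<cdot> x = x0" "y0 \<cdot> b = y"
    using sequence_equiv_inverse[OF ty(1,3) 1] by blast
  obtain c where c: "is_iso K B0 B' c" "c \<cdot> x0 = x'" "y' \<cdot> c = y0"
    using 2 unfolding sequence_equiv_iff by blast
  have B0: "B0 \<in> Obj K" using s(1) unfolding s' sequences_def by simp
  have "is_iso K B B' (c \<cdot> b)" using is_iso_comp[OF ty(2) B0 ty(8) b(1) c(1)] .
  moreover have "b \<in> mor K B B0" "c \<in> mor K B0 B'" using b(1) c(1) unfolding is_iso_def by auto
  then have "(c \<cdot> b) \<cdot> x = x'" "y' \<cdot> (c \<cdot> b) = y"
    using b(2,3) c(2,3) ty B0
    by (simp_all add: mor_iff comp_assoc_arr) (simp add: comp_assoc_arr[symmetric])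
  ultimately show ?thesis by blast
qed

lemma push_mor:
  assumes "A \<in> Obj K" "A' \<in> Obj K" "C \<in> Obj K" "a \<in> mor K A A'"
  shows "\<delta> \<in> ext K C A \<Longrightarrow> push K C a \<delta> \<in> ext K C A'"
    and "push K C a \<one>\<^bsub>Ext K C A\<^esub> = \<one>\<^bsub>Ext K C A'\<^esub>"
proof -
  have hom: "push K C a \<in> hom (Ext K C A) (Ext K C A')"
    using assms by (intro ExtMap_hom id_mor)
  then show "\<delta> \<in> ext K C A \<Longrightarrow> push K C a \<delta> \<in> ext K C A'" by (auto simp: hom_def)
  show "push K C a \<one>\<^bsub>Ext K C A\<^esub> = \<one>\<^bsub>Ext K C A'\<^esub>"
    using hom Ext_comm_group assms by (intro hom_one) (auto dest: comm_group.axioms)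
qed

lemma pull_mor:
  assumes "A \<in> Obj K" "C \<in> Obj K" "C' \<in> Obj K" "c \<in> mor K C' C"
  shows "\<delta> \<in> ext K C A \<Longrightarrow> pull K c A \<delta> \<in> ext K C' A"
    and "pull K c A \<one>\<^bsub>Ext K C A\<^esub> = \<one>\<^bsub>Ext K C' A\<^esub>"
proof -
  have hom: "pull K c A \<in> hom (Ext K C A) (Ext K C' A)"
    using assms by (intro ExtMap_hom id_mor)
  then show "\<delta> \<in> ext K C A \<Longrightarrow> pull K c A \<delta> \<in> ext K C' A" by (auto simp: hom_def)
  show "pull K c A \<one>\<^bsub>Ext K C A\<^esub> = \<one>\<^bsub>Ext K C' A\<^esub>"
    using hom Ext_comm_group assms by (intro hom_one) (auto dest: comm_group.axioms)
qed

lemma push_comp: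
  assumes "A \<in> Obj K" "A' \<in> Obj K" "A'' \<in> Obj K" "C \<in> Obj K" "a \<in> mor K A A'" "a' \<in> mor K A' A''"
    and "\<delta> \<in> ext K C A"
  shows "push K C (a' \<cdot> a) \<delta> = push K C a' (push K C a \<delta>)"
  using ExtMap_Cmp[of A A' A'' C C C "Idn K C" "Idn K C" a a' \<delta>] assms id_mor by simp

lemma pull_comp:
  assumes "A \<in> Obj K" "C \<in> Obj K" "C' \<in> Obj K" "C'' \<in> Obj K" "c \<in> mor K C' C" "c' \<in> mor K C'' C'"
    and "\<delta> \<in> ext K C A"
  shows "pull K (c \<cdot> c') A \<delta> = pull K c' A (pull K c A \<delta>)"
  using ExtMap_Cmp[of A A A C C' C'' c c' "Idn K A" "Idn K A" \<delta>] assms id_mor by simp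

lemma push_add:
  assumes "A \<in> Obj K" "A' \<in> Obj K" "C \<in> Obj K" "a \<in> mor K A A'" "a' \<in> mor K A A'" "\<delta> \<in> ext K C A"
  shows "push K C (a \<oplus> a') \<delta> = push K C a \<delta> \<otimes>\<^bsub>Ext K C A'\<^esub> push K C a' \<delta>"
  using ExtMap_add_right[of A A' C C "Idn K C" a a' \<delta>] assms id_mor
  by (simp add: hom_mult_eq_add)

lemma push_zero:
  assumes "A \<in> Obj K" "A' \<in> Obj K" "C \<in> Obj K" "\<delta> \<in> ext K C A"
  shows "push K C (zero A A') \<delta> = \<one>\<^bsub>Ext K C A'\<^esub>"
proof -
  interpret comm_group "Ext K C A'" using Ext_comm_group assms by blast
  have z: "zero A A' \<in> mor K A A'" using assms by (simp add: mor_iff)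
  have "push K C (zero A A') \<delta> = push K C (zero A A' \<oplus> zero A A') \<delta>" using assms by simp
  then show ?thesis
    using push_add[OF assms(1-3) z z assms(4)] push_mor(1)[OF assms(1-3) z assms(4)] by simp
qed

lemma pull_zero:
  assumes "A \<in> Obj K" "C \<in> Obj K" "C' \<in> Obj K" "\<delta> \<in> ext K C A"
  shows "pull K (zero C' C) A \<delta> = \<one>\<^bsub>Ext K C' A\<^esub>"
proof -
  interpret comm_group "Ext K C' A" using Ext_comm_group assms by blast
  have z: "zero C' C \<in> mor K C' C" using assms by (simp add: mor_iff)
  have "pull K (zero C' C) A \<delta> = pull K (zero C' C \<oplus> zero C' C) A \<delta>" using assms by simp
  also have "\<dots> = pull K (zero C' C) A \<delta> \<otimes>\<^bsub>Ext K C' A\<^esub> pull K (zero C' C) A \<delta>"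
    using ExtMap_add_left[of A A C C' "zero C' C" "zero C' C" "Idn K A" \<delta>] assms z id_mor
    by (simp add: hom_mult_eq_add)
  finally show ?thesis using pull_mor(1)[OF assms(1-3) z assms(4)] by simp
qed

text \<open>Comparing an arbitrary triangle with these two, by means of the third axiom or the lifting
  of morphisms of extensions, gives the exactness properties below.\<close>

lemma etriangle_Idn:
  assumes "X \<in> Obj K" "zero_object K Z"
  shows "etriangle K X (Idn K X) X (zero X Z) Z \<one>\<^bsub>Ext K Z X\<^esub>"
    and "etriangle K Z (zero Z X) X (Idn K X) X \<one>\<^bsub>Ext K X Z\<^esub>"
proof -
  have Z: "Z \<in> Obj K" using assms(2) unfolding zero_object_def by blast
  have bi: "is_biproduct K X X Z (Idn K X) (zero Z X) (Idn K X) (zero X Z)"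
    unfolding is_biproduct_def using zero_object_Idn[OF assms(2)] assms(1) Z
    by (simp add: mor_iff hom_mult_eq_add)
  show "etriangle K X (Idn K X) X (zero X Z) Z \<one>\<^bsub>Ext K Z X\<^esub>"
    "etriangle K Z (zero Z X) X (Idn K X) X \<one>\<^bsub>Ext K X Z\<^esub>"
    using Rlz_zero[OF bi] Rlz_zero[OF is_biproduct_swap[OF bi]] by auto
qed

lemma etriangle_comp_zero:
  assumes "etriangle K A x B y C \<delta>"
  shows "y \<cdot> x = zero A C"
proof -
  note ty = etriangleD[OF assms]
  obtain Z where Z: "zero_object K Z" using ex_zero_object by blast
  have Z0: "Z \<in> Obj K" using Z unfolding zero_object_def by blast
  obtain c where c: "c \<in> mor K Z C" "c \<cdot> zero A Z = y \<cdot> x"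
    using ET3[OF etriangle_Idn(1)[OF ty(1) Z] assms id_mor[OF ty(1)] ty(4)] ty by blast
  have "c \<cdot> zero A Z = zero A C" using c(1) ty Z0 by (simp add: mor_iff)
  then show ?thesis using c(2) by simp
qed

lemma lift_through_inflation:
  assumes "etriangle K A x B y C \<delta>" "X \<in> Obj K" "f \<in> mor K X B" "y \<cdot> f = zero X C"
  shows "\<exists>g\<in>mor K X A. f = x \<cdot> g"
proof -
  note ty = etriangleD[OF assms(1)]
  obtain Z where Z: "zero_object K Z" using ex_zero_object by blast
  have Z0: "Z \<in> Obj K" using Z unfolding zero_object_def by blast
  have "zero Z C \<in> mor K Z C" "y \<cdot> f = zero Z C \<cdot> zero X Z"
    using assms(2,4) ty Z0 by (simp_all add: mor_iff)
  then obtain a where a: "a \<in> mor K X A" "f \<cdot> Idn K X = x \<cdot> a"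
    using ET3op[OF etriangle_Idn(1)[OF assms(2) Z] assms(1,3)] by blast
  have "f = x \<cdot> a" using a(2) comp_id[OF assms(2) ty(2) assms(3)] by simp
  then show ?thesis using a(1) by blast
qed

lemma extend_along_inflation:
  assumes "etriangle K A x B y C \<delta>" "X \<in> Obj K" "f \<in> mor K A X" "push K C f \<delta> = \<one>\<^bsub>Ext K C X\<^esub>"
  shows "\<exists>g\<in>mor K B X. f = g \<cdot> x"
proof -
  note ty = etriangleD[OF assms(1)]
  obtain Z where Z: "zero_object K Z" using ex_zero_object by blast
  have Z0: "Z \<in> Obj K" using Z unfolding zero_object_def by blast
  have z: "zero C Z \<in> mor K C Z" using ty Z0 by (simp add: mor_iff)
  have "push K C f \<delta> = pull K (zero C Z) X \<one>\<^bsub>Ext K Z X\<^esub>"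
    using assms(4) pull_mor(2)[OF assms(2) Z0 ty(3) z] by simp
  then obtain b where b: "b \<in> mor K B X" "b \<cdot> x = Idn K X \<cdot> f"
    using Rlz_morphism[OF assms(1) etriangle_Idn(1)[OF assms(2) Z] assms(3) z] by blast
  have "f = b \<cdot> x" using b(2) id_comp[OF ty(1) assms(2,3)] by simp
  then show ?thesis using b(1) by blast
qed

lemma push_inflation:
  assumes "etriangle K A x B y C \<delta>"
  shows "push K C x \<delta> = \<one>\<^bsub>Ext K C B\<^esub>"
proof -
  note ty = etriangleD[OF assms]
  obtain Z where Z: "zero_object K Z" using ex_zero_object by blast
  have Z0: "Z \<in> Obj K" using Z unfolding zero_object_def by blast
  obtain c where c: "c \<in> mor K C Z" "push K C x \<delta> = pull K c B \<one>\<^bsub>Ext K Z B\<^esub>"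
    using ET3[OF assms etriangle_Idn(1)[OF ty(2) Z] ty(4) id_mor[OF ty(2)]] by blast
  then show ?thesis using pull_mor(2)[OF ty(2) Z0 ty(3)] by simp
qed

lemma push_factor:
  assumes "etriangle K A x B y C \<delta>" "X \<in> Obj K" "g \<in> mor K B X"
  shows "push K C (g \<cdot> x) \<delta> = \<one>\<^bsub>Ext K C X\<^esub>"
  using etriangleD[OF assms(1)] assms(2,3) push_comp[of A B X C x g \<delta>] push_inflation[OF assms(1)]
    push_mor(2)[of B X C g] by simp

end

section \<open>The opposite extriangulated category\<close>

text \<open>The axioms of an extriangulated category are self-dual. With the opposite category as a
  record of the same kind, a statement about deflations, right classes of cotorsion pairs or pushouts
  of extensions can be read off from its dual.\<close>

definition opp :: "('o, 'm, 'e) extricat \<Rightarrow> ('o, 'm, 'e) extricat" where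
  "opp K =
     \<lparr>Obj = Obj K, Hom = (\<lambda>A B. Hom K B A), Cmp = (\<lambda>g f. f \<cdot>\<^bsub>K\<^esub> g), Idn = Idn K,
      Ext = (\<lambda>C A. Ext K A C), ExtMap = (\<lambda>c a. ExtMap K a c),
      Rlz = (\<lambda>C A \<delta>. (\<lambda>(x, B, y). (y, B, x)) ` Rlz K A C \<delta>)\<rparr>"

lemma opp_sel [simp]:
  "Obj (opp K) = Obj K" "Hom (opp K) A B = Hom K B A" "g \<cdot>\<^bsub>opp K\<^esub> f = f \<cdot>\<^bsub>K\<^esub> g" "Idn (opp K) = Idn K"
  "Ext (opp K) C A = Ext K A C" "ExtMap (opp K) c a = ExtMap K a c"
  by (simp_all add: opp_def)

lemma opp_etriangle [simp]: "etriangle (opp K) A x B y C \<delta> \<longleftrightarrow> etriangle K C y B x A \<delta>"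
  unfolding etriangle_def by (force simp: opp_def image_iff)

lemma opp_is_iso [simp]: "is_iso (opp K) A B f \<longleftrightarrow> is_iso K B A f"
  unfolding is_iso_def by auto

lemma opp_is_section [simp]: "is_section (opp K) A B f \<longleftrightarrow> is_retraction K B A f"
  unfolding is_section_def is_retraction_def by auto

lemma opp_zero_object [simp]: "zero_object (opp K) Z \<longleftrightarrow> zero_object K Z"
  unfolding zero_object_def by auto

lemma opp_is_biproduct [simp]:
  "is_biproduct (opp K) X A B i j p q \<longleftrightarrow> is_biproduct K X A B p q i j"
  unfolding is_biproduct_def by auto

lemma opp_direct_summand [simp]: "direct_summand (opp K) Y X \<longleftrightarrow> direct_summand K Y X"
  unfolding direct_summand_def opp_is_biproduct by blast

lemma opp_subcategory [simp]: "subcategory (opp K) D \<longleftrightarrow> subcategory K D"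
  unfolding subcategory_def opp_is_iso opp_sel unfolding is_iso_def by blast

lemma opp_summand_closed [simp]: "summand_closed (opp K) D \<longleftrightarrow> summand_closed K D"
  unfolding summand_closed_def by simp

lemma opp_no_summand_in [simp]: "no_summand_in (opp K) W X \<longleftrightarrow> no_summand_in K W X"
  unfolding no_summand_in_def by simp

lemma opp_factors_through [simp]: "factors_through (opp K) W A B = factors_through K W B A"
  unfolding factors_through_def by auto

lemma opp_quot_class [simp]: "quot_class (opp K) W A B f = quot_class K W B A f"
  unfolding quot_class_def by simp

lemma opp_W_monic [simp]: "W_monic (opp K) W A B x \<longleftrightarrow> W_epic K W B A x"
  and opp_W_epic [simp]: "W_epic (opp K) W A B x \<longleftrightarrow> W_monic K W B A x"
  unfolding W_monic_def W_epic_def by simp_all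

lemma (in additive_category) additive_category_opp:
  assumes "Obj K' = Obj K" "Hom K' = (\<lambda>A B. Hom K B A)" "Cmp K' = (\<lambda>g f. f \<cdot> g)" "Idn K' = Idn K"
  shows "additive_category (K' :: ('o, 'm, 'y) addcat_scheme)"
proof (rule additive_category.intro, unfold assms, goal_cases)
  case (1 A B A' B' f) then show ?case using Hom_disjoint[of B A B' A' f] by simp
next
  case (2 A) then show ?case by (rule Idn_closed)
next
  case (3 A B C f g) then show ?case using Cmp_closed[of C B A g f] by simp
next
  case (4 A B f) then show ?case using Idn_right[of B A f] by simp
next
  case (5 A B f) then show ?case using Idn_left[of B A f] by simp
next
  case (6 A B C D f g h) then show ?case using Cmp_assoc[of D C B A h g f] by simp
next
  case (7 A B) then show ?case using Hom_comm_group by simp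
next
  case (8 A B C f f' g) then show ?case using Cmp_add_left[of C B A g f f'] by simp
next
  case (9 A B C f g g') then show ?case using Cmp_add_right[of C B A g g' f] by simp
next
  case 10
  obtain Z where "zero_object K Z" using ex_zero_object by blast
  then have "zero_object K' Z" unfolding zero_object_def assms by simp
  then show ?case by blast
next
  case (11 A B)
  obtain X i j p q where "is_biproduct K X A B i j p q" using ex_biproduct[OF 11] by blast
  then have "is_biproduct K' X A B p q i j" unfolding is_biproduct_def assms by simp
  then show ?case by blast
qed

text \<open>Reversing sequences inverts the isomorphism between the middle terms, so equivalence
  classes are mapped to equivalence classes because the relation is symmetric.\<close>

lemma Rlz_class_opp:
  assumes "additive_category K" "A \<in> Obj K" "C \<in> Obj K"
    and "Rlz K A C \<delta> \<in> sequences K C A // sequence_equiv K C A"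
  shows "Rlz (opp (K :: ('a, 'b, 'c) extricat)) C A \<delta> \<in> sequences (opp K) A C // sequence_equiv (opp K) A C"
proof -
  interpret additive_category K by fact
  define rv :: "'b \<times> 'a \<times> 'b \<Rightarrow> 'b \<times> 'a \<times> 'b" where "rv = (\<lambda>(x, B, y). (y, B, x))"
  have rv: "rv (x, B, y) = (y, B, x)" for x B y by (simp add: rv_def)
  have eq: "((y, B, x), (y', B', x')) \<in> sequence_equiv (opp K) A C \<longleftrightarrow>
      ((x, B, y), (x', B', y')) \<in> sequence_equiv K C A" (is "?L \<longleftrightarrow> ?R") for x B y x' B' y'
  proof -
    have "?L \<longleftrightarrow> ((x', B', y'), (x, B, y)) \<in> sequence_equiv K C A"
      unfolding sequence_equiv_iff opp_sel opp_is_iso by blast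
    also have "\<dots> \<longleftrightarrow> ?R"
      using sequence_equiv_inverse[OF assms(3,2)] unfolding sequence_equiv_iff by blast
    finally show ?thesis .
  qed
  obtain s where s: "s \<in> sequences K C A" "Rlz K A C \<delta> = sequence_equiv K C A `` {s}"
    using assms(4) by (rule quotientE)
  obtain x B y where s': "s = (x, B, y)" by (cases s) auto
  have "Rlz (opp K) C A \<delta> = rv ` Rlz K A C \<delta>" by (simp add: opp_def rv_def)
  also have "\<dots> = sequence_equiv (opp K) A C `` {(y, B, x)}"
  proof (rule Set.set_eqI)
    fix t :: "'b \<times> 'a \<times> 'b"
    obtain y' B' x' where t: "t = (y', B', x')" by (cases t) auto
    have "t \<in> rv ` Rlz K A C \<delta> \<longleftrightarrow> (x', B', y') \<in> Rlz K A C \<delta>"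
      unfolding t using rv by (auto simp: image_iff) (metis rv)
    also have "\<dots> \<longleftrightarrow> t \<in> sequence_equiv (opp K) A C `` {(y, B, x)}"
      unfolding s(2) s' t using eq by simp
    finally show "t \<in> rv ` Rlz K A C \<delta> \<longleftrightarrow> t \<in> sequence_equiv (opp K) A C `` {(y, B, x)}" .
  qed
  finally show ?thesis
    using s(1) s' by (auto simp: quotient_def sequences_def)
qed

lemma extriangulated_category_opp:
  fixes K :: "('o, 'm, 'e) extricat" (structure)
  assumes "extriangulated_category K"
  shows "extriangulated_category (opp K)"
proof -
  interpret extriangulated_category K by fact
  interpret op: additive_category "opp K"
    by (rule additive_category_opp) (simp_all add: opp_def)
  show ?thesis
  proof (rule extriangulated_category.intro[OF op.additive_category_axioms],
      rule extriangulated_category_axioms.intro, goal_cases)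
    case (1 A C) then show ?case by (simp add: Ext_comm_group)
  next
    case (2 A A' C C' c a) then show ?case by (simp add: ExtMap_hom)
  next
    case (3 A C \<delta>) then show ?case by (simp add: ExtMap_Idn)
  next
    case (4 A A' A'' C C' C'' c c' a a' \<delta>)
    then show ?case using ExtMap_Cmp[of C C' C'' A A' A'' a a' c c' \<delta>] by simp
  next
    case (5 A A' C C' c a a' \<delta>)
    then show ?case using ExtMap_add_left[of C C' A A' a a' c \<delta>] by simp
  next
    case (6 A A' C C' c c' a \<delta>)
    then show ?case using ExtMap_add_right[of C C' A A' a c c' \<delta>] by simp
  next
    case (7 A C \<delta>) then show ?case
      using Rlz_class_opp[OF additive_category_axioms] Rlz_class by simp
  next
    case (8 A x B y C \<delta> A' x' B' y' C' \<delta>' a c)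
    then show ?case
      using Rlz_morphism[of C' y' B' x' A' \<delta>' C y B x A \<delta> c a] by auto
  next
    case (9 X A C i j p q)
    then have "is_biproduct K X A C p q i j" by simp
    then show ?case using Rlz_zero[OF is_biproduct_swap] by simp
  next
    case (10 A x B y C \<delta> A' x' B' y' C' \<delta>' AA iA iA' pA pA' BB iB iB' pB pB' CC iC iC' pC pC')
    note tri = 10(1,2)[simplified]
    note ty = etriangleD[OF tri(1)] etriangleD[OF tri(2)]
    have "etriangle K CC ((pB \<cdot> y \<cdot> iC) \<otimes>\<^bsub>Hom K CC BB\<^esub> (pB' \<cdot> y' \<cdot> iC')) BB
       ((pA \<cdot> x \<cdot> iB) \<otimes>\<^bsub>Hom K BB AA\<^esub> (pA' \<cdot> x' \<cdot> iB')) AA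
       (ExtMap K iA pC \<delta> \<otimes>\<^bsub>Ext K AA CC\<^esub> ExtMap K iA' pC' \<delta>')"
      using Rlz_sum[OF tri] 10(3-5) by simp
    moreover have "pB \<cdot> y \<cdot> iC = pB \<cdot> (y \<cdot> iC)" "pB' \<cdot> y' \<cdot> iC' = pB' \<cdot> (y' \<cdot> iC')"
        "pA \<cdot> x \<cdot> iB = pA \<cdot> (x \<cdot> iB)" "pA' \<cdot> x' \<cdot> iB' = pA' \<cdot> (x' \<cdot> iB')"
      using 10(3-5) ty by (auto simp: is_biproduct_def mor_iff comp_assoc_arr)
    ultimately show ?case by simp
  next
    case (11 A x B y C \<delta> A' x' B' y' C' \<delta>' a b)
    then show ?case
      using ET3op[of C' y' B' x' A' \<delta>' C y B x A \<delta> b a] by (auto simp: eq_commute)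
  next
    case (12 A x B y C \<delta> A' x' B' y' C' \<delta>' b c)
    then show ?case
      using ET3[of C' y' B' x' A' \<delta>' C y B x A \<delta> c b] by (auto simp: eq_commute)
  next
    case 13 then show ?case using ET4op by simp
  next
    case 14 then show ?case using ET4 by simp
  qed
qed

text \<open>The record type is restricted to the one on which \<open>opp\<close> operates.\<close>

locale extriangulated = extriangulated_category K for K :: "('o, 'm, 'e) extricat" (structure)
begin

lemma extriangulated_opp: "extriangulated_category (opp K)"
  by (rule extriangulated_category_opp) (rule extriangulated_category_axioms)

lemma extend_along_deflation:
  assumes "etriangle K A x B y C \<delta>" "X \<in> Obj K" "f \<in> mor K B X" "f \<cdot> x = zero A X"
  shows "\<exists>g\<in>mor K C X. f = g \<cdot> y"
  using extriangulated_category.lift_through_inflation[OF extriangulated_opp, of C y B x A \<delta> X f] assms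
  by simp

lemma lift_through_deflation:
  assumes "etriangle K A x B y C \<delta>" "X \<in> Obj K" "f \<in> mor K X C" "pull K f A \<delta> = \<one>\<^bsub>Ext K X A\<^esub>"
  shows "\<exists>g\<in>mor K X B. f = y \<cdot> g"
  using extriangulated_category.extend_along_inflation[OF extriangulated_opp, of C y B x A \<delta> X f] assms
  by simp

lemma pull_factor:
  assumes "etriangle K A x B y C \<delta>" "X \<in> Obj K" "g \<in> mor K X B"
  shows "pull K (y \<cdot> g) A \<delta> = \<one>\<^bsub>Ext K X A\<^esub>"
  using extriangulated_category.push_factor[OF extriangulated_opp, of C y B x A \<delta> X g] assms
  by simp

lemma etriangle_section_zero:
  assumes "etriangle K A x B y C \<delta>" "is_section K A B x"
  shows "\<delta> = \<one>\<^bsub>Ext K C A\<^esub>"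
proof -
  note ty = etriangleD[OF assms(1)]
  obtain r where "r \<in> mor K B A" "r \<cdot> x = Idn K A" using assms(2) unfolding is_section_def by blast
  then show ?thesis using push_factor[OF assms(1) ty(1)] ExtMap_Idn[OF ty(1,3,6)] by metis
qed

text \<open>By uniqueness of realizations, the sequence is isomorphic to \<open>A \<rightarrow> A \<oplus> C \<rightarrow> C\<close>.\<close>

lemma etriangle_zero_biproduct:
  assumes "etriangle K A x B y C \<one>\<^bsub>Ext K C A\<^esub>"
  shows "\<exists>t r. is_biproduct K B A C x t r y"
proof -
  note ty = etriangleD[OF assms]
  obtain X i j p q where bi: "is_biproduct K X A C i j p q" using ex_biproduct[OF ty(1,3)] by blast
  obtain b where b: "is_iso K X B b" "b \<cdot> i = x" "y \<cdot> b = q"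
    using etriangle_unique[OF Rlz_zero[OF bi] assms] by blast
  then obtain b' where b': "b \<in> mor K X B" "b' \<in> mor K B X" "b' \<cdot> b = Idn K X" "b \<cdot> b' = Idn K B"
    by (metis is_isoE)
  have X: "X \<in> Obj K" "i \<in> mor K A X" "j \<in> mor K C X" "p \<in> mor K X A" "q \<in> mor K X C"
    "p \<cdot> i = Idn K A" "q \<cdot> j = Idn K C" "p \<cdot> j = zero C A" "q \<cdot> i = zero A C"
    and sum: "i \<cdot> p \<oplus> j \<cdot> q = Idn K X"
    using bi ty by (auto simp: is_biproduct_def mor_iff hom_mult_eq_add)
  have ar: "arr b" "src b = X" "trg b = B" "arr b'" "src b' = B" "trg b' = X"
    "arr i" "src i = A" "trg i = X" "arr j" "src j = C" "trg j = X"
    "arr p" "src p = X" "trg p = A" "arr q" "src q = X" "trg q = C" "arr y" "src y = B" "trg y = C"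
    using X(1-5) b'(1,2) ty by (simp_all add: mor_iff)
  have "x \<cdot> (p \<cdot> b') \<oplus> (b \<cdot> j) \<cdot> y = Idn K B"
  proof -
    have "y = q \<cdot> b'" unfolding b(3)[symmetric] using ar b'(4) ty by (simp add: comp_assoc_arr)
    then have "x \<cdot> (p \<cdot> b') \<oplus> (b \<cdot> j) \<cdot> y = b \<cdot> (i \<cdot> p \<oplus> j \<cdot> q) \<cdot> b'"
      unfolding b(2)[symmetric] using ar by (simp add: comp_assoc_arr)
    then show ?thesis unfolding sum using ar b'(4) by simp
  qed
  moreover have "(p \<cdot> b') \<cdot> x = Idn K A"
    unfolding b(2)[symmetric] using ar b'(3) X(6) comp_assoc_arr[of i b b'] X(1)
    by (simp add: comp_assoc_arr)
  moreover have "y \<cdot> (b \<cdot> j) = Idn K C"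
    using b(3) ar X(7) by (simp add: comp_assoc_arr[symmetric])
  moreover have "(p \<cdot> b') \<cdot> (b \<cdot> j) = zero C A"
    using ar b'(3) X(8) comp_assoc_arr[of j b b'] X(1) by (simp add: comp_assoc_arr)
  moreover have "y \<cdot> x = zero A C" using etriangle_comp_zero[OF assms] .
  ultimately have "is_biproduct K B A C x (b \<cdot> j) (p \<cdot> b') y"
    unfolding is_biproduct_def using ty ar X(1) by (simp add: mor_iff hom_mult_eq_add)
  then show ?thesis by blast
qed

text \<open>The difference \<open>k\<close> of \<open>u\<close> and the identity satisfies \<open>k x = 0\<close> and \<open>y k = 0\<close>. By the first
  equation it factors through \<open>y\<close>, so the second one gives \<open>k k = 0\<close>.\<close>

lemma etriangle_endo_iso:
  assumes "etriangle K A x B y C \<delta>" "u \<in> mor K B B" "u \<cdot> x = x" "y \<cdot> u = y"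
  shows "is_iso K B B u"
proof -
  note ty = etriangleD[OF assms(1)]
  define k where "k = u \<oplus> neg (Idn K B)"
  have ar: "arr u" "src u = B" "trg u = B" "arr x" "src x = A" "trg x = B" "arr y" "src y = B" "trg y = C"
    using ty assms(2) by (simp_all add: mor_iff)
  have k: "k \<in> mor K B B" "k \<cdot> x = zero A B" "y \<cdot> k = zero B C"
    unfolding k_def using ar ty assms(3,4) by (simp_all add: mor_iff)
  obtain k' where k': "k' \<in> mor K C B" "k = k' \<cdot> y"
    using extend_along_deflation[OF assms(1) ty(2) k(1,2)] by blast
  have "k \<cdot> k = k' \<cdot> (y \<cdot> k)"
    using k k' ar ty by (simp add: mor_iff comp_assoc_arr)
  also have "\<dots> = zero B B" using k k'(1) ar ty by (simp add: mor_iff)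
  finally have "is_iso K B B (Idn K B \<oplus> k)" using k(1) ty by (intro is_iso_unipotent)
  moreover have "Idn K B \<oplus> k = u" unfolding k_def using ar ty by simp
  ultimately show ?thesis by simp
qed

text \<open>The inverse of \<open>c\<close> induces a map of the middle terms in the other direction, and both
  composites are automorphisms because they are compatible with \<open>x\<close>, \<open>y\<close> and \<open>x'\<close>, \<open>y'\<close>.\<close>

lemma etriangle_morphism_iso:
  assumes "etriangle K A x B y C \<delta>" "etriangle K A x' B' y' C \<delta>'"
    and "b \<in> mor K B B'" "b \<cdot> x = x'" "y' \<cdot> b = c \<cdot> y" "is_iso K C C c" "\<delta> = pull K c A \<delta>'"
  shows "is_iso K B B' b"
proof -
  note ty = etriangleD[OF assms(1)] etriangleD[OF assms(2)]
  obtain d where d: "c \<in> mor K C C" "d \<in> mor K C C" "d \<cdot> c = Idn K C" "c \<cdot> d = Idn K C"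
    using assms(6) by (rule is_isoE)
  have "\<delta>' = pull K d A \<delta>"
    using pull_comp[of A C C C c d \<delta>'] d ty assms(7) ExtMap_Idn by simp
  then have "push K C (Idn K A) \<delta>' = pull K d A \<delta>" using ty ExtMap_Idn by simp
  then obtain b' where b': "b' \<in> mor K B' B" "b' \<cdot> x' = x \<cdot> Idn K A" "y \<cdot> b' = d \<cdot> y'"
    using Rlz_morphism[OF assms(2,1) id_mor[OF ty(1)] d(2)] by blast
  have ar: "arr x" "src x = A" "trg x = B" "arr y" "src y = B" "trg y = C"
    "arr x'" "src x' = A" "trg x' = B'" "arr y'" "src y' = B'" "trg y' = C"
    "arr b" "src b = B" "trg b = B'" "arr b'" "src b' = B'" "trg b' = B"
    "arr c" "src c = C" "trg c = C" "arr d" "src d = C" "trg d = C"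
    using ty assms(3) b'(1) d(1,2) by (simp_all add: mor_iff)
  have "(b' \<cdot> b) \<cdot> x = x" using assms(4) b'(2) ar by (simp add: comp_assoc_arr)
  moreover have "y \<cdot> (b' \<cdot> b) = (d \<cdot> c) \<cdot> y"
    using assms(5) b'(3) ar comp_assoc_arr[of b b' y] by (simp add: comp_assoc_arr)
  ultimately have 1: "is_iso K B B (b' \<cdot> b)"
    using d(3) ar ty by (intro etriangle_endo_iso[OF assms(1)]) (simp_all add: mor_iff)
  have "(b \<cdot> b') \<cdot> x' = x'" using assms(4) b'(2) ar by (simp add: comp_assoc_arr)
  moreover have "y' \<cdot> (b \<cdot> b') = (c \<cdot> d) \<cdot> y'"
    using assms(5) b'(3) ar comp_assoc_arr[of b' b y'] by (simp add: comp_assoc_arr)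
  ultimately have 2: "is_iso K B' B' (b \<cdot> b')"
    using d(4) ar ty by (intro etriangle_endo_iso[OF assms(2)]) (simp_all add: mor_iff)
  obtain e1 where e1: "e1 \<in> mor K B B" "e1 \<cdot> (b' \<cdot> b) = Idn K B" using 1 by (rule is_isoE)
  obtain e2 where e2: "e2 \<in> mor K B' B'" "(b \<cdot> b') \<cdot> e2 = Idn K B'" using 2 by (rule is_isoE)
  show ?thesis
    using e1 e2 ar ty assms(3)
    by (intro is_isoI[where l = "e1 \<cdot> b'" and r = "b' \<cdot> e2"]) (simp_all add: mor_iff comp_assoc_arr)
qed

end

section \<open>Twin cotorsion pairs and their hearts\<close>

text \<open>Two factorizations combine to one through the direct sum of the intermediate objects.\<close>

lemma (in additive_category) factors_through_add:
  assumes "D \<subseteq> Obj K"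
    and sums: "\<And>Y Y' P i j p q. \<lbrakk>Y \<in> D; Y' \<in> D; is_biproduct K P Y Y' i j p q\<rbrakk> \<Longrightarrow> P \<in> D"
    and "A \<in> Obj K" "B \<in> Obj K" "f \<in> factors_through K D A B" "g \<in> factors_through K D A B"
  shows "f \<oplus> g \<in> factors_through K D A B"
proof -
  obtain Y h k where f: "Y \<in> D" "h \<in> mor K A Y" "k \<in> mor K Y B" "f = k \<cdot> h"
    using assms(5) unfolding factors_through_def by auto
  obtain Y' h' k' where g: "Y' \<in> D" "h' \<in> mor K A Y'" "k' \<in> mor K Y' B" "g = k' \<cdot> h'"
    using assms(6) unfolding factors_through_def by auto
  have Y: "Y \<in> Obj K" "Y' \<in> Obj K" using f(1) g(1) assms(1) by auto
  obtain P i j p q where bi: "is_biproduct K P Y Y' i j p q" using ex_biproduct[OF Y] by blast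
  then have P: "P \<in> Obj K" "i \<in> mor K Y P" "j \<in> mor K Y' P" "p \<in> mor K P Y" "q \<in> mor K P Y'"
    "p \<cdot> i = Idn K Y" "q \<cdot> j = Idn K Y'" "p \<cdot> j = zero Y' Y" "q \<cdot> i = zero Y Y'"
    unfolding is_biproduct_def by auto
  have "P \<in> D" using sums[OF f(1) g(1) bi] .
  have ar: "arr h" "src h = A" "trg h = Y" "arr k" "src k = Y" "trg k = B"
    "arr h'" "src h' = A" "trg h' = Y'" "arr k'" "src k' = Y'" "trg k' = B"
    "arr i" "src i = Y" "trg i = P" "arr j" "src j = Y'" "trg j = P"
    "arr p" "src p = P" "trg p = Y" "arr q" "src q = P" "trg q = Y'"
    using f g P(1-5) Y assms(3,4) by (simp_all add: mor_iff)
  have "(k \<cdot> p \<oplus> k' \<cdot> q) \<cdot> (i \<cdot> h \<oplus> j \<cdot> h')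
      = k \<cdot> (p \<cdot> i) \<cdot> h \<oplus> k \<cdot> (p \<cdot> j) \<cdot> h' \<oplus> (k' \<cdot> (q \<cdot> i) \<cdot> h \<oplus> k' \<cdot> (q \<cdot> j) \<cdot> h')"
    using ar by (simp add: arith)
  also have "\<dots> = f \<oplus> g" using ar P(6-9) Y f(4) g(4) assms(3,4) by simp
  finally have "f \<oplus> g = (k \<cdot> p \<oplus> k' \<cdot> q) \<cdot> (i \<cdot> h \<oplus> j \<cdot> h')" by simp
  moreover have "k \<cdot> p \<oplus> k' \<cdot> q \<in> mor K P B" "i \<cdot> h \<oplus> j \<cdot> h' \<in> mor K A P" "f \<oplus> g \<in> mor K A B"
    using ar P(1) assms(3,4) f(4) g(4) by (simp_all add: mor_iff)
  ultimately show ?thesis using \<open>P \<in> D\<close> unfolding factors_through_def by blast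
qed

lemma cotorsion_pair_opp: "cotorsion_pair K U V \<Longrightarrow> cotorsion_pair (opp K) V U"
  unfolding cotorsion_pair_def by (simp; blast)

lemma factors_throughI:
  assumes "X \<in> D" "h \<in> mor K A X" "g \<in> mor K X B" "g \<cdot>\<^bsub>K\<^esub> h \<in> mor K A B"
  shows "g \<cdot>\<^bsub>K\<^esub> h \<in> factors_through K D A B"
  using assms unfolding factors_through_def by blast

context extriangulated
begin

lemma cotorsion_vanish:
  "\<lbrakk>cotorsion_pair K U V; X \<in> U; Y \<in> V; \<delta> \<in> ext K X Y\<rbrakk> \<Longrightarrow> \<delta> = \<one>\<^bsub>Ext K X Y\<^esub>"
  using cotorsion_pair.Ext_vanish[of K U V X Y] by simp

lemma cotorsion_Obj:
  "cotorsion_pair K U V \<Longrightarrow> U \<subseteq> Obj K" "cotorsion_pair K U V \<Longrightarrow> V \<subseteq> Obj K"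
  using cotorsion_pair.subcategories unfolding subcategory_def by blast+

text \<open>The left approximation \<open>Y \<rightarrow> V' \<rightarrow> U'\<close> splits, which makes \<open>Y\<close> a summand of \<open>V'\<close>.\<close>

lemma cotorsion_right_memI:
  assumes "cotorsion_pair K U V" "Y \<in> Obj K"
    and "\<And>X \<delta>. \<lbrakk>X \<in> U; \<delta> \<in> ext K X Y\<rbrakk> \<Longrightarrow> \<delta> = \<one>\<^bsub>Ext K X Y\<^esub>"
  shows "Y \<in> V"
proof -
  obtain V' U' x y \<delta> where *: "V' \<in> V" "U' \<in> U" "etriangle K Y x V' y U' \<delta>"
    using cotorsion_pair.approx_left[OF assms(1,2)] by blast
  then have "\<delta> = \<one>\<^bsub>Ext K U' Y\<^esub>" using assms(3) etriangleD(6) by blast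
  then have "direct_summand K Y V'"
    using *(3) etriangle_zero_biproduct unfolding direct_summand_def by blast
  then show ?thesis
    using cotorsion_pair.summands(2)[OF assms(1)] *(1) unfolding summand_closed_def by blast
qed

text \<open>A retract need not have a complement, so that closure under direct summands does not
  apply to it. The vanishing of extensions, however, passes to retracts.\<close>

lemma cotorsion_right_retract:
  assumes "cotorsion_pair K U V" "X \<in> Obj K" "Idn K X \<in> factors_through K V X X"
  shows "X \<in> V"
proof (rule cotorsion_right_memI[OF assms(1,2)])
  fix Z \<delta> assume Z: "Z \<in> U" and \<delta>: "\<delta> \<in> ext K Z X"
  obtain Y h g where Y: "Y \<in> V" "h \<in> mor K X Y" "g \<in> mor K Y X" "Idn K X = g \<cdot> h"
    using assms(3) unfolding factors_through_def by blast
  have ob: "Y \<in> Obj K" "Z \<in> Obj K" using Y(1) Z cotorsion_Obj[OF assms(1)] by auto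
  have "\<delta> = push K Z (g \<cdot> h) \<delta>"
    using ExtMap_Idn[OF assms(2) ob(2) \<delta>] Y(4) by simp
  also have "\<dots> = push K Z g (push K Z h \<delta>)"
    using push_comp[OF assms(2) ob(1) assms(2) ob(2) Y(2,3) \<delta>] .
  also have "push K Z h \<delta> = \<one>\<^bsub>Ext K Z Y\<^esub>"
    using cotorsion_vanish[OF assms(1) Z Y(1)] push_mor(1)[OF assms(2) ob Y(2) \<delta>] by blast
  also have "push K Z g \<one>\<^bsub>Ext K Z Y\<^esub> = \<one>\<^bsub>Ext K Z X\<^esub>"
    using push_mor(2)[OF ob(1) assms(2) ob(2) Y(3)] .
  finally show "\<delta> = \<one>\<^bsub>Ext K Z X\<^esub>" .
qed

lemma cotorsion_right_biproduct:
  assumes cp: "cotorsion_pair K U V" and Y: "Y \<in> V" "Y' \<in> V" and bi: "is_biproduct K P Y Y' i j p q"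
  shows "P \<in> V"
proof -
  have P: "P \<in> Obj K" "Y \<in> Obj K" "Y' \<in> Obj K" "i \<in> mor K Y P" "j \<in> mor K Y' P"
    "p \<in> mor K P Y" "q \<in> mor K P Y'"
    and sum: "(i \<cdot> p) \<otimes>\<^bsub>Hom K P P\<^esub> (j \<cdot> q) = Idn K P"
    using bi unfolding is_biproduct_def by auto
  have ip: "i \<cdot> p \<in> mor K P P" "j \<cdot> q \<in> mor K P P" using P by (simp_all add: mor_iff)
  show ?thesis
  proof (rule cotorsion_right_memI[OF cp P(1)])
    fix Z \<delta> assume Z: "Z \<in> U" and \<delta>: "\<delta> \<in> ext K Z P"
    have Z': "Z \<in> Obj K" using Z cotorsion_Obj[OF cp] by auto
    interpret comm_group "Ext K Z P" using Ext_comm_group P(1) Z' by blast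
    have van: "push K Z (g \<cdot> h) \<delta> = \<one>\<^bsub>Ext K Z P\<^esub>" if "R \<in> V" "h \<in> mor K P R" "g \<in> mor K R P" for R g h
    proof -
      have R: "R \<in> Obj K" using that(1) cotorsion_Obj[OF cp] by auto
      have "push K Z h \<delta> = \<one>\<^bsub>Ext K Z R\<^esub>"
        using cotorsion_vanish[OF cp Z that(1)] push_mor(1)[OF P(1) R Z' that(2) \<delta>] by blast
      then show ?thesis
        using push_comp[OF P(1) R P(1) Z' that(2,3) \<delta>] push_mor(2)[OF R P(1) Z' that(3)] by simp
    qed
    have "\<delta> = push K Z (i \<cdot> p \<oplus> j \<cdot> q) \<delta>"
      using ExtMap_Idn[OF P(1) Z' \<delta>] sum hom_mult_eq_add[OF P(1,1) ip(1)] by simp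
    then show "\<delta> = \<one>\<^bsub>Ext K Z P\<^esub>"
      using push_add[OF P(1,1) Z' ip \<delta>] van[OF Y(1) P(6,4)] van[OF Y(2) P(7,5)] by simp
  qed
qed

lemma cotorsion_right_zero:
  assumes cp: "cotorsion_pair K U V" and Z: "zero_object K Z"
  shows "Z \<in> V"
proof (rule cotorsion_right_memI[OF cp])
  show Z': "Z \<in> Obj K" using Z unfolding zero_object_def by blast
  fix X \<delta> assume "X \<in> U" and \<delta>: "\<delta> \<in> ext K X Z"
  then have "X \<in> Obj K" using cotorsion_Obj[OF cp] by auto
  then show "\<delta> = \<one>\<^bsub>Ext K X Z\<^esub>"
    using push_zero[OF Z' Z' _ \<delta>] ExtMap_Idn[OF Z' _ \<delta>] zero_object_Idn[OF Z] by metis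
qed

lemma cotorsion_lift:
  assumes cp: "cotorsion_pair K U V" and tri: "etriangle K Y v X u B \<epsilon>"
    and "Y \<in> V" "Z \<in> U" "f \<in> mor K Z B"
  shows "\<exists>g\<in>mor K Z X. f = u \<cdot> g"
proof -
  note ty = etriangleD[OF tri]
  have Z: "Z \<in> Obj K" using assms(4) cotorsion_Obj[OF cp] by auto
  then show ?thesis
    using lift_through_deflation[OF tri Z assms(5)] cotorsion_vanish[OF cp assms(4,3)]
      pull_mor(1)[OF ty(1,3) Z assms(5) ty(6)] by blast
qed

end

locale twin_heart = extriangulated K + twin_cotorsion_pair K S T U V
  for K :: "('o, 'm, 'e) extricat" (structure) and S T U V :: "'o set"
begin

abbreviation W :: "'o set" where "W \<equiv> T \<inter> U"
abbreviation H :: "'o set" where "H \<equiv> heart_obj K S T U V"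

lemma V_subset_T: "V \<subseteq> T"
proof
  fix Y assume Y: "Y \<in> V"
  then have "Y \<in> Obj K" using cotorsion_Obj[OF second_pair] by blast
  then show "Y \<in> T"
    using cotorsion_right_memI[OF first_pair] cotorsion_vanish[OF second_pair _ Y] S_subset_U by blast
qed

lemma twin_heart_opp: "twin_heart (opp K) V U T S"
proof -
  have "twin_cotorsion_pair (opp K) V U T S"
    using first_pair second_pair V_subset_T by (intro twin_cotorsion_pair.intro cotorsion_pair_opp)
  then show ?thesis
    using extriangulated_opp by (intro twin_heart.intro extriangulated.intro)
qed

lemma W_Obj: "W \<subseteq> Obj K" using cotorsion_Obj[OF first_pair] by auto

lemma H_Obj: "H \<subseteq> Obj K" unfolding heart_obj_def B_plus_def by auto

lemma T_factors_add:
  assumes "A \<in> Obj K" "B \<in> Obj K" "f \<in> factors_through K T A B" "g \<in> factors_through K T A B"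
  shows "f \<oplus> g \<in> factors_through K T A B"
  using cotorsion_Obj[OF first_pair] cotorsion_right_biproduct[OF first_pair] assms
  by (intro factors_through_add) blast+

text \<open>Let \<open>u : X \<rightarrow> B\<close> be the approximation of \<open>B\<close> by an object of \<open>U\<close>, with kernel \<open>Y\<close> in \<open>V\<close>. It has
  to be shown that \<open>X\<close> lies in \<open>T\<close>. The composite \<open>y u\<close> lifts to the object \<open>WC\<close> covering \<open>C\<close>, and \<open>WC\<close>
  maps to \<open>B\<close> as \<open>y\<close> is \<open>W\<close>-epic. The difference of the two maps from \<open>X\<close> to \<open>B\<close> factors through \<open>A\<close>,
  and then through the object \<open>WA\<close> covering \<open>A\<close>. So \<open>u\<close> factors through \<open>WC\<close> and \<open>WA\<close>. Lifting the maps
  from \<open>WC\<close> and \<open>WA\<close> to \<open>B\<close> back along \<open>u\<close> shows that the identity of \<open>X\<close> is a sum of endomorphisms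
  factoring through \<open>WC\<close>, \<open>WA\<close> and \<open>Y\<close>, all of which lie in \<open>T\<close>.\<close>

lemma B_plus_extension:
  assumes A: "A \<in> B_plus K V W" and C: "C \<in> B_plus K V W"
    and tri: "etriangle K A x B y C \<delta>" and epi: "W_epic K W B C y"
  shows "B \<in> B_plus K V W"
proof -
  note ty = etriangleD[OF tri]
  obtain VA WA xa wa \<delta>a where a: "VA \<in> V" "WA \<in> W" "etriangle K VA xa WA wa A \<delta>a"
    using A unfolding B_plus_def by blast
  obtain VC WC xc wc \<delta>c where c: "VC \<in> V" "WC \<in> W" "etriangle K VC xc WC wc C \<delta>c"
    using C unfolding B_plus_def by blast
  obtain Y X v u \<epsilon> where b: "Y \<in> V" "X \<in> U" "etriangle K Y v X u B \<epsilon>"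
    using cotorsion_pair.approx_right[OF second_pair ty(2)] by blast
  note tb = etriangleD[OF b(3)] and ta = etriangleD[OF a(3)] and tc = etriangleD[OF c(3)]
  have "y \<cdot> u \<in> mor K X C" using ty tb by (simp add: mor_iff)
  then obtain \<alpha> where \<alpha>: "\<alpha> \<in> mor K X WC" "y \<cdot> u = wc \<cdot> \<alpha>"
    using cotorsion_lift[OF second_pair c(3) c(1) b(2)] by blast
  obtain \<beta> where \<beta>: "\<beta> \<in> mor K WC B" "wc = y \<cdot> \<beta>"
    using epi c(2) tc(5) unfolding W_epic_def by blast
  have ar: "arr x" "src x = A" "trg x = B" "arr y" "src y = B" "trg y = C"
    "arr u" "src u = X" "trg u = B" "arr v" "src v = Y" "trg v = X" "arr wa" "src wa = WA" "trg wa = A"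
    "arr \<alpha>" "src \<alpha> = X" "trg \<alpha> = WC" "arr \<beta>" "src \<beta> = WC" "trg \<beta> = B"
    using ty ta tb tc \<alpha>(1) \<beta>(1) by (simp_all add: mor_iff)
  have "y \<cdot> (u \<oplus> neg (\<beta> \<cdot> \<alpha>)) = zero X C"
    using ar \<alpha>(2) \<beta>(2) comp_assoc_arr[of \<alpha> \<beta> y] by simp
  moreover have "u \<oplus> neg (\<beta> \<cdot> \<alpha>) \<in> mor K X B" using ar ty tb by (simp add: mor_iff)
  ultimately obtain \<gamma> where \<gamma>: "\<gamma> \<in> mor K X A" "u \<oplus> neg (\<beta> \<cdot> \<alpha>) = x \<cdot> \<gamma>"
    using lift_through_inflation[OF tri tb(2)] by blast
  obtain \<gamma>' where \<gamma>': "\<gamma>' \<in> mor K X WA" "\<gamma> = wa \<cdot> \<gamma>'"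
    using cotorsion_lift[OF second_pair a(3) a(1) b(2) \<gamma>(1)] by blast
  have u_eq: "u = \<beta> \<cdot> \<alpha> \<oplus> x \<cdot> \<gamma>"
    unfolding \<gamma>(2)[symmetric] using ar by (simp add: add_left_comm_arr)
  obtain \<beta>' where \<beta>': "\<beta>' \<in> mor K WC X" "\<beta> = u \<cdot> \<beta>'"
    using cotorsion_lift[OF second_pair b(3) b(1) _ \<beta>(1)] c(2) by blast
  have "x \<cdot> wa \<in> mor K WA B" using ar ta ty by (simp add: mor_iff)
  then obtain \<xi> where \<xi>: "\<xi> \<in> mor K WA X" "x \<cdot> wa = u \<cdot> \<xi>"
    using cotorsion_lift[OF second_pair b(3) b(1)] a(2) by blast
  have ar2: "arr \<gamma>'" "src \<gamma>' = X" "trg \<gamma>' = WA" "arr \<beta>'" "src \<beta>' = WC" "trg \<beta>' = X"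
    "arr \<xi>" "src \<xi> = WA" "trg \<xi> = X"
    using \<gamma>'(1) \<beta>'(1) \<xi>(1) ta tb tc by (simp_all add: mor_iff)
  define k where "k = Idn K X \<oplus> neg (\<beta>' \<cdot> \<alpha> \<oplus> \<xi> \<cdot> \<gamma>')"
  have "u \<cdot> (\<beta>' \<cdot> \<alpha> \<oplus> \<xi> \<cdot> \<gamma>') = \<beta> \<cdot> \<alpha> \<oplus> x \<cdot> \<gamma>"
    unfolding \<gamma>'(2) using ar ar2 \<beta>'(2) \<xi>(2) by (simp add: comp_assoc_arr[symmetric])
  then have uu: "u \<cdot> (\<beta>' \<cdot> \<alpha> \<oplus> \<xi> \<cdot> \<gamma>') = u" using u_eq by metis
  have "u \<cdot> k = u \<oplus> neg (u \<cdot> (\<beta>' \<cdot> \<alpha> \<oplus> \<xi> \<cdot> \<gamma>'))"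
    unfolding k_def using ar ar2 tb by (simp del: comp_add add: comp_add[of "Idn K X"])
  then have "u \<cdot> k = zero X B" unfolding uu using ar by simp
  moreover have "k \<in> mor K X X" unfolding k_def using ar ar2 tb by (simp add: mor_iff)
  ultimately obtain \<zeta> where \<zeta>: "\<zeta> \<in> mor K X Y" "k = v \<cdot> \<zeta>"
    using lift_through_inflation[OF b(3) tb(2)] by blast
  have ar3: "arr \<zeta>" "src \<zeta> = X" "trg \<zeta> = Y" using \<zeta>(1) tb by (simp_all add: mor_iff)
  have "Idn K X = (\<beta>' \<cdot> \<alpha> \<oplus> \<xi> \<cdot> \<gamma>') \<oplus> k"
    unfolding k_def using ar ar2 tb by (simp add: add_assoc_arr add_left_comm_arr[of _ "Idn K X"] neg_add)
  also have "\<dots> = (\<beta>' \<cdot> \<alpha> \<oplus> \<xi> \<cdot> \<gamma>') \<oplus> v \<cdot> \<zeta>" using \<zeta>(2) by simp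
  also have "\<dots> \<in> factors_through K T X X"
  proof (intro T_factors_add factors_throughI)
    show "WC \<in> T" "WA \<in> T" "Y \<in> T" using a(2) c(2) b(1) V_subset_T by auto
  qed (use \<alpha>(1) \<beta>'(1) \<xi>(1) \<gamma>'(1) \<zeta>(1) tb ar ar2 ar3 in \<open>simp_all add: mor_iff\<close>)
  finally have "X \<in> T" using cotorsion_right_retract[OF first_pair tb(2)] by blast
  then show ?thesis using b ty(2) unfolding B_plus_def by blast
qed

lemma opp_B_plus: "B_plus (opp K) D D' = B_minus K D D'"
  unfolding B_plus_def B_minus_def opp_etriangle opp_sel by blast

lemma opp_B_minus: "B_minus (opp K) D D' = B_plus K D D'"
  unfolding B_plus_def B_minus_def opp_etriangle opp_sel by blast

lemma opp_heart_obj: "heart_obj (opp K) V U T S = H"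
  unfolding heart_obj_def opp_B_plus opp_B_minus by (simp add: Int_commute)

lemma heart_extension:
  assumes "A \<in> H" "C \<in> H" "etriangle K A x B y C \<delta>" "W_monic K W A B x" "W_epic K W B C y"
  shows "B \<in> H"
proof -
  interpret op: twin_heart "opp K" V U T S by (rule twin_heart_opp)
  have "B \<in> B_plus (opp K) S (U \<inter> T)"
    using assms op.B_plus_extension[of C A y B x \<delta>] unfolding heart_obj_def
    by (simp add: opp_B_plus Int_commute)
  then show ?thesis
    using assms B_plus_extension[of A C x B y \<delta>] unfolding heart_obj_def
    by (simp add: opp_B_plus Int_commute)
qed

definition F_triangle :: "'o \<Rightarrow> 'm \<Rightarrow> 'o \<Rightarrow> 'm \<Rightarrow> 'o \<Rightarrow> 'e \<Rightarrow> bool" where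
  "F_triangle A x B y C \<delta> \<longleftrightarrow> A \<in> H \<and> C \<in> H \<and> etriangle K A x B y C \<delta> \<and>
     W_monic K W A B x \<and> W_epic K W B C y"

lemma F_triangleD:
  assumes "F_triangle A x B y C \<delta>"
  shows "A \<in> H" "B \<in> H" "C \<in> H" "etriangle K A x B y C \<delta>" "W_monic K W A B x" "W_epic K W B C y"
  using assms heart_extension unfolding F_triangle_def by blast+

lemma W_monic_iso:
  assumes "A \<in> Obj K" "B \<in> Obj K" "B' \<in> Obj K" "x \<in> mor K A B" "W_monic K W A B x" "is_iso K B B' b"
  shows "W_monic K W A B' (b \<cdot> x)"
  unfolding W_monic_def
proof (intro ballI)
  fix X f assume X: "X \<in> W" "f \<in> mor K A X"
  obtain c where b: "b \<in> mor K B B'" "c \<in> mor K B' B" "c \<cdot> b = Idn K B" using assms(6) by (rule is_isoE)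
  obtain g where g: "g \<in> mor K B X" "f = g \<cdot> x" using assms(5) X unfolding W_monic_def by blast
  have X': "X \<in> Obj K" using X W_Obj by blast
  have ar: "arr b" "src b = B" "trg b = B'" "arr c" "src c = B'" "trg c = B"
    "arr g" "src g = B" "trg g = X" "arr x" "src x = A" "trg x = B"
    using b(1,2) g(1) X' assms by (simp_all add: mor_iff)
  have "f = (g \<cdot> ((c \<cdot> b) \<cdot> x))" using g(2) b(3) ar by simp
  also have "\<dots> = (g \<cdot> c) \<cdot> (b \<cdot> x)" using ar by (simp add: comp_assoc_arr)
  finally have "f = (g \<cdot> c) \<cdot> (b \<cdot> x)" .
  moreover have "g \<cdot> c \<in> mor K B' X" using ar X' assms by (simp add: mor_iff)
  ultimately show "\<exists>g\<in>mor K B' X. f = g \<cdot> (b \<cdot> x)" by blast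
qed

lemma W_epic_iso:
  assumes "C \<in> Obj K" "B \<in> Obj K" "B' \<in> Obj K" "y \<in> mor K B C" "W_epic K W B C y" "is_iso K B' B b"
  shows "W_epic K W B' C (y \<cdot> b)"
proof -
  interpret op: twin_heart "opp K" V U T S by (rule twin_heart_opp)
  show ?thesis using op.W_monic_iso[of C B B' y b] assms by (simp add: Int_commute)
qed

text \<open>Membership in \<open>\<E>\<^sub>1\<close> asks for one realization by a \<open>W\<close>-monic and a \<open>W\<close>-epic morphism. As
  realizations are unique up to isomorphism, all of them have this property.\<close>

lemma heart_etriangle:
  "etriangle (heart_extri K S T U V) A x B y C \<delta> \<longleftrightarrow> F_triangle A x B y C \<delta>"
proof
  assume "F_triangle A x B y C \<delta>"
  then show "etriangle (heart_extri K S T U V) A x B y C \<delta>"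
    unfolding F_triangle_def etriangle_def heart_extri_def E1_def by auto
next
  assume a: "etriangle (heart_extri K S T U V) A x B y C \<delta>"
  then have AC: "A \<in> H" "C \<in> H" and \<delta>: "\<delta> \<in> E1 K W C A" and R: "(x, B, y) \<in> Rlz K C A \<delta>"
    unfolding etriangle_def heart_extri_def by auto
  obtain x' B' y' where t': "etriangle K A x' B' y' C \<delta>" "W_monic K W A B' x'" "W_epic K W B' C y'"
    using \<delta> unfolding E1_def by blast
  then have t: "etriangle K A x B y C \<delta>" using R unfolding etriangle_def by auto
  obtain b where b: "is_iso K B' B b" "b \<cdot> x' = x" "y \<cdot> b = y'"
    using etriangle_unique[OF t'(1) t] by blast
  obtain c where c: "is_iso K B B' c" "c \<cdot> x = x'" "y' \<cdot> c = y"
    using etriangle_unique[OF t t'(1)] by blast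
  note ty = etriangleD[OF t] etriangleD[OF t'(1)]
  have "W_monic K W A B x" using W_monic_iso[OF ty(7,8,2,10) t'(2) b(1)] b(2) by simp
  moreover have "W_epic K W B C y" using W_epic_iso[OF ty(9,8,2,11) t'(3) c(1)] c(3) by simp
  ultimately show "F_triangle A x B y C \<delta>" using AC t unfolding F_triangle_def by blast
qed

end

section \<open>Ideal quotients\<close>

locale ideal_quotient_category = additive_category K
  for K :: "('o, 'm, 'z) addcat_scheme" (structure) +
  fixes D W :: "'o set"
  assumes objects: "D \<subseteq> Obj K" "W \<subseteq> Obj K" and W_nonempty: "W \<noteq> {}"
    and W_biproduct: "\<lbrakk>Y \<in> W; Y' \<in> W; is_biproduct K P Y Y' i j p q\<rbrakk> \<Longrightarrow> P \<in> W"
begin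

abbreviation I :: "'o \<Rightarrow> 'o \<Rightarrow> 'm set" where "I \<equiv> factors_through K W"
abbreviation Q :: "'o \<Rightarrow> 'o \<Rightarrow> 'm \<Rightarrow> 'm set" where "Q \<equiv> quot_class K W"
abbreviation QK :: "('o, 'm set) addcat" where "QK \<equiv> ideal_quotient K D W"

lemma I_mor: "f \<in> I A B \<Longrightarrow> f \<in> mor K A B"
  unfolding factors_through_def by blast

lemma I_add: "\<lbrakk>A \<in> Obj K; B \<in> Obj K; f \<in> I A B; g \<in> I A B\<rbrakk> \<Longrightarrow> f \<oplus> g \<in> I A B"
  using objects W_biproduct by (intro factors_through_add) blast+

lemma I_comp_left:
  assumes "A \<in> Obj K" "B \<in> Obj K" "C \<in> Obj K" "f \<in> I A B" "g \<in> mor K B C"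
  shows "g \<cdot> f \<in> I A C"
proof -
  obtain X h k where f: "X \<in> W" "h \<in> mor K A X" "k \<in> mor K X B" "f = k \<cdot> h"
    using assms(4) unfolding factors_through_def by blast
  have X: "X \<in> Obj K" using f(1) objects by auto
  have "g \<cdot> f = (g \<cdot> k) \<cdot> h" unfolding f(4) using f assms X by (simp add: mor_iff comp_assoc_arr)
  moreover have "g \<cdot> k \<in> mor K X C" "g \<cdot> f \<in> mor K A C"
    using f(2,3) assms(1-3,5) I_mor[OF assms(4)] X by (simp_all add: mor_iff)
  ultimately show ?thesis using f(1,2) unfolding factors_through_def by blast
qed

lemma I_comp_right:
  assumes "A \<in> Obj K" "B \<in> Obj K" "C \<in> Obj K" "f \<in> I B C" "g \<in> mor K A B"
  shows "f \<cdot> g \<in> I A C"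
proof -
  obtain X h k where f: "X \<in> W" "h \<in> mor K B X" "k \<in> mor K X C" "f = k \<cdot> h"
    using assms(4) unfolding factors_through_def by blast
  have X: "X \<in> Obj K" using f(1) objects by auto
  have "f \<cdot> g = k \<cdot> (h \<cdot> g)" unfolding f(4) using f assms X by (simp add: mor_iff comp_assoc_arr)
  moreover have "h \<cdot> g \<in> mor K A X" "f \<cdot> g \<in> mor K A C"
    using f(2,3) assms(1-3,5) I_mor[OF assms(4)] X by (simp_all add: mor_iff)
  ultimately show ?thesis using f(1,3) unfolding factors_through_def by blast
qed

lemma I_neg: "\<lbrakk>A \<in> Obj K; B \<in> Obj K; f \<in> I A B\<rbrakk> \<Longrightarrow> neg f \<in> I A B"
  using I_comp_left[of A B B f "neg (Idn K B)"] I_mor[of f A B] by (simp add: mor_iff)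

lemma I_zero:
  assumes "A \<in> Obj K" "B \<in> Obj K"
  shows "zero A B \<in> I A B"
proof -
  obtain X where X: "X \<in> W" using W_nonempty by blast
  then have "X \<in> Obj K" using objects by blast
  then have "zero A B = zero X B \<cdot> zero A X" "zero A X \<in> mor K A X" "zero X B \<in> mor K X B"
    "zero A B \<in> mor K A B" using assms by (simp_all add: mor_iff)
  then show ?thesis using X unfolding factors_through_def by blast
qed

lemma I_subgroup:
  assumes "A \<in> Obj K" "B \<in> Obj K"
  shows "subgroup (I A B) (Hom K A B)"
proof
  show "I A B \<subseteq> mor K A B" using I_mor by blast
  show "f \<otimes>\<^bsub>Hom K A B\<^esub> g \<in> I A B" if "f \<in> I A B" "g \<in> I A B" for f g
    using I_add[OF assms that] hom_mult_eq_add[OF assms I_mor[OF that(1)]] by simp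
  show "\<one>\<^bsub>Hom K A B\<^esub> \<in> I A B" using I_zero[OF assms] .
  show "inv\<^bsub>Hom K A B\<^esub> f \<in> I A B" if "f \<in> I A B" for f
    using I_neg[OF assms that] I_mor[OF that] assms by (simp add: neg_def mor_iff)
qed

lemma I_normal:
  assumes "A \<in> Obj K" "B \<in> Obj K"
  shows "normal (I A B) (Hom K A B)"
  using comm_group.subgroup_imp_normal[OF hom_comm_group[OF assms] I_subgroup[OF assms]] .

lemma Q_eq_iff:
  assumes "A \<in> Obj K" "B \<in> Obj K" "f \<in> mor K A B" "g \<in> mor K A B"
  shows "Q A B f = Q A B g \<longleftrightarrow> (\<exists>w\<in>I A B. f = g \<oplus> w)"
proof -
  interpret comm_group "Hom K A B" using hom_comm_group assms by blast
  have *: "h \<in> Q A B g \<longleftrightarrow> (\<exists>w\<in>I A B. h = g \<oplus> w)" for h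
  proof -
    have "w \<otimes>\<^bsub>Hom K A B\<^esub> g = g \<oplus> w" if "w \<in> I A B" for w
      using m_comm[OF I_mor[OF that] assms(4)] hom_mult_eq_add[OF assms(1,2,4)] by simp
    then show ?thesis unfolding quot_class_def r_coset_def by auto
  qed
  have "Q A B f = Q A B g \<longleftrightarrow> f \<in> Q A B g"
    unfolding quot_class_def
    using repr_independence[OF _ assms(4) I_subgroup[OF assms(1,2)], of f]
      rcos_self[OF assms(3) I_subgroup[OF assms(1,2)]] by metis
  then show ?thesis using * by simp
qed

lemma Q_eqI:
  assumes "A \<in> Obj K" "B \<in> Obj K" "g \<in> mor K A B" "w \<in> I A B"
  shows "Q A B (g \<oplus> w) = Q A B g"
  using Q_eq_iff[OF assms(1,2) _ assms(3), of "g \<oplus> w"] assms I_mor[OF assms(4)]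
  by (auto simp: mor_iff)

lemma Q_mem:
  assumes "A \<in> Obj K" "B \<in> Obj K" "f \<in> mor K A B"
  shows "f \<in> Q A B f" "Q A B f \<subseteq> mor K A B"
proof -
  interpret comm_group "Hom K A B" using hom_comm_group assms by blast
  show "f \<in> Q A B f"
    unfolding quot_class_def by (rule rcos_self[OF assms(3) I_subgroup[OF assms(1,2)]])
  show "Q A B f \<subseteq> mor K A B"
    unfolding quot_class_def using r_coset_subset_G[OF _ assms(3)] I_mor by blast
qed

lemma mor_quotient: "mor QK A B = Q A B ` mor K A B"
  unfolding ideal_quotient_def FactGroup_def RCOSETS_def quot_class_def by auto

lemma Q_mor: "f \<in> mor K A B \<Longrightarrow> Q A B f \<in> mor QK A B"
  unfolding mor_quotient by blast

lemma Obj_quotient [simp]: "Obj QK = D"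
  unfolding ideal_quotient_def by simp

lemma Idn_quotient: "Idn QK A = Q A A (Idn K A)"
  unfolding ideal_quotient_def by simp

lemma one_quotient:
  assumes "A \<in> Obj K" "B \<in> Obj K"
  shows "\<one>\<^bsub>Hom QK A B\<^esub> = Q A B (zero A B)"
proof -
  interpret comm_group "Hom K A B" using hom_comm_group assms by blast
  have "I A B \<subseteq> mor K A B" using I_mor by blast
  then show ?thesis unfolding ideal_quotient_def FactGroup_def quot_class_def by simp
qed

lemma add_quotient:
  assumes "A \<in> Obj K" "B \<in> Obj K" "f \<in> mor K A B" "g \<in> mor K A B"
  shows "Q A B f \<otimes>\<^bsub>Hom QK A B\<^esub> Q A B g = Q A B (f \<oplus> g)"
  using normal.rcos_sum[OF I_normal[OF assms(1,2)] assms(3,4)] hom_mult_eq_add[OF assms(1-3)]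
  unfolding ideal_quotient_def FactGroup_def quot_class_def by simp

text \<open>The composite in the quotient is a union over all representatives. Disjointness of the
  morphism sets fixes the objects involved, and the ideal property makes all members of the union
  equal.\<close>

lemma Cmp_quotient:
  assumes "A \<in> D" "B \<in> D" "C \<in> D" "f \<in> mor K A B" "g \<in> mor K B C"
  shows "Q B C g \<cdot>\<^bsub>QK\<^esub> Q A B f = Q A C (g \<cdot> f)"
proof -
  have ob: "A \<in> Obj K" "B \<in> Obj K" "C \<in> Obj K" using assms objects by auto
  have *: "Q A' C' (g' \<cdot> f') = Q A C (g \<cdot> f)"
    if "A' \<in> D" "B' \<in> D" "C' \<in> D" "f' \<in> Q A B f \<inter> mor K A' B'" "g' \<in> Q B C g \<inter> mor K B' C'"
    for A' B' C' f' g'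
  proof -
    have ob': "A' \<in> Obj K" "B' \<in> Obj K" "C' \<in> Obj K" using that objects by auto
    have f': "f' \<in> mor K A B" and g': "g' \<in> mor K B C"
      using that Q_mem(2)[OF ob(1,2) assms(4)] Q_mem(2)[OF ob(2,3) assms(5)] by auto
    then have eq: "A' = A" "B' = B" "C' = C"
      using that(4,5) hom_disjoint[OF ob(1,2) ob'(1,2)] hom_disjoint[OF ob(2,3) ob'(2,3)] by auto
    interpret AB: comm_group "Hom K A B" using hom_comm_group ob by blast
    interpret BC: comm_group "Hom K B C" using hom_comm_group ob by blast
    have "Q A B f' = Q A B f" "Q B C g' = Q B C g"
      using that(4,5) AB.repr_independence[OF _ assms(4) I_subgroup[OF ob(1,2)]]
        BC.repr_independence[OF _ assms(5) I_subgroup[OF ob(2,3)]] unfolding quot_class_def by auto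
    then obtain v w where v: "v \<in> I A B" "f' = f \<oplus> v" and w: "w \<in> I B C" "g' = g \<oplus> w"
      using Q_eq_iff[OF ob(1,2) f' assms(4)] Q_eq_iff[OF ob(2,3) g' assms(5)] by blast
    have ar: "arr f" "src f = A" "trg f = B" "arr g" "src g = B" "trg g = C"
      "arr v" "src v = A" "trg v = B" "arr w" "src w = B" "trg w = C"
      using assms(4,5) I_mor[OF v(1)] I_mor[OF w(1)] ob by (simp_all add: mor_iff)
    have "g' \<cdot> f' = g \<cdot> f \<oplus> (g \<cdot> v \<oplus> w \<cdot> f')"
      unfolding v(2) w(2) using ar by (simp add: arith)
    moreover have "g \<cdot> v \<oplus> w \<cdot> f' \<in> I A C"
      using I_comp_left[OF ob v(1) assms(5)] I_comp_right[OF ob w(1) f'] I_add ob by blast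
    moreover have "g \<cdot> f \<in> mor K A C" using ar ob by (simp add: mor_iff)
    ultimately show ?thesis using Q_eqI[OF ob(1,3)] eq by simp
  qed
  have "Q B C g \<cdot>\<^bsub>QK\<^esub> Q A B f = \<Union>{Q A' C' (g' \<cdot> f') | A' B' C' f' g'. A' \<in> D \<and> B' \<in> D \<and> C' \<in> D \<and>
      f' \<in> Q A B f \<inter> mor K A' B' \<and> g' \<in> Q B C g \<inter> mor K B' C'}" (is "_ = \<Union>?M")
    unfolding ideal_quotient_def by simp
  also have "?M = {Q A C (g \<cdot> f)}"
  proof
    show "?M \<subseteq> {Q A C (g \<cdot> f)}" using * by blast
    have "f \<in> Q A B f \<inter> mor K A B" "g \<in> Q B C g \<inter> mor K B C"
      using Q_mem(1) ob assms(4,5) by auto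
    then show "{Q A C (g \<cdot> f)} \<subseteq> ?M" using assms(1-3) by blast
  qed
  finally show ?thesis by simp
qed

lemma mor_quotientE:
  assumes "F \<in> mor QK A B"
  obtains f where "f \<in> mor K A B" "F = Q A B f"
  using assms unfolding mor_quotient by blast

lemma preadditive_quotient: "preadditive QK"
proof (rule preadditive.intro, goal_cases)
  case (1 A B A' B' F)
  then have ob: "A \<in> Obj K" "B \<in> Obj K" "A' \<in> Obj K" "B' \<in> Obj K" using objects by auto
  obtain f where f: "f \<in> mor K A B" "F = Q A B f" using 1(5) by (rule mor_quotientE)
  obtain f' where f': "f' \<in> mor K A' B'" "F = Q A' B' f'" using 1(6) by (rule mor_quotientE)
  have "f \<in> mor K A B" "f \<in> mor K A' B'"
    using f f' Q_mem[OF ob(1,2) f(1)] Q_mem(2)[OF ob(3,4) f'(1)] by auto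
  then show ?case using hom_disjoint[OF ob] by blast
next
  case (2 A)
  then show ?case using Q_mor id_mor objects unfolding Idn_quotient by auto
next
  case (3 A B C F G)
  then have ob: "A \<in> Obj K" "B \<in> Obj K" "C \<in> Obj K" and D: "A \<in> D" "B \<in> D" "C \<in> D"
    using objects by auto
  obtain f where f: "f \<in> mor K A B" "F = Q A B f" using 3(4) by (rule mor_quotientE)
  obtain g where g: "g \<in> mor K B C" "G = Q B C g" using 3(5) by (rule mor_quotientE)
  show ?case using Cmp_quotient[OF D f(1) g(1)] f(2) g(2) Q_mor[OF comp_mor[OF ob f(1) g(1)]] by simp
next
  case (4 A B F)
  then have D: "A \<in> D" "B \<in> D" "B \<in> D" and ob: "A \<in> Obj K" "B \<in> Obj K" using objects by auto
  obtain f where f: "f \<in> mor K A B" "F = Q A B f" using 4(3) by (rule mor_quotientE)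
  show ?case
    using Cmp_quotient[OF D f(1) id_mor[OF ob(2)]] f id_comp[OF ob f(1)] by (simp add: Idn_quotient)
next
  case (5 A B F)
  then have D: "A \<in> D" "A \<in> D" "B \<in> D" and ob: "A \<in> Obj K" "B \<in> Obj K" using objects by auto
  obtain f where f: "f \<in> mor K A B" "F = Q A B f" using 5(3) by (rule mor_quotientE)
  show ?case
    using Cmp_quotient[OF D id_mor[OF ob(1)] f(1)] f comp_id[OF ob f(1)] by (simp add: Idn_quotient)
next
  case (6 A B C E F G H)
  then have D: "A \<in> D" "B \<in> D" "C \<in> D" "E \<in> D"
    and ob: "A \<in> Obj K" "B \<in> Obj K" "C \<in> Obj K" "E \<in> Obj K" using objects by auto
  obtain f where f: "f \<in> mor K A B" "F = Q A B f" using 6(5) by (rule mor_quotientE)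
  obtain g where g: "g \<in> mor K B C" "G = Q B C g" using 6(6) by (rule mor_quotientE)
  obtain h where h: "h \<in> mor K C E" "H = Q C E h" using 6(7) by (rule mor_quotientE)
  show ?case
    unfolding f(2) g(2) h(2)
    using Cmp_quotient D f(1) g(1) h(1) comp_mor ob comp_assoc[OF ob f(1) g(1) h(1)] by simp
next
  case (7 A B)
  then have ob: "A \<in> Obj K" "B \<in> Obj K" using objects by auto
  show ?case
    using comm_group.abelian_FactGroup[OF hom_comm_group[OF ob] I_subgroup[OF ob]]
    unfolding ideal_quotient_def by simp
next
  case (8 A B C F F' G)
  then have D: "A \<in> D" "B \<in> D" "C \<in> D" and ob: "A \<in> Obj K" "B \<in> Obj K" "C \<in> Obj K"
    using objects by auto
  obtain f where f: "f \<in> mor K A B" "F = Q A B f" using 8(4) by (rule mor_quotientE)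
  obtain f' where f': "f' \<in> mor K A B" "F' = Q A B f'" using 8(5) by (rule mor_quotientE)
  obtain g where g: "g \<in> mor K B C" "G = Q B C g" using 8(6) by (rule mor_quotientE)
  have s: "f \<oplus> f' \<in> mor K A B" "g \<cdot> (f \<oplus> f') = g \<cdot> f \<oplus> g \<cdot> f'" 
    using f(1) f'(1) g(1) ob by (simp_all add: mor_iff)
  show ?case
    unfolding f(2) f'(2) g(2)
    using add_quotient[OF ob(1,2) f(1) f'(1)] Cmp_quotient[OF D f(1) g(1)] Cmp_quotient[OF D f'(1) g(1)]
      Cmp_quotient[OF D s(1) g(1)] add_quotient[OF ob(1,3) comp_mor[OF ob f(1) g(1)] comp_mor[OF ob f'(1) g(1)]]
      s(2) by simp
next
  case (9 A B C F G G')
  then have D: "A \<in> D" "B \<in> D" "C \<in> D" and ob: "A \<in> Obj K" "B \<in> Obj K" "C \<in> Obj K"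
    using objects by auto
  obtain f where f: "f \<in> mor K A B" "F = Q A B f" using 9(4) by (rule mor_quotientE)
  obtain g where g: "g \<in> mor K B C" "G = Q B C g" using 9(5) by (rule mor_quotientE)
  obtain g' where g': "g' \<in> mor K B C" "G' = Q B C g'" using 9(6) by (rule mor_quotientE)
  have s: "g \<oplus> g' \<in> mor K B C" "(g \<oplus> g') \<cdot> f = g \<cdot> f \<oplus> g' \<cdot> f" 
    using f(1) g(1) g'(1) ob by (simp_all add: mor_iff)
  show ?case
    unfolding f(2) g(2) g'(2)
    using add_quotient[OF ob(2,3) g(1) g'(1)] Cmp_quotient[OF D f(1) g(1)] Cmp_quotient[OF D f(1) g'(1)]
      Cmp_quotient[OF D f(1) s(1)] add_quotient[OF ob(1,3) comp_mor[OF ob f(1) g(1)] comp_mor[OF ob f(1) g'(1)]]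
      s(2) by simp
qed

end

section \<open>Morphisms modulo \<open>W\<close> in the heart\<close>

context twin_heart
begin

lemma W_retract:
  assumes "X \<in> Obj K" "Idn K X \<in> factors_through K W X X"
  shows "X \<in> W"
proof -
  have "Idn K X \<in> factors_through K T X X" "Idn K X \<in> factors_through K U X X"
    using assms(2) unfolding factors_through_def by blast+
  then show ?thesis
    using cotorsion_right_retract[OF first_pair assms(1)] assms(1)
      extriangulated.cotorsion_right_retract[OF extriangulated.intro[OF extriangulated_opp]
        cotorsion_pair_opp[OF second_pair], of X]
    by simp
qed

lemma W_zero_object:
  assumes "zero_object K Z"
  shows "Z \<in> W"
  using cotorsion_right_zero[OF first_pair assms] assms
    extriangulated.cotorsion_right_zero[OF extriangulated.intro[OF extriangulated_opp]
      cotorsion_pair_opp[OF second_pair], of Z]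
  by simp

sublocale ideal_quotient_category K H W
proof
  show "H \<subseteq> Obj K" by (rule H_Obj)
  show "W \<subseteq> Obj K" by (rule W_Obj)
  show "W \<noteq> {}" using ex_zero_object W_zero_object by blast
  fix Y Y' P i j p q assume a: "Y \<in> W" "Y' \<in> W" "is_biproduct K P Y Y' i j p q"
  have "P \<in> T" using cotorsion_right_biproduct[OF first_pair _ _ a(3)] a(1,2) by blast
  moreover have "P \<in> U"
    using extriangulated.cotorsion_right_biproduct[OF extriangulated.intro[OF extriangulated_opp]
      cotorsion_pair_opp[OF second_pair], of Y Y' P p q i j] a by simp
  ultimately show "P \<in> W" by blast
qed

abbreviation heart_comp :: "'m set \<Rightarrow> 'm set \<Rightarrow> 'm set"  (infixl "\<bullet>" 75) where
  "G \<bullet> F \<equiv> G \<cdot>\<^bsub>QK\<^esub> F"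

lemma heart_eq: "heart K S T U V = QK"
  unfolding heart_def ..

sublocale QK: preadditive QK
  by (rule preadditive_quotient)

lemma Q_id_iff:
  assumes "A \<in> Obj K" "f \<in> mor K A A"
  shows "Q A A f = Q A A (Idn K A) \<longleftrightarrow> (\<exists>w\<in>I A A. f = Idn K A \<oplus> w)"
  using Q_eq_iff[OF assms(1,1) assms(2) id_mor[OF assms(1)]] .

lemma zero_objectI:
  assumes "Y \<in> Obj K" "Idn K Y = zero Y Y"
  shows "zero_object K Y"
  unfolding zero_object_def
proof (intro conjI ballI ex_ex1I)
  fix A assume A: "A \<in> Obj K"
  show "\<exists>f. f \<in> mor K A Y" using A assms zero_arr by (intro exI[of _ "zero A Y"]) (simp add: mor_iff)
  show "\<exists>f. f \<in> mor K Y A" using A assms zero_arr by (intro exI[of _ "zero Y A"]) (simp add: mor_iff)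
  have 1: "f = zero A Y" if "f \<in> mor K A Y" for f
  proof -
    have "f = Idn K Y \<cdot> f" using that A assms(1) by (simp add: mor_iff)
    then show ?thesis unfolding assms(2) using that A assms(1) by (simp add: mor_iff)
  qed
  show "f = g" if "f \<in> mor K A Y" "g \<in> mor K A Y" for f g using 1 that by metis
  have 2: "f = zero Y A" if "f \<in> mor K Y A" for f
  proof -
    have "f = f \<cdot> Idn K Y" using that A assms(1) by (simp add: mor_iff)
    then show ?thesis unfolding assms(2) using that A assms(1) by (simp add: mor_iff)
  qed
  show "f = g" if "f \<in> mor K Y A" "g \<in> mor K Y A" for f g using 2 that by metis
qed (rule assms)

text \<open>If a diagonal entry of a morphism through \<open>W\<close> were an automorphism of the indecomposable
  summand \<open>Y\<^sub>k\<close>, then the identity of \<open>Y\<^sub>k\<close> would factor through \<open>W\<close>. So \<open>Y\<^sub>k\<close> would be a summand of \<open>A\<close>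
  that lies in \<open>W\<close>, hence zero, whereas a local endomorphism ring is nonzero.\<close>

lemma one_plus_W_iso:
  assumes "krull_schmidt K" "A \<in> Obj K" "no_summand_in K W A" "w \<in> I A A"
  shows "is_iso K A A (Idn K A \<oplus> w)"
proof -
  obtain n Y i p where
    1: "\<forall>k<n. Y k \<in> Obj K \<and> local_end K (Y k) \<and> i k \<in> mor K (Y k) A \<and> p k \<in> mor K A (Y k)"
    and 2: "\<forall>k<n. \<forall>l<n. p k \<cdot> i l = (if k = l then Idn K (Y k) else zero (Y l) (Y k))"
    and 3: "(\<Otimes>\<^bsub>Hom K A A\<^esub>k\<in>{..<n::nat}. i k \<cdot> p k) = Idn K A"
    using bspec[OF assms(1)[unfolded krull_schmidt_def] assms(2)]
    by (elim exE conjE) (rule that; assumption)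
  have dec: "decomposition A {..<n} Y i p"
    unfolding decomposition_def using 1 2 3 assms(2) by simp
  show ?thesis
  proof (rule is_iso_one_plus_radical[OF dec, where J = "I A A"])
    show "local_end K (Y k)" if "k \<in> {..<n}" for k using 1 that by simp
    show "I A A \<subseteq> mor K A A" using I_mor by blast
    show "f \<oplus> g \<in> I A A" if "f \<in> I A A" "g \<in> I A A" for f g
      using I_add assms(2) that by blast
    show "f \<cdot> g \<in> I A A" if "f \<in> mor K A A" "g \<in> I A A" for f g
      using I_comp_left assms(2) that by blast
    show "f \<cdot> g \<in> I A A" if "f \<in> I A A" "g \<in> mor K A A" for f g
      using I_comp_right assms(2) that by blast
    show "w \<in> I A A" by fact
    fix v k assume v: "v \<in> I A A" and k: "k \<in> {..<n}"
    have Y: "Y k \<in> Obj K" "i k \<in> mor K (Y k) A" "p k \<in> mor K A (Y k)" using 1 k by auto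
    show "\<not> is_iso K (Y k) (Y k) (p k \<cdot> v \<cdot> i k)"
    proof
      assume "is_iso K (Y k) (Y k) (p k \<cdot> v \<cdot> i k)"
      then obtain \<psi> where \<psi>: "\<psi> \<in> mor K (Y k) (Y k)" "\<psi> \<cdot> (p k \<cdot> v \<cdot> i k) = Idn K (Y k)"
        by (rule is_isoE)
      have "p k \<cdot> v \<in> I A (Y k)" using I_comp_left[OF assms(2,2) Y(1) v Y(3)] .
      then have "p k \<cdot> v \<cdot> i k \<in> I (Y k) (Y k)" using I_comp_right[OF Y(1) assms(2) Y(1) _ Y(2)] by blast
      then have "Idn K (Y k) \<in> I (Y k) (Y k)" using I_comp_left[OF Y(1,1,1) _ \<psi>(1)] \<psi>(2) by metis
      then have "Y k \<in> W" using W_retract[OF Y(1)] by blast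
      then have "zero_object K (Y k)"
        using decomposition_summand[OF dec k] assms(3) unfolding no_summand_in_def by blast
      then show False using zero_object_Idn 1 k unfolding local_end_def by auto
    qed
  qed
qed

text \<open>The composite \<open>r e\<close> is an automorphism congruent to the identity. Composing \<open>e\<close> with its
  inverse does not change the class of \<open>e\<close>.\<close>

lemma heart_retract_lifts:
  assumes "krull_schmidt K" "A \<in> Obj K" "A' \<in> Obj K" "no_summand_in K W A"
    and "r \<in> mor K A' A" "e \<in> mor K A A'" "Q A A (r \<cdot> e) = Q A A (Idn K A)"
  shows "\<exists>e'\<in>mor K A A'. r \<cdot> e' = Idn K A \<and> Q A A' e' = Q A A' e"
proof -
  have "r \<cdot> e \<in> mor K A A" using assms(2,3,5,6) by (simp add: mor_iff)
  then obtain w where w: "w \<in> I A A" "r \<cdot> e = Idn K A \<oplus> w" using Q_id_iff assms(2,7) by blast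
  obtain v where v: "v \<in> mor K A A" "v \<cdot> (Idn K A \<oplus> w) = Idn K A" "(Idn K A \<oplus> w) \<cdot> v = Idn K A"
    using one_plus_W_iso[OF assms(1,2,4) w(1)] by (rule is_isoE)
  have ar: "arr v" "src v = A" "trg v = A" "arr w" "src w = A" "trg w = A"
    "arr r" "src r = A'" "trg r = A" "arr e" "src e = A" "trg e = A'"
    using v(1) I_mor[OF w(1)] assms(2,3,5,6) by (simp_all add: mor_iff)
  have "v \<oplus> v \<cdot> w = Idn K A" using v(2) ar assms(2) by simp
  then have "v = Idn K A \<oplus> neg (v \<cdot> w)"
    using ar by (metis add_assoc_arr add_neg(1) add_zero(1) comp_arr neg_arr)
  then have "e \<cdot> v = e \<cdot> (Idn K A \<oplus> neg (v \<cdot> w))" by simp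
  then have "e \<cdot> v = e \<oplus> neg (e \<cdot> (v \<cdot> w))" using ar assms(2) by simp
  moreover have "neg (e \<cdot> (v \<cdot> w)) \<in> I A A'"
    using I_neg I_comp_left w(1) v(1) assms(2,3,6) by metis
  ultimately have "Q A A' (e \<cdot> v) = Q A A' e" using Q_eqI assms(2,3,6) by simp
  moreover have "r \<cdot> (e \<cdot> v) = Idn K A"
    using v(3) w(2) ar by (metis comp_assoc_arr)
  moreover have "e \<cdot> v \<in> mor K A A'" using ar assms(2,3) by (simp add: mor_iff)
  ultimately show ?thesis by blast
qed

text \<open>The difference of \<open>f\<close> and \<open>g x\<close> factors through an object of \<open>W\<close>, so it extends along \<open>x\<close>.\<close>

lemma W_monic_factor:
  assumes "A \<in> Obj K" "B \<in> Obj K" "M \<in> Obj K" "x \<in> mor K A B" "W_monic K W A B x"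
    and "f \<in> mor K A M" "g \<in> mor K B M" "Q A M f = Q A M (g \<cdot> x)"
  shows "\<exists>g'\<in>mor K B M. f = g' \<cdot> x \<and> Q B M g' = Q B M g"
proof -
  have "g \<cdot> x \<in> mor K A M" using assms by (simp add: mor_iff)
  then obtain w where w: "w \<in> I A M" "f = g \<cdot> x \<oplus> w" using Q_eq_iff assms by blast
  obtain X h k where h: "X \<in> W" "h \<in> mor K A X" "k \<in> mor K X M" "w = k \<cdot> h"
    using w(1) unfolding factors_through_def by blast
  obtain h' where h': "h' \<in> mor K B X" "h = h' \<cdot> x" using assms(5) h(1,2) unfolding W_monic_def by blast
  have X: "X \<in> Obj K" using h(1) W_Obj by blast
  have kh: "k \<cdot> h' \<in> I B M"
    using h(1,3) h'(1) X assms(2,3) by (intro factors_throughI[OF h(1) h'(1) h(3)]) (simp add: mor_iff)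
  have "f = (g \<oplus> k \<cdot> h') \<cdot> x"
    unfolding w(2) h(4) h'(2) using assms h(3) h'(1) X by (simp add: mor_iff comp_assoc_arr)
  moreover have "g \<oplus> k \<cdot> h' \<in> mor K B M" using assms h(3) h'(1) X by (simp add: mor_iff)
  ultimately show ?thesis using Q_eqI[OF assms(2,3,7) kh] by blast
qed

lemma W_epic_factor:
  assumes "C \<in> Obj K" "B \<in> Obj K" "M \<in> Obj K" "y \<in> mor K B C" "W_epic K W B C y"
    and "f \<in> mor K M C" "g \<in> mor K M B" "Q M C f = Q M C (y \<cdot> g)"
  shows "\<exists>g'\<in>mor K M B. f = y \<cdot> g' \<and> Q M B g' = Q M B g"
proof -
  interpret op: twin_heart "opp K" V U T S by (rule twin_heart_opp)
  show ?thesis using op.W_monic_factor[of C B M y f g] assms by (simp add: Int_commute)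
qed

lemma opp_F_triangle:
  "twin_heart.F_triangle (opp K) V U T S C y B x A \<delta> \<longleftrightarrow> F_triangle A x B y C \<delta>"
proof -
  interpret op: twin_heart "opp K" V U T S by (rule twin_heart_opp)
  show ?thesis unfolding op.F_triangle_def F_triangle_def opp_heart_obj
    by (auto simp: Int_commute)
qed

lemma push_W_monic_zero:
  assumes "etriangle K A x B y C \<delta>" "W_monic K W A B x" "M \<in> Obj K" "w \<in> I A M"
  shows "push K C w \<delta> = \<one>\<^bsub>Ext K C M\<^esub>"
proof -
  note ty = etriangleD[OF assms(1)]
  have z: "zero B M \<in> mor K B M" "zero B M \<cdot> x = zero A M" using ty assms(3) by (simp_all add: mor_iff)
  have "Q A M w = Q A M (zero A M)"
    using Q_eqI[OF ty(1) assms(3) _ assms(4), of "zero A M"] I_mor[OF assms(4)] ty assms(3)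
    by (simp add: mor_iff)
  then obtain g where "g \<in> mor K B M" "w = g \<cdot> x"
    using W_monic_factor[OF ty(1,2) assms(3) ty(4) assms(2) I_mor[OF assms(4)] z(1)] z(2) by auto
  then show ?thesis using push_factor[OF assms(1,3)] by simp
qed

text \<open>The new extension is \<open>\<delta> = r\<^sub>*\<delta>'\<close>. Since \<open>e r\<close> differs from the identity by a morphism
  through \<open>W\<close>, which kills \<open>\<delta>'\<close>, also \<open>\<delta>' = e\<^sub>*\<delta>\<close>. The two morphisms of extensions induce maps \<open>b\<close> and \<open>d\<close>
  between the middle terms. Here \<open>b d\<close> is compatible with the identities of \<open>A\<close> and \<open>C\<close>, hence
  invertible, and \<open>d b\<close> is so after subtracting an endomorphism \<open>v\<close> through \<open>W\<close>.

  One-sided inverses \<open>l\<close> and \<open>l'\<close> express invertibility of \<open>b\<close> in the heart without mentioning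
  composition in the heart; in this form the statement can be dualized.\<close>

lemma F_triangle_push:
  assumes F: "F_triangle A' x' B' y' C \<delta>'" and A: "A \<in> H"
    and r: "r \<in> mor K A' A" and e: "e \<in> mor K A A'"
    and re: "r \<cdot> e = Idn K A" and er: "Q A' A' (e \<cdot> r) = Q A' A' (Idn K A')"
  shows "\<exists>x B y \<delta>. \<exists>b\<in>mor K B' B. \<exists>l\<in>mor K B B'. \<exists>l'\<in>mor K B B'. F_triangle A x B y C \<delta> \<and>
    b \<cdot> x' = x \<cdot> r \<and> y \<cdot> b = y' \<and> Q B' B' (l \<cdot> b) = Q B' B' (Idn K B') \<and> Q B B (b \<cdot> l') = Q B B (Idn K B)"
proof -
  note F' = F_triangleD[OF F]
  note ty' = etriangleD[OF F'(4)]
  have A0: "A \<in> Obj K" using A H_Obj by blast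
  define \<delta> where "\<delta> = push K C r \<delta>'"
  have \<delta>: "\<delta> \<in> ext K C A" unfolding \<delta>_def using push_mor(1)[OF ty'(1) A0 ty'(3) r ty'(6)] .
  obtain x B y where tri: "etriangle K A x B y C \<delta>" using ex_etriangle[OF A0 ty'(3) \<delta>] by blast
  note ty = etriangleD[OF tri]
  have "push K C r \<delta>' = pull K (Idn K C) A \<delta>"
    unfolding \<delta>_def[symmetric] using ExtMap_Idn[OF A0 ty'(3) \<delta>] by simp
  then obtain b where b: "b \<in> mor K B' B" "b \<cdot> x' = x \<cdot> r" "y \<cdot> b = Idn K C \<cdot> y'"
    using Rlz_morphism[OF F'(4) tri r id_mor[OF ty(3)]] by blast
  have er_mor: "e \<cdot> r \<in> mor K A' A'" using e r A0 ty' by (simp add: mor_iff)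
  obtain w where w: "w \<in> I A' A'" "e \<cdot> r = Idn K A' \<oplus> w" using Q_id_iff[OF ty'(1) er_mor] er by blast
  have "push K C e \<delta> = push K C (Idn K A' \<oplus> w) \<delta>'"
    unfolding \<delta>_def w(2)[symmetric] using push_comp[OF ty'(1) A0 ty'(1) ty'(3) r e ty'(6)] by simp
  also have "\<dots> = \<delta>' \<otimes>\<^bsub>Ext K C A'\<^esub> \<one>\<^bsub>Ext K C A'\<^esub>"
    using push_add[OF ty'(1,1,3) id_mor[OF ty'(1)] I_mor[OF w(1)] ty'(6)] ExtMap_Idn[OF ty'(1,3,6)]
      push_W_monic_zero[OF F'(4,5) ty'(1) w(1)] by simp
  also have "\<dots> = \<delta>'"
    using comm_group.axioms(1)[OF Ext_comm_group[OF ty'(1,3)]] ty'(6)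
    by (simp add: comm_monoid.axioms(1) monoid.r_one)
  also have "\<dots> = pull K (Idn K C) A' \<delta>'" using ExtMap_Idn[OF ty'(1,3,6)] by simp
  finally obtain d where d: "d \<in> mor K B B'" "d \<cdot> x = x' \<cdot> e" "y' \<cdot> d = Idn K C \<cdot> y"
    using Rlz_morphism[OF tri F'(4) e id_mor[OF ty(3)]] by blast
  have ar: "arr x" "src x = A" "trg x = B" "arr y" "src y = B" "trg y = C"
    "arr x'" "src x' = A'" "trg x' = B'" "arr y'" "src y' = B'" "trg y' = C"
    "arr b" "src b = B'" "trg b = B" "arr d" "src d = B" "trg d = B'"
    "arr r" "src r = A'" "trg r = A" "arr e" "src e = A" "trg e = A'"
    "arr w" "src w = A'" "trg w = A'"
    using ty ty' b(1) d(1) r e A0 I_mor[OF w(1)] by (simp_all add: mor_iff)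
  have yb: "y \<cdot> b = y'" and yd: "y' \<cdot> d = y" using b(3) d(3) ar by simp_all
  have mono: "W_monic K W A B x"
    unfolding W_monic_def
  proof (intro ballI)
    fix X f assume X: "X \<in> W" and f: "f \<in> mor K A X"
    have X0: "X \<in> Obj K" using X W_Obj by blast
    have "f \<cdot> r \<in> mor K A' X" using f X0 A0 ar ty' by (simp add: mor_iff)
    then obtain g where g: "g \<in> mor K B' X" "f \<cdot> r = g \<cdot> x'" using F'(5) X unfolding W_monic_def by blast
    have ar': "arr f" "src f = A" "trg f = X" "arr g" "src g = B'" "trg g = X"
      using f g(1) X0 A0 ty' by (simp_all add: mor_iff)
    have "f = (f \<cdot> r) \<cdot> e" using ar ar' re by (simp add: comp_assoc_arr)
    also have "\<dots> = (g \<cdot> d) \<cdot> x" unfolding g(2) using ar ar' d(2) by (simp add: comp_assoc_arr)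
    finally have "f = (g \<cdot> d) \<cdot> x" .
    moreover have "g \<cdot> d \<in> mor K B X" using ar ar' X0 ty by (simp add: mor_iff)
    ultimately show "\<exists>g\<in>mor K B X. f = g \<cdot> x" by blast
  qed
  have epi: "W_epic K W B C y"
    unfolding W_epic_def
  proof (intro ballI)
    fix X f assume X: "X \<in> W" and f: "f \<in> mor K X C"
    have X0: "X \<in> Obj K" using X W_Obj by blast
    obtain g where g: "g \<in> mor K X B'" "f = y' \<cdot> g" using F'(6) X f unfolding W_epic_def by blast
    have ar': "arr g" "src g = X" "trg g = B'" using g(1) X0 ty' by (simp_all add: mor_iff)
    have "f = y \<cdot> (b \<cdot> g)" unfolding g(2) yb[symmetric] using ar ar' by (simp add: comp_assoc_arr)
    moreover have "b \<cdot> g \<in> mor K X B" using ar ar' X0 ty by (simp add: mor_iff)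
    ultimately show "\<exists>g\<in>mor K X B. f = y \<cdot> g" by blast
  qed
  have Ftri: "F_triangle A x B y C \<delta>" unfolding F_triangle_def using A F'(3) tri mono epi by blast
  have "is_iso K B B (b \<cdot> d)"
  proof (rule etriangle_endo_iso[OF tri])
    show "b \<cdot> d \<in> mor K B B" using ar ty by (simp add: mor_iff)
    show "b \<cdot> d \<cdot> x = x" using ar d(2) b(2) re comp_assoc_arr[of e x' b] by (simp add: comp_assoc_arr)
    show "y \<cdot> (b \<cdot> d) = y" using ar yb yd comp_assoc_arr[of d b y] by simp
  qed
  then obtain t where t: "t \<in> mor K B B" "(b \<cdot> d) \<cdot> t = Idn K B" by (rule is_isoE)
  have dbx: "(d \<cdot> b) \<cdot> x' = x' \<oplus> x' \<cdot> w"
  proof -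
    have "(d \<cdot> b) \<cdot> x' = (d \<cdot> x) \<cdot> r" using ar b(2) by (simp add: comp_assoc_arr)
    also have "\<dots> = x' \<cdot> (e \<cdot> r)" unfolding d(2) using ar by (simp add: comp_assoc_arr)
    finally show ?thesis unfolding w(2) using ar ty'(1) by simp
  qed
  obtain X h k where h: "X \<in> W" "h \<in> mor K A' X" "k \<in> mor K X A'" "w = k \<cdot> h"
    using w(1) unfolding factors_through_def by blast
  have X: "X \<in> Obj K" using h(1) W_Obj by blast
  obtain h' where h': "h' \<in> mor K B' X" "h = h' \<cdot> x'" using F'(5) h(1,2) unfolding W_monic_def by blast
  \<comment> \<open>\<open>v\<close> is chosen such that \<open>v x' = x' w\<close> is the defect of \<open>d b\<close> on \<open>A'\<close>, while \<open>y' v = 0\<close>.\<close>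
  define v where "v = x' \<cdot> (k \<cdot> h')"
  have ar': "arr k" "src k = X" "trg k = A'" "arr h'" "src h' = B'" "trg h' = X"
    using h(3) h'(1) X ty' by (simp_all add: mor_iff)
  have v: "v \<in> I B' B'"
    unfolding v_def using ar ar' h(1) X ty'
    by (intro I_comp_left[OF ty'(2,1,2)] factors_throughI[of X]) (simp_all add: mor_iff)
  have ar'': "arr v" "src v = B'" "trg v = B'" using I_mor[OF v] ty' by (simp_all add: mor_iff)
  define u where "u = d \<cdot> b \<oplus> neg v"
  have "is_iso K B' B' u"
  proof (rule etriangle_endo_iso[OF F'(4)])
    show "u \<in> mor K B' B'" unfolding u_def using ar ar'' ty' by (simp add: mor_iff)
    have "v \<cdot> x' = x' \<cdot> w" unfolding v_def h(4) h'(2) using ar ar' by (simp add: comp_assoc_arr)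
    moreover have "u \<cdot> x' = (d \<cdot> b) \<cdot> x' \<oplus> neg (v \<cdot> x')" unfolding u_def using ar ar'' by simp
    ultimately show "u \<cdot> x' = x'" unfolding dbx using ar by (simp add: add_assoc_arr)
    have "y' \<cdot> v = (y' \<cdot> x') \<cdot> (k \<cdot> h')" unfolding v_def using ar ar' by (simp add: comp_assoc_arr)
    then have "y' \<cdot> v = zero B' C" using etriangle_comp_zero[OF F'(4)] ar ar' ty' by simp
    moreover have "y' \<cdot> (d \<cdot> b) = y'" using ar yb yd comp_assoc_arr[of b d y'] by simp
    ultimately show "y' \<cdot> u = y'" unfolding u_def using ar ar'' ty' by simp
  qed
  then obtain s where s: "s \<in> mor K B' B'" "s \<cdot> u = Idn K B'" by (rule is_isoE)
  have ar3: "arr s" "src s = B'" "trg s = B'" "arr t" "src t = B" "trg t = B"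
    using s(1) t(1) ty ty' by (simp_all add: mor_iff)
  have "d \<cdot> b = u \<oplus> v" unfolding u_def using ar ar'' by (simp add: add_assoc_arr)
  then have "(s \<cdot> d) \<cdot> b = s \<cdot> (u \<oplus> v)" using ar ar3 by (simp add: comp_assoc_arr)
  also have "\<dots> = Idn K B' \<oplus> s \<cdot> v"
    using s(2) ar3 ar'' ar comp_add[of u v s] unfolding u_def by simp
  finally have "Q B' B' ((s \<cdot> d) \<cdot> b) = Q B' B' (Idn K B')"
    using Q_eqI[OF ty'(2,2) id_mor[OF ty'(2)] I_comp_left[OF ty'(2,2,2) v s(1)]] by simp
  moreover have "b \<cdot> (d \<cdot> t) = Idn K B" using t(2) ar ar3 by (simp add: comp_assoc_arr)
  moreover have "s \<cdot> d \<in> mor K B B'" "d \<cdot> t \<in> mor K B B'" using ar ar3 ty ty' by (simp_all add: mor_iff)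
  ultimately show ?thesis using Ftri b(1,2) yb by metis
qed

lemma F_triangle_pull:
  assumes F: "F_triangle A x' B' y' C' \<delta>'" and C: "C \<in> H"
    and r: "r \<in> mor K C' C" and e: "e \<in> mor K C C'"
    and re: "r \<cdot> e = Idn K C" and er: "Q C' C' (e \<cdot> r) = Q C' C' (Idn K C')"
  shows "\<exists>x B y \<delta>. \<exists>b\<in>mor K B B'. \<exists>l\<in>mor K B' B. \<exists>l'\<in>mor K B' B. F_triangle A x B y C \<delta> \<and>
    y' \<cdot> b = e \<cdot> y \<and> b \<cdot> x = x' \<and> Q B' B' (b \<cdot> l) = Q B' B' (Idn K B') \<and> Q B B (l' \<cdot> b) = Q B B (Idn K B)"
proof -
  interpret op: twin_heart "opp K" V U T S by (rule twin_heart_opp)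
  obtain y B x \<delta> b l l' where *: "b \<in> mor K B B'" "l \<in> mor K B' B" "l' \<in> mor K B' B"
    "op.F_triangle C y B x A \<delta>" "y' \<cdot> b = e \<cdot> y" "b \<cdot> x = x'"
    "Q B' B' (b \<cdot> l) = Q B' B' (Idn K B')" "Q B B (l' \<cdot> b) = Q B B (Idn K B)"
    using op.F_triangle_push[of C' y' B' x' A \<delta>' C e r] F C r e re er
    by (auto simp: opp_F_triangle opp_heart_obj Int_commute)
  then show ?thesis unfolding opp_F_triangle by blast
qed

end

section \<open>Short sequences up to equivalence\<close>

context preadditive
begin

definition short_sequences :: "('o, 'm) ses set" where
  "short_sequences = {(A, x, B, y, C). A \<in> Obj K \<and> B \<in> Obj K \<and> C \<in> Obj K \<and>
     x \<in> mor K A B \<and> y \<in> mor K B C}"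

lemma sequence_iso_inverse:
  assumes ob: "A \<in> Obj K" "B \<in> Obj K" "B' \<in> Obj K" "C \<in> Obj K"
    and xy: "x \<in> mor K A B" "y \<in> mor K B C" "x' \<in> mor K A B'" "y' \<in> mor K B' C"
    and b: "is_iso K B B' b" and c: "is_iso K C C c" and eqs: "b \<cdot> x = x'" "y' \<cdot> b = c \<cdot> y"
  obtains b' c' where "is_iso K B' B b'" "is_iso K C C c'" "c \<in> mor K C C" "c' \<in> mor K C C"
    "c \<cdot> c' = Idn K C" "b' \<cdot> x' = x" "y \<cdot> b' = c' \<cdot> y'"
proof -
  obtain b' where b': "b \<in> mor K B B'" "b' \<in> mor K B' B" "b' \<cdot> b = Idn K B" "b \<cdot> b' = Idn K B'"
    "is_iso K B' B b'" using b by (rule is_isoE)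
  obtain c' where c': "c \<in> mor K C C" "c' \<in> mor K C C" "c' \<cdot> c = Idn K C" "c \<cdot> c' = Idn K C"
    "is_iso K C C c'" using c by (rule is_isoE)
  have ar: "arr x" "src x = A" "trg x = B" "arr y" "src y = B" "trg y = C"
    "arr x'" "src x' = A" "trg x' = B'" "arr y'" "src y' = B'" "trg y' = C"
    "arr b" "src b = B" "trg b = B'" "arr b'" "src b' = B'" "trg b' = B"
    "arr c" "src c = C" "trg c = C" "arr c'" "src c' = C" "trg c' = C"
    using ob xy b'(1,2) c'(1,2) by (simp_all add: mor_iff)
  have "b' \<cdot> x' = (b' \<cdot> b) \<cdot> x" using ar eqs(1) by (simp add: comp_assoc_arr)
  then have 1: "b' \<cdot> x' = x" using b'(3) ar by simp
  have "c' \<cdot> y' = c' \<cdot> ((y' \<cdot> b) \<cdot> b')" using ar b'(4) by (simp add: comp_assoc_arr)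
  also have "\<dots> = (c' \<cdot> c) \<cdot> (y \<cdot> b')" unfolding eqs(2) using ar by (simp add: comp_assoc_arr)
  also have "\<dots> = y \<cdot> b'" using ar c'(3) by simp
  finally have "y \<cdot> b' = c' \<cdot> y'" by simp
  then show ?thesis using that 1 b'(5) c' by blast
qed

lemma sequence_iso_comp:
  assumes ob: "A \<in> Obj K" "B \<in> Obj K" "B' \<in> Obj K" "B'' \<in> Obj K" "C \<in> Obj K"
    and xy: "x \<in> mor K A B" "y \<in> mor K B C" "y' \<in> mor K B' C" "y'' \<in> mor K B'' C"
    and b: "is_iso K B B' b" and c: "is_iso K C C c" and eqs: "b \<cdot> x = x'" "y' \<cdot> b = c \<cdot> y"
    and d: "is_iso K B' B'' d" and e: "is_iso K C C e" and eqs': "d \<cdot> x' = x''" "y'' \<cdot> d = e \<cdot> y'"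
  shows "is_iso K B B'' (d \<cdot> b)" "is_iso K C C (e \<cdot> c)" "(d \<cdot> b) \<cdot> x = x''"
    "y'' \<cdot> (d \<cdot> b) = (e \<cdot> c) \<cdot> y"
proof -
  have "b \<in> mor K B B'" "c \<in> mor K C C" "d \<in> mor K B' B''" "e \<in> mor K C C"
    using b c d e unfolding is_iso_def by auto
  then have ar: "arr x" "src x = A" "trg x = B" "arr y" "src y = B" "trg y = C"
    "arr y'" "src y' = B'" "trg y' = C" "arr y''" "src y'' = B''" "trg y'' = C"
    "arr b" "src b = B" "trg b = B'" "arr d" "src d = B'" "trg d = B''"
    "arr c" "src c = C" "trg c = C" "arr e" "src e = C" "trg e = C"
    using ob xy by (simp_all add: mor_iff)
  show "is_iso K B B'' (d \<cdot> b)" "is_iso K C C (e \<cdot> c)"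
    using is_iso_comp[OF ob(2,3,4) b d] is_iso_comp[OF ob(5,5,5) c e] .
  show "(d \<cdot> b) \<cdot> x = x''" using ar eqs(1) eqs'(1) by (simp add: comp_assoc_arr)
  have "y'' \<cdot> (d \<cdot> b) = (e \<cdot> y') \<cdot> b" using ar eqs'(2) comp_assoc_arr[of b d y''] by simp
  then show "y'' \<cdot> (d \<cdot> b) = (e \<cdot> c) \<cdot> y" using ar eqs(2) by (simp add: comp_assoc_arr)
qed

lemma ses_equiv_iff:
  "((A, x, B, y, C), (A', x', B', y', C')) \<in> ses_equiv K X \<longleftrightarrow>
     (A, x, B, y, C) \<in> X \<and> (A', x', B', y', C') \<in> X \<and> A' = A \<and> C' = C \<and>
     (\<exists>b c. is_iso K B B' b \<and> is_iso K C C c \<and> b \<cdot> x = x' \<and> y' \<cdot> b = c \<cdot> y)"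
  unfolding ses_equiv_def by simp

lemma ses_equiv_refl:
  assumes "X \<subseteq> short_sequences" "q \<in> X"
  shows "(q, q) \<in> ses_equiv K X"
proof -
  obtain A x B y C where q: "q = (A, x, B, y, C)" by (cases q) auto
  have ty: "A \<in> Obj K" "B \<in> Obj K" "C \<in> Obj K" "x \<in> mor K A B" "y \<in> mor K B C"
    using assms unfolding q short_sequences_def by auto
  show ?thesis
    unfolding q ses_equiv_iff
    using assms(2) is_iso_Idn[OF ty(2)] is_iso_Idn[OF ty(3)] ty
    unfolding q by (intro conjI exI[of _ "Idn K B"] exI[of _ "Idn K C"]) (simp_all add: mor_iff)
qed

lemma ses_equiv_sym:
  assumes "X \<subseteq> short_sequences" "(q, q') \<in> ses_equiv K X"
  shows "(q', q) \<in> ses_equiv K X"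
proof -
  obtain A x B y C where q: "q = (A, x, B, y, C)" by (cases q) auto
  obtain A' x' B' y' C' where q': "q' = (A', x', B', y', C')" by (cases q') auto
  have eq: "A' = A" "C' = C" and qX: "q \<in> X" "q' \<in> X" using assms(2) unfolding q q' ses_equiv_iff by auto
  have ty: "A \<in> Obj K" "B \<in> Obj K" "B' \<in> Obj K" "C \<in> Obj K" "x \<in> mor K A B" "y \<in> mor K B C"
     "x' \<in> mor K A B'" "y' \<in> mor K B' C"
    using assms(1) qX eq unfolding q q' short_sequences_def by auto
  obtain b c where bc: "is_iso K B B' b" "is_iso K C C c" "b \<cdot> x = x'" "y' \<cdot> b = c \<cdot> y"
    using assms(2) unfolding q q' ses_equiv_iff by blast
  obtain b' c' where "is_iso K B' B b'" "is_iso K C C c'" "b' \<cdot> x' = x" "y \<cdot> b' = c' \<cdot> y'"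
    using ty bc by (rule sequence_iso_inverse)
  then show ?thesis unfolding q q' ses_equiv_iff eq using qX unfolding q q' eq by blast
qed

lemma ses_equiv_trans:
  assumes "X \<subseteq> short_sequences" "(q, q') \<in> ses_equiv K X" "(q', q'') \<in> ses_equiv K X"
  shows "(q, q'') \<in> ses_equiv K X"
proof -
  obtain A x B y C where q: "q = (A, x, B, y, C)" by (cases q) auto
  obtain A' x' B' y' C' where q': "q' = (A', x', B', y', C')" by (cases q') auto
  obtain A'' x'' B'' y'' C'' where q'': "q'' = (A'', x'', B'', y'', C'')" by (cases q'') auto
  have eq: "A' = A" "C' = C" "A'' = A" "C'' = C" and qX: "q \<in> X" "q' \<in> X" "q'' \<in> X"
    using assms(2,3) unfolding q q' q'' ses_equiv_iff by auto
  have ty: "A \<in> Obj K" "B \<in> Obj K" "B' \<in> Obj K" "B'' \<in> Obj K" "C \<in> Obj K"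
     "x \<in> mor K A B" "y \<in> mor K B C" "y' \<in> mor K B' C" "y'' \<in> mor K B'' C"
    using assms(1) qX eq unfolding q q' q'' short_sequences_def by auto
  obtain b c where bc: "is_iso K B B' b" "is_iso K C C c" "b \<cdot> x = x'" "y' \<cdot> b = c \<cdot> y"
    using assms(2) unfolding q q' ses_equiv_iff by blast
  obtain d e where de: "is_iso K B' B'' d" "is_iso K C C e" "d \<cdot> x' = x''" "y'' \<cdot> d = e \<cdot> y'"
    using assms(3) unfolding q' q'' ses_equiv_iff eq by blast
  show ?thesis
    unfolding q q'' ses_equiv_iff eq
    using sequence_iso_comp[OF ty bc de] qX unfolding q q'' eq by blast
qed

lemma left_factoring_iso:
  assumes "A \<in> Obj K" "B \<in> Obj K" "B' \<in> Obj K" "x \<in> mor K A B" "is_iso K B B' b" "left_factoring K A B x"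
  shows "left_factoring K A B' (b \<cdot> x)"
  unfolding left_factoring_def
proof (intro ballI impI)
  fix M f assume M: "M \<in> Obj K" and f: "f \<in> mor K A M" "\<not> is_section K A M f"
  obtain g where g: "g \<in> mor K B M" "f = g \<cdot> x" using assms(6) M f unfolding left_factoring_def by blast
  obtain b' where b': "b \<in> mor K B B'" "b' \<in> mor K B' B" "b' \<cdot> b = Idn K B" using assms(5) by (rule is_isoE)
  have "f = g \<cdot> ((b' \<cdot> b) \<cdot> x)" unfolding b'(3) g(2) using g(1) assms(1-4) M by (simp add: mor_iff)
  also have "\<dots> = (g \<cdot> b') \<cdot> (b \<cdot> x)" using g(1) b'(1,2) assms(1-4) M by (simp add: mor_iff comp_assoc_arr)
  finally have "f = (g \<cdot> b') \<cdot> (b \<cdot> x)" .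
  moreover have "g \<cdot> b' \<in> mor K B' M" using g(1) b'(2) assms(2,3) M by (simp add: mor_iff)
  ultimately show "\<exists>g\<in>mor K B' M. f = g \<cdot> (b \<cdot> x)" by blast
qed

lemma right_factoring_iso:
  assumes "C \<in> Obj K" "B \<in> Obj K" "B' \<in> Obj K" "y \<in> mor K B C" "y' \<in> mor K B' C"
    and "is_iso K B B' b" "is_iso K C C c" "y' \<cdot> b = c \<cdot> y" "right_factoring K B C y"
  shows "right_factoring K B' C y'"
  unfolding right_factoring_def
proof (intro ballI impI)
  fix N f assume N: "N \<in> Obj K" and f: "f \<in> mor K N C" "\<not> is_retraction K N C f"
  obtain c' where c': "c \<in> mor K C C" "c' \<in> mor K C C" "c' \<cdot> c = Idn K C" "c \<cdot> c' = Idn K C"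
    using assms(7) by (rule is_isoE)
  have b: "b \<in> mor K B B'" using assms(6) unfolding is_iso_def by blast
  have ar: "arr c" "src c = C" "trg c = C" "arr c'" "src c' = C" "trg c' = C"
    "arr f" "src f = N" "trg f = C" "arr b" "src b = B" "trg b = B'"
    "arr y" "src y = B" "trg y = C" "arr y'" "src y' = B'" "trg y' = C"
    using c'(1,2) f(1) b assms N by (simp_all add: mor_iff)
  have "\<not> is_retraction K N C (c' \<cdot> f)"
  proof
    assume "is_retraction K N C (c' \<cdot> f)"
    then obtain t where t: "t \<in> mor K C N" "(c' \<cdot> f) \<cdot> t = Idn K C" unfolding is_retraction_def by blast
    have art: "arr t" "src t = C" "trg t = N" using t(1) assms(1) N by (simp_all add: mor_iff)
    have "f \<cdot> (t \<cdot> c') = (c \<cdot> c') \<cdot> (f \<cdot> (t \<cdot> c'))" unfolding c'(4) using ar art by simp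
    also have "\<dots> = c \<cdot> (((c' \<cdot> f) \<cdot> t) \<cdot> c')" using ar art by (simp add: comp_assoc_arr)
    also have "\<dots> = Idn K C" unfolding t(2) using ar c'(4) by simp
    finally have "f \<cdot> (t \<cdot> c') = Idn K C" .
    moreover have "t \<cdot> c' \<in> mor K C N" using ar art assms(1) N by (simp add: mor_iff)
    ultimately show False using f unfolding is_retraction_def by blast
  qed
  moreover have "c' \<cdot> f \<in> mor K N C" using ar assms(1) N by (simp add: mor_iff)
  ultimately obtain g where g: "g \<in> mor K N B" "c' \<cdot> f = y \<cdot> g"
    using assms(9) N unfolding right_factoring_def by blast
  have arg: "arr g" "src g = N" "trg g = B" using g(1) assms(2) N by (simp_all add: mor_iff)
  have "f = c \<cdot> (c' \<cdot> f)" using ar c'(4) by (simp add: comp_assoc_arr[symmetric])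
  also have "\<dots> = (y' \<cdot> b) \<cdot> g" unfolding g(2) assms(8) using ar arg by (simp add: comp_assoc_arr)
  also have "\<dots> = y' \<cdot> (b \<cdot> g)" using ar arg by (simp add: comp_assoc_arr)
  finally have "f = y' \<cdot> (b \<cdot> g)" .
  moreover have "b \<cdot> g \<in> mor K N B'" using ar arg assms(3) N by (simp add: mor_iff)
  ultimately show "\<exists>g\<in>mor K N B'. f = y' \<cdot> g" by blast
qed

lemma split_ses_iso:
  assumes "A \<in> Obj K" "B \<in> Obj K" "B' \<in> Obj K" "C \<in> Obj K" "x \<in> mor K A B" "y \<in> mor K B C"
    and "y' \<in> mor K B' C" "is_iso K B B' b" "is_iso K C C c" "y' \<cdot> b = c \<cdot> y" "split_ses K A x B y C"
  shows "split_ses K A (b \<cdot> x) B' y' C"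
proof -
  obtain b' where b': "b \<in> mor K B B'" "b' \<in> mor K B' B" "b' \<cdot> b = Idn K B" "b \<cdot> b' = Idn K B'"
    using assms(8) by (rule is_isoE)
  obtain c' where c': "c \<in> mor K C C" "c' \<in> mor K C C" "c' \<cdot> c = Idn K C" "c \<cdot> c' = Idn K C"
    using assms(9) by (rule is_isoE)
  obtain t r where "is_biproduct K B A C x t r y" using assms(11) unfolding split_ses_def by blast
  then have bi: "t \<in> mor K C B" "r \<in> mor K B A" "r \<cdot> x = Idn K A" "y \<cdot> t = Idn K C"
     "r \<cdot> t = zero C A" "y \<cdot> x = zero A C" and sum: "(x \<cdot> r) \<otimes>\<^bsub>Hom K B B\<^esub> (t \<cdot> y) = Idn K B"
    unfolding is_biproduct_def by auto
  have ar: "arr x" "src x = A" "trg x = B" "arr y" "src y = B" "trg y = C" "arr y'" "src y' = B'" "trg y' = C"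
    "arr b" "src b = B" "trg b = B'" "arr b'" "src b' = B'" "trg b' = B"
    "arr c" "src c = C" "trg c = C" "arr c'" "src c' = C" "trg c' = C"
    "arr t" "src t = C" "trg t = B" "arr r" "src r = B" "trg r = A"
    using assms(1-7) b'(1,2) c'(1,2) bi(1,2) by (simp_all add: mor_iff)
  have "y' = (y' \<cdot> b) \<cdot> b'" using ar b'(4) by (simp add: comp_assoc_arr)
  then have y': "y' = c \<cdot> (y \<cdot> b')" unfolding assms(10) using ar by (simp add: comp_assoc_arr)
  have xr: "x \<cdot> r \<oplus> t \<cdot> y = Idn K B"
    using sum hom_mult_eq_add[OF assms(2,2), of "x \<cdot> r"] ar assms(2) by (simp add: mor_iff)
  have "(r \<cdot> b') \<cdot> (b \<cdot> x) = r \<cdot> ((b' \<cdot> b) \<cdot> x)" using ar by (simp add: comp_assoc_arr)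
  then have 1: "(r \<cdot> b') \<cdot> (b \<cdot> x) = Idn K A" unfolding b'(3) using ar bi(3) by simp
  have "y' \<cdot> (b \<cdot> t \<cdot> c') = (y' \<cdot> b) \<cdot> (t \<cdot> c')" using ar by (simp add: comp_assoc_arr)
  also have "\<dots> = c \<cdot> ((y \<cdot> t) \<cdot> c')" unfolding assms(10) using ar by (simp add: comp_assoc_arr)
  also have "\<dots> = Idn K C" unfolding bi(4) using ar c'(4) by simp
  finally have 2: "y' \<cdot> (b \<cdot> t \<cdot> c') = Idn K C" .
  have "(r \<cdot> b') \<cdot> (b \<cdot> t \<cdot> c') = r \<cdot> (((b' \<cdot> b) \<cdot> t) \<cdot> c')" using ar by (simp add: comp_assoc_arr)
  also have "\<dots> = (r \<cdot> t) \<cdot> c'" unfolding b'(3) using ar by (simp add: comp_assoc_arr)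
  finally have 3: "(r \<cdot> b') \<cdot> (b \<cdot> t \<cdot> c') = zero C A" unfolding bi(5) using ar assms(1) by simp
  have "y' \<cdot> (b \<cdot> x) = c \<cdot> (y \<cdot> x)" using ar assms(10) by (simp add: comp_assoc_arr[symmetric])
  then have 4: "y' \<cdot> (b \<cdot> x) = zero A C" unfolding bi(6) using ar assms(1) by simp
  have "(b \<cdot> t \<cdot> c') \<cdot> y' = b \<cdot> (t \<cdot> ((c' \<cdot> c) \<cdot> (y \<cdot> b')))" unfolding y' using ar by (simp add: comp_assoc_arr)
  also have "\<dots> = b \<cdot> ((t \<cdot> y) \<cdot> b')" unfolding c'(3) using ar by (simp add: comp_assoc_arr)
  finally have "(b \<cdot> x) \<cdot> (r \<cdot> b') \<oplus> (b \<cdot> t \<cdot> c') \<cdot> y' = b \<cdot> ((x \<cdot> r \<oplus> t \<cdot> y) \<cdot> b')"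
    using ar by (simp add: comp_assoc_arr)
  then have 5: "(b \<cdot> x) \<cdot> (r \<cdot> b') \<oplus> (b \<cdot> t \<cdot> c') \<cdot> y' = Idn K B'" unfolding xr using ar b'(4) by simp
  have "is_biproduct K B' A C (b \<cdot> x) (b \<cdot> t \<cdot> c') (r \<cdot> b') y'"
    unfolding is_biproduct_def
  proof (intro conjI)
    show "(b \<cdot> x \<cdot> (r \<cdot> b')) \<otimes>\<^bsub>Hom K B' B'\<^esub> (b \<cdot> t \<cdot> c' \<cdot> y') = Idn K B'"
      using 5 hom_mult_eq_add[OF assms(3,3), of "b \<cdot> x \<cdot> (r \<cdot> b')"] ar assms(3) by (simp add: mor_iff)
  qed (use 1 2 3 4 ar assms(1,3,4) in \<open>simp_all add: mor_iff\<close>)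
  then show ?thesis unfolding split_ses_def by blast
qed

lemma almost_split_ses_equiv:
  assumes "X \<subseteq> short_sequences" "(q, q') \<in> ses_equiv K X" "q \<in> almost_split_ses K X"
  shows "q' \<in> almost_split_ses K X"
proof -
  obtain A x B y C where q: "q = (A, x, B, y, C)" by (cases q) auto
  obtain A' x' B' y' C' where q': "q' = (A', x', B', y', C')" by (cases q') auto
  have eq: "A' = A" "C' = C" and qX: "q \<in> X" "q' \<in> X"
    using assms(2) unfolding q q' ses_equiv_iff by auto
  have ty: "A \<in> Obj K" "B \<in> Obj K" "B' \<in> Obj K" "C \<in> Obj K" "x \<in> mor K A B" "y \<in> mor K B C"
     "x' \<in> mor K A B'" "y' \<in> mor K B' C"
    using assms(1) qX eq unfolding q q' short_sequences_def by auto
  obtain b c where b: "is_iso K B B' b" and c: "is_iso K C C c" and eqs: "b \<cdot> x = x'" "y' \<cdot> b = c \<cdot> y"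
    using assms(2) unfolding q q' ses_equiv_iff by blast
  have "(q', q) \<in> ses_equiv K X" using ses_equiv_sym[OF assms(1,2)] .
  then obtain b' c' where b': "is_iso K B' B b'" and c': "is_iso K C C c'"
    and eqs': "b' \<cdot> x' = x" "y \<cdot> b' = c' \<cdot> y'"
    unfolding q q' ses_equiv_iff eq by blast
  have as: "\<not> split_ses K A x B y C" "left_factoring K A B x" "right_factoring K B C y"
    using assms(3) unfolding q almost_split_ses_def by auto
  have "\<not> split_ses K A x' B' y' C"
    using split_ses_iso[OF ty(1,3,2,4,7,8,6) b' c' eqs'(2)] as(1) eqs'(1) by blast
  moreover have "left_factoring K A B' x'"
    using left_factoring_iso[OF ty(1,2,3,5) b as(2)] eqs(1) by simp
  moreover have "right_factoring K B' C y'"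
    using right_factoring_iso[OF ty(4,2,3,6,8) b c eqs(2) as(3)] .
  ultimately show ?thesis using qX(2) unfolding q' eq almost_split_ses_def by simp
qed

end

section \<open>Lifting along the functor to the heart\<close>

lemma heart_extri_sel [simp]:
  "Obj (heart_extri K S T U V) = heart_obj K S T U V"
  "Hom (heart_extri K S T U V) = Hom K" "Cmp (heart_extri K S T U V) = Cmp K"
  "Idn (heart_extri K S T U V) = Idn K" "ExtMap (heart_extri K S T U V) = ExtMap K"
  "\<one>\<^bsub>Ext (heart_extri K S T U V) C A\<^esub> = \<one>\<^bsub>Ext K C A\<^esub>"
  "is_iso (heart_extri K S T U V) A B f = is_iso K A B f"
  "is_section (heart_extri K S T U V) A B f = is_section K A B f"
  "is_retraction (heart_extri K S T U V) A B f = is_retraction K A B f"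
  unfolding is_iso_def is_section_def is_retraction_def heart_extri_def by simp_all

context twin_heart
begin

abbreviation HE :: "('o, 'm, 'e) extricat" where "HE \<equiv> heart_extri K S T U V"

lemma triangle_equiv_iff:
  "(((A, x, B, y, C), \<delta>), ((A', x', B', y', C'), \<delta>')) \<in> triangle_equiv HE \<longleftrightarrow>
     F_triangle A x B y C \<delta> \<and> F_triangle A' x' B' y' C' \<delta>' \<and> A' = A \<and> C' = C \<and>
     (\<exists>b c. is_iso K B B' b \<and> is_iso K C C c \<and> b \<cdot> x = x' \<and> y' \<cdot> b = c \<cdot> y \<and> \<delta> = pull K c A \<delta>')"
proof -
  have "push K C (Idn K A) \<delta> = \<delta>" if "F_triangle A x B y C \<delta>"
    using etriangleD[OF F_triangleD(4)[OF that]] ExtMap_Idn by blast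
  then show ?thesis
    unfolding triangle_equiv_def by (simp add: heart_etriangle cong: conj_cong)
qed

lemma triangle_equiv_refl:
  assumes "F_triangle A x B y C \<delta>"
  shows "(((A, x, B, y, C), \<delta>), ((A, x, B, y, C), \<delta>)) \<in> triangle_equiv HE"
proof -
  note ty = etriangleD[OF F_triangleD(4)[OF assms]]
  show ?thesis unfolding triangle_equiv_iff
    using assms is_iso_Idn[OF ty(2)] is_iso_Idn[OF ty(3)] ty ExtMap_Idn[OF ty(1,3,6)]
    by (intro conjI exI[of _ "Idn K B"] exI[of _ "Idn K C"]) (simp_all add: mor_iff)
qed

lemma triangle_equiv_sym:
  assumes "(t, t') \<in> triangle_equiv HE"
  shows "(t', t) \<in> triangle_equiv HE"
proof -
  obtain A x B y C \<delta> where q: "t = ((A, x, B, y, C), \<delta>)" by (cases t) auto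
  obtain A' x' B' y' C' \<delta>' where q': "t' = ((A', x', B', y', C'), \<delta>')" by (cases t') auto
  have eq: "A' = A" "C' = C" and F: "F_triangle A x B y C \<delta>" "F_triangle A x' B' y' C \<delta>'"
    using assms unfolding q q' triangle_equiv_iff by auto
  obtain b c where bc: "is_iso K B B' b" "is_iso K C C c" "b \<cdot> x = x'" "y' \<cdot> b = c \<cdot> y"
    and \<delta>: "\<delta> = pull K c A \<delta>'"
    using assms unfolding q q' triangle_equiv_iff by blast
  note ty = etriangleD[OF F_triangleD(4)[OF F(1)]] and ty' = etriangleD[OF F_triangleD(4)[OF F(2)]]
  obtain b' c' where b': "is_iso K B' B b'" "is_iso K C C c'" "b' \<cdot> x' = x" "y \<cdot> b' = c' \<cdot> y'"
    and c': "c \<in> mor K C C" "c' \<in> mor K C C" "c \<cdot> c' = Idn K C"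
    using ty(1,2) ty'(2) ty(3-5) ty'(4,5) bc by (rule sequence_iso_inverse)
  have "pull K c' A \<delta> = \<delta>'"
    unfolding \<delta> using pull_comp[OF ty(1,3,3,3) c'(1,2) ty'(6)] c'(3) ExtMap_Idn[OF ty'(1,3,6)] by simp
  then show ?thesis unfolding q q' triangle_equiv_iff eq using b' F by blast
qed

lemma triangle_equiv_trans:
  assumes "(t, t') \<in> triangle_equiv HE" "(t', t'') \<in> triangle_equiv HE"
  shows "(t, t'') \<in> triangle_equiv HE"
proof -
  obtain A x B y C \<delta> where q: "t = ((A, x, B, y, C), \<delta>)" by (cases t) auto
  obtain A' x' B' y' C' \<delta>' where q': "t' = ((A', x', B', y', C'), \<delta>')" by (cases t') auto
  obtain A'' x'' B'' y'' C'' \<delta>'' where q'': "t'' = ((A'', x'', B'', y'', C''), \<delta>'')" by (cases t'') auto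
  have eq: "A' = A" "C' = C" "A'' = A" "C'' = C"
    and F: "F_triangle A x B y C \<delta>" "F_triangle A x' B' y' C \<delta>'" "F_triangle A x'' B'' y'' C \<delta>''"
    using assms unfolding q q' q'' triangle_equiv_iff by auto
  note ty = etriangleD[OF F_triangleD(4)[OF F(1)]] and ty' = etriangleD[OF F_triangleD(4)[OF F(2)]]
    and ty'' = etriangleD[OF F_triangleD(4)[OF F(3)]]
  obtain b c where bc: "is_iso K B B' b" "is_iso K C C c" "b \<cdot> x = x'" "y' \<cdot> b = c \<cdot> y"
    and \<delta>: "\<delta> = pull K c A \<delta>'"
    using assms(1) unfolding q q' triangle_equiv_iff by blast
  obtain d e where de: "is_iso K B' B'' d" "is_iso K C C e" "d \<cdot> x' = x''" "y'' \<cdot> d = e \<cdot> y'"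
    and \<delta>': "\<delta>' = pull K e A \<delta>''"
    using assms(2) unfolding q' q'' triangle_equiv_iff eq by blast
  have "c \<in> mor K C C" "e \<in> mor K C C" using bc(2) de(2) unfolding is_iso_def by auto
  then have "\<delta> = pull K (e \<cdot> c) A \<delta>''"
    unfolding \<delta> \<delta>' using pull_comp[OF ty(1,3,3,3) _ _ ty''(6)] by simp
  then show ?thesis
    unfolding q q'' triangle_equiv_iff eq
    using sequence_iso_comp[OF ty(1,2) ty'(2) ty''(2) ty(3-5) ty'(5) ty''(5) bc de] F(1,3) by blast
qed

lemma is_iso_quotientI:
  assumes "A \<in> H" "B \<in> H" "f \<in> mor K A B"
    and "l \<in> mor K B A" "Q A A (l \<cdot> f) = Q A A (Idn K A)"
    and "r \<in> mor K B A" "Q B B (f \<cdot> r) = Q B B (Idn K B)"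
  shows "is_iso QK A B (Q A B f)"
  by (rule QK.is_isoI[where l = "Q B A l" and r = "Q B A r"])
    (use assms Cmp_quotient Q_mor in \<open>simp_all add: Idn_quotient\<close>)

lemma F_triangle_image:
  assumes "F_triangle A x B y C \<delta>"
  shows "(A, Q A B x, B, Q B C y, C) \<in> heart_ses K S T U V"
proof -
  note F = F_triangleD[OF assms] and ty = etriangleD[OF F_triangleD(4)[OF assms]]
  have Qm: "Q A B x \<in> mor QK A B" "Q B C y \<in> mor QK B C" using Q_mor ty by auto
  have "ses_isomorphic QK (A, Q A B x, B, Q B C y, C) (A, Q A B x, B, Q B C y, C)"
    unfolding ses_isomorphic_def prod.case
    by (rule exI[of _ "Idn QK A"], rule exI[of _ "Idn QK B"], rule exI[of _ "Idn QK C"])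
      (use QK.is_iso_Idn F(1-3) QK.comp_id[OF _ _ Qm(1)] QK.id_comp[OF _ _ Qm(1)]
        QK.comp_id[OF _ _ Qm(2)] QK.id_comp[OF _ _ Qm(2)] in simp)
  then show ?thesis
    unfolding heart_ses_def heart_eq
    using assms F(1-3) Qm
    by (auto simp: sequences_def heart_etriangle heart_image_def intro!: exI[of _ \<delta>])
      blast
qed

lemma heart_ses_short: "heart_ses K S T U V \<subseteq> QK.short_sequences"
  unfolding heart_ses_def QK.short_sequences_def heart_eq sequences_def by auto

lemma heart_ses_cases:
  assumes "(A, x, B, y, C) \<in> heart_ses K S T U V"
  obtains A' x' B' y' C' \<delta>' a b c where "F_triangle A' x' B' y' C' \<delta>'"
    "is_iso QK A' A a" "is_iso QK B' B b" "is_iso QK C' C c"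
    "b \<bullet> Q A' B' x' = x \<bullet> a" "c \<bullet> Q B' C' y' = y \<bullet> b"
proof -
  from assms obtain A' x' B' y' C' \<delta> where "F_triangle A' x' B' y' C' \<delta>"
    "ses_isomorphic QK (heart_image K S T U V ((A', x', B', y', C'), \<delta>)) (A, x, B, y, C)"
    unfolding heart_ses_def heart_eq heart_etriangle by blast
  then show ?thesis using that unfolding heart_image_def ses_isomorphic_def by auto
qed

lemma image_equiv:
  assumes "(t, t') \<in> triangle_equiv HE"
  shows "(heart_image K S T U V t, heart_image K S T U V t') \<in> ses_equiv QK (heart_ses K S T U V)"
proof -
  obtain A x B y C \<delta> where q: "t = ((A, x, B, y, C), \<delta>)" by (cases t) auto
  obtain A' x' B' y' C' \<delta>' where q': "t' = ((A', x', B', y', C'), \<delta>')" by (cases t') auto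
  have eq: "A' = A" "C' = C" and F: "F_triangle A x B y C \<delta>" "F_triangle A x' B' y' C \<delta>'"
    using assms unfolding q q' triangle_equiv_iff by auto
  obtain b c where b: "is_iso K B B' b" and c: "is_iso K C C c" and eqs: "b \<cdot> x = x'" "y' \<cdot> b = c \<cdot> y"
    using assms unfolding q q' triangle_equiv_iff by blast
  note ty = etriangleD[OF F_triangleD(4)[OF F(1)]] and ty' = etriangleD[OF F_triangleD(4)[OF F(2)]]
  note D = F_triangleD(1-3)[OF F(1)] and D' = F_triangleD(1-3)[OF F(2)]
  obtain b' where b': "b \<in> mor K B B'" "b' \<in> mor K B' B" "b' \<cdot> b = Idn K B" "b \<cdot> b' = Idn K B'"
    using b by (rule is_isoE)
  obtain c' where c': "c \<in> mor K C C" "c' \<in> mor K C C" "c' \<cdot> c = Idn K C" "c \<cdot> c' = Idn K C"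
    using c by (rule is_isoE)
  have "is_iso QK B B' (Q B B' b)" using is_iso_quotientI[OF D(2) D'(2) b'(1,2) _ b'(2)] b'(3,4) by simp
  moreover have "is_iso QK C C (Q C C c)" using is_iso_quotientI[OF D(3,3) c'(1,2) _ c'(2)] c'(3,4) by simp
  moreover have "Q B B' b \<bullet> Q A B x = Q A B' x'"
    using Cmp_quotient[OF D(1,2) D'(2) ty(4) b'(1)] eqs(1) by simp
  moreover have "Q B' C y' \<bullet> Q B B' b = Q C C c \<bullet> Q B C y"
    using Cmp_quotient[OF D(2) D'(2,3) b'(1) ty'(5)] Cmp_quotient[OF D(2,3,3) ty(5) c'(1)] eqs(2) by simp
  ultimately show ?thesis
    unfolding q q' heart_image_def prod.case QK.ses_equiv_iff eq
    using F_triangle_image[OF F(1)] F_triangle_image[OF F(2)] by blast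
qed

end

section \<open>Almost split sequences\<close>

context twin_heart
begin

text \<open>A left inverse of \<open>f\<close> in the heart is represented by an \<open>r\<close> such that \<open>r f\<close> is congruent to the
  identity, hence an automorphism.\<close>

lemma section_lifts:
  assumes "krull_schmidt K" "A \<in> H" "M \<in> H" "no_summand_in K W A" "f \<in> mor K A M"
  shows "is_section QK A M (Q A M f) \<longleftrightarrow> is_section K A M f"
proof
  have ob: "A \<in> Obj K" "M \<in> Obj K" using assms H_Obj by auto
  assume "is_section K A M f"
  then obtain r where r: "r \<in> mor K M A" "r \<cdot> f = Idn K A" unfolding is_section_def by blast
  then have "Q M A r \<bullet> Q A M f = Idn QK A"
    using Cmp_quotient[OF assms(2,3,2,5)] by (simp add: Idn_quotient)
  then show "is_section QK A M (Q A M f)"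
    unfolding is_section_def using Q_mor assms(5) r(1) by blast
next
  have ob: "A \<in> Obj K" "M \<in> Obj K" using assms H_Obj by auto
  assume "is_section QK A M (Q A M f)"
  then obtain R where R: "R \<in> mor QK M A" "R \<bullet> Q A M f = Idn QK A"
    unfolding is_section_def by blast
  obtain r where r: "r \<in> mor K M A" "R = Q M A r" using R(1) by (rule mor_quotientE)
  have "Q A A (r \<cdot> f) = Q A A (Idn K A)"
    using R(2) Cmp_quotient[OF assms(2,3,2,5) r(1)] r(2) by (simp add: Idn_quotient)
  moreover have rf: "r \<cdot> f \<in> mor K A A" using r(1) assms(5) ob by (simp add: mor_iff)
  ultimately obtain w where "w \<in> I A A" "r \<cdot> f = Idn K A \<oplus> w" using Q_id_iff[OF ob(1)] by blast
  then have "is_iso K A A (r \<cdot> f)" using one_plus_W_iso[OF assms(1) ob(1) assms(4)] by simp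
  then obtain v where v: "v \<in> mor K A A" "v \<cdot> (r \<cdot> f) = Idn K A" by (rule is_isoE)
  then have "(v \<cdot> r) \<cdot> f = Idn K A" "v \<cdot> r \<in> mor K M A"
    using r(1) assms(5) ob by (simp_all add: mor_iff comp_assoc_arr)
  then show "is_section K A M f" unfolding is_section_def using assms(5) by blast
qed

lemma retraction_lifts:
  assumes "krull_schmidt K" "C \<in> H" "N \<in> H" "no_summand_in K W C" "f \<in> mor K N C"
  shows "is_retraction QK N C (Q N C f) \<longleftrightarrow> is_retraction K N C f"
proof
  have ob: "C \<in> Obj K" "N \<in> Obj K" using assms H_Obj by auto
  assume "is_retraction K N C f"
  then obtain t where t: "t \<in> mor K C N" "f \<cdot> t = Idn K C" unfolding is_retraction_def by blast
  then have "Q N C f \<bullet> Q C N t = Idn QK C"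
    using Cmp_quotient[OF assms(2,3,2) t(1) assms(5)] by (simp add: Idn_quotient)
  then show "is_retraction QK N C (Q N C f)"
    unfolding is_retraction_def using Q_mor assms(5) t(1) by blast
next
  have ob: "C \<in> Obj K" "N \<in> Obj K" using assms H_Obj by auto
  assume "is_retraction QK N C (Q N C f)"
  then obtain R where R: "R \<in> mor QK C N" "Q N C f \<bullet> R = Idn QK C"
    unfolding is_retraction_def by blast
  obtain t where t: "t \<in> mor K C N" "R = Q C N t" using R(1) by (rule mor_quotientE)
  have "Q C C (f \<cdot> t) = Q C C (Idn K C)"
    using R(2) Cmp_quotient[OF assms(2,3,2) t(1) assms(5)] t(2) by (simp add: Idn_quotient)
  moreover have ft: "f \<cdot> t \<in> mor K C C" using t(1) assms(5) ob by (simp add: mor_iff)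
  ultimately obtain w where "w \<in> I C C" "f \<cdot> t = Idn K C \<oplus> w" using Q_id_iff[OF ob(1)] by blast
  then have "is_iso K C C (f \<cdot> t)" using one_plus_W_iso[OF assms(1) ob(1) assms(4)] by simp
  then obtain v where v: "v \<in> mor K C C" "f \<cdot> t \<cdot> v = Idn K C" by (rule is_isoE)
  then have "f \<cdot> (t \<cdot> v) = Idn K C" "t \<cdot> v \<in> mor K C N"
    using t(1) assms(5) ob by (simp_all add: mor_iff comp_assoc_arr)
  then show "is_retraction K N C f" unfolding is_retraction_def using assms(5) by blast
qed

lemma left_factoring_quotient:
  assumes "krull_schmidt K" "F_triangle A x B y C \<delta>" "no_summand_in K W A"
  shows "left_factoring QK A B (Q A B x) \<longleftrightarrow> left_factoring HE A B x"
proof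
  note F = F_triangleD[OF assms(2)] and ty = etriangleD[OF F_triangleD(4)[OF assms(2)]]
  assume l: "left_factoring QK A B (Q A B x)"
  show "left_factoring HE A B x"
    unfolding left_factoring_def heart_extri_sel
  proof (intro ballI impI)
    fix M f assume M: "M \<in> H" and f: "f \<in> mor K A M" and ns: "\<not> is_section K A M f"
    then have "\<not> is_section QK A M (Q A M f)" using section_lifts[OF assms(1) F(1) M assms(3) f] by blast
    then obtain G where G: "G \<in> mor QK B M" "Q A M f = G \<bullet> Q A B x"
      using l M Q_mor[OF f] unfolding left_factoring_def Obj_quotient by blast
    obtain g where g: "g \<in> mor K B M" "G = Q B M g" using G(1) by (rule mor_quotientE)
    have "Q A M f = Q A M (g \<cdot> x)" using G(2) g(2) Cmp_quotient[OF F(1,2) M ty(4) g(1)] by simp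
    then show "\<exists>g\<in>mor K B M. f = g \<cdot> x"
      using W_monic_factor[OF ty(1,2) _ ty(4) F(5) f g(1)] M H_Obj by blast
  qed
next
  note F = F_triangleD[OF assms(2)] and ty = etriangleD[OF F_triangleD(4)[OF assms(2)]]
  assume l: "left_factoring HE A B x"
  show "left_factoring QK A B (Q A B x)"
    unfolding left_factoring_def Obj_quotient
  proof (intro ballI impI)
    fix M f' assume M: "M \<in> H" and f': "f' \<in> mor QK A M" and ns: "\<not> is_section QK A M f'"
    obtain f where f: "f \<in> mor K A M" "f' = Q A M f" using f' by (rule mor_quotientE)
    have "\<not> is_section K A M f" using section_lifts[OF assms(1) F(1) M assms(3) f(1)] ns f(2) by blast
    then obtain g where g: "g \<in> mor K B M" "f = g \<cdot> x"
      using l M f(1) unfolding left_factoring_def heart_extri_sel by blast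
    then have "f' = Q B M g \<bullet> Q A B x" using f(2) Cmp_quotient[OF F(1,2) M ty(4) g(1)] by simp
    then show "\<exists>g\<in>mor QK B M. f' = g \<bullet> Q A B x" using Q_mor[OF g(1)] by blast
  qed
qed

lemma right_factoring_quotient:
  assumes "krull_schmidt K" "F_triangle A x B y C \<delta>" "no_summand_in K W C"
  shows "right_factoring QK B C (Q B C y) \<longleftrightarrow> right_factoring HE B C y"
proof
  note F = F_triangleD[OF assms(2)] and ty = etriangleD[OF F_triangleD(4)[OF assms(2)]]
  assume l: "right_factoring QK B C (Q B C y)"
  show "right_factoring HE B C y"
    unfolding right_factoring_def heart_extri_sel
  proof (intro ballI impI)
    fix N f assume N: "N \<in> H" and f: "f \<in> mor K N C" and ns: "\<not> is_retraction K N C f"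
    then have "\<not> is_retraction QK N C (Q N C f)"
      using retraction_lifts[OF assms(1) F(3) N assms(3) f] by blast
    then obtain G where G: "G \<in> mor QK N B" "Q N C f = Q B C y \<bullet> G"
      using l N Q_mor[OF f] unfolding right_factoring_def Obj_quotient by blast
    obtain g where g: "g \<in> mor K N B" "G = Q N B g" using G(1) by (rule mor_quotientE)
    have "Q N C f = Q N C (y \<cdot> g)" using G(2) g(2) Cmp_quotient[OF N F(2,3) g(1) ty(5)] by simp
    then show "\<exists>g\<in>mor K N B. f = y \<cdot> g"
      using W_epic_factor[OF ty(3,2) _ ty(5) F(6) f g(1)] N H_Obj by blast
  qed
next
  note F = F_triangleD[OF assms(2)] and ty = etriangleD[OF F_triangleD(4)[OF assms(2)]]
  assume l: "right_factoring HE B C y"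
  show "right_factoring QK B C (Q B C y)"
    unfolding right_factoring_def Obj_quotient
  proof (intro ballI impI)
    fix N f' assume N: "N \<in> H" and f': "f' \<in> mor QK N C" and ns: "\<not> is_retraction QK N C f'"
    obtain f where f: "f \<in> mor K N C" "f' = Q N C f" using f' by (rule mor_quotientE)
    have "\<not> is_retraction K N C f"
      using retraction_lifts[OF assms(1) F(3) N assms(3) f(1)] ns f(2) by blast
    then obtain g where g: "g \<in> mor K N B" "f = y \<cdot> g"
      using l N f(1) unfolding right_factoring_def heart_extri_sel by blast
    then have "f' = Q B C y \<bullet> Q N B g" using f(2) Cmp_quotient[OF N F(2,3) g(1) ty(5)] by simp
    then show "\<exists>g\<in>mor QK N B. f' = Q B C y \<bullet> g" using Q_mor[OF g(1)] by blast
  qed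
qed

text \<open>A retraction of \<open>x\<close> in the heart can be corrected to one in \<open>\<H>\<close> because the identity of \<open>A\<close>
  then factors through \<open>x\<close> modulo \<open>W\<close>.\<close>

lemma split_ses_image_iff:
  assumes "F_triangle A x B y C \<delta>"
  shows "split_ses QK A (Q A B x) B (Q B C y) C \<longleftrightarrow> \<delta> = \<one>\<^bsub>Ext K C A\<^esub>"
proof
  note F = F_triangleD[OF assms] and ty = etriangleD[OF F_triangleD(4)[OF assms]]
  assume "split_ses QK A (Q A B x) B (Q B C y) C"
  then obtain R where R: "R \<in> mor QK B A" "R \<bullet> Q A B x = Idn QK A"
    unfolding split_ses_def is_biproduct_def by blast
  obtain r where r: "r \<in> mor K B A" "R = Q B A r" using R(1) by (rule mor_quotientE)
  have "Q A A (Idn K A) = Q A A (r \<cdot> x)"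
    using R(2) Cmp_quotient[OF F(1,2,1) ty(4) r(1)] r(2) by (simp add: Idn_quotient)
  then obtain r' where "r' \<in> mor K B A" "Idn K A = r' \<cdot> x"
    using W_monic_factor[OF ty(1,2,1,4) F(5) id_mor[OF ty(1)] r(1)] by blast
  then have "is_section K A B x" unfolding is_section_def using ty(4) by metis
  then show "\<delta> = \<one>\<^bsub>Ext K C A\<^esub>" by (rule etriangle_section_zero[OF F(4)])
next
  note F = F_triangleD[OF assms] and ty = etriangleD[OF F_triangleD(4)[OF assms]]
  assume "\<delta> = \<one>\<^bsub>Ext K C A\<^esub>"
  then obtain t r where bi: "is_biproduct K B A C x t r y" using etriangle_zero_biproduct F(4) by blast
  then have tr: "t \<in> mor K C B" "r \<in> mor K B A" "r \<cdot> x = Idn K A" "y \<cdot> t = Idn K C"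
     "r \<cdot> t = zero C A" "y \<cdot> x = zero A C" and sum: "(x \<cdot> r) \<otimes>\<^bsub>Hom K B B\<^esub> (t \<cdot> y) = Idn K B"
    unfolding is_biproduct_def by auto
  have xr: "x \<cdot> r \<in> mor K B B" "t \<cdot> y \<in> mor K B B" using ty tr(1,2) by (simp_all add: mor_iff)
  have "is_biproduct QK B A C (Q A B x) (Q C B t) (Q B A r) (Q B C y)"
    unfolding is_biproduct_def
    using F(1-3) Q_mor ty tr Cmp_quotient add_quotient[OF ty(2,2) xr] sum hom_mult_eq_add[OF ty(2,2) xr(1)]
    by (simp add: Idn_quotient one_quotient)
  then show "split_ses QK A (Q A B x) B (Q B C y) C" unfolding split_ses_def by blast
qed

text \<open>Let \<open>A = Y \<oplus> Z\<close> with \<open>Y\<close> in \<open>W\<close>. The idempotent of \<open>Y\<close> factors through \<open>W\<close> and kills \<open>\<delta>\<close>. If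
  the idempotent of \<open>Z\<close> were not a section, it would factor through \<open>x\<close> and kill \<open>\<delta>\<close> too, so that
  \<open>\<delta> = 0\<close>. But a section that vanishes on \<open>Y\<close> forces \<open>Y = 0\<close>.\<close>

lemma almost_split_no_summand:
  assumes F: "F_triangle A x B y C \<delta>" and ns: "\<delta> \<noteq> \<one>\<^bsub>Ext K C A\<^esub>" and lf: "left_factoring HE A B x"
  shows "no_summand_in K W A"
  unfolding no_summand_in_def
proof (intro ballI impI)
  note D = F_triangleD[OF F] and ty = etriangleD[OF F_triangleD(4)[OF F]]
  fix Y assume Y: "Y \<in> W" "direct_summand K Y A"
  obtain Z i j p q where "is_biproduct K A Y Z i j p q" using Y(2) unfolding direct_summand_def by blast
  then have bi: "Y \<in> Obj K" "Z \<in> Obj K" "i \<in> mor K Y A" "j \<in> mor K Z A" "p \<in> mor K A Y" "q \<in> mor K A Z"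
    "p \<cdot> i = Idn K Y" "q \<cdot> i = zero Y Z" and sum: "(i \<cdot> p) \<otimes>\<^bsub>Hom K A A\<^esub> (j \<cdot> q) = Idn K A"
    unfolding is_biproduct_def by auto
  have ip: "i \<cdot> p \<in> mor K A A" "j \<cdot> q \<in> mor K A A" using bi ty(1) by (simp_all add: mor_iff)
  have "i \<cdot> p \<in> I A A" using factors_throughI[OF Y(1) bi(5,3) ip(1)] .
  then have 1: "push K C (i \<cdot> p) \<delta> = \<one>\<^bsub>Ext K C A\<^esub>" using push_W_monic_zero[OF D(4,5) ty(1)] by blast
  have "is_section K A A (j \<cdot> q)"
  proof (rule ccontr)
    assume "\<not> is_section K A A (j \<cdot> q)"
    then obtain g where "g \<in> mor K B A" "j \<cdot> q = g \<cdot> x"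
      using lf D(1) ip(2) unfolding left_factoring_def heart_extri_sel by blast
    then have 2: "push K C (j \<cdot> q) \<delta> = \<one>\<^bsub>Ext K C A\<^esub>" using push_factor[OF D(4) ty(1)] by simp
    have "\<delta> = push K C (i \<cdot> p \<oplus> j \<cdot> q) \<delta>"
      using sum hom_mult_eq_add[OF ty(1,1) ip(1)] ExtMap_Idn[OF ty(1,3,6)] by simp
    also have "\<dots> = \<one>\<^bsub>Ext K C A\<^esub> \<otimes>\<^bsub>Ext K C A\<^esub> \<one>\<^bsub>Ext K C A\<^esub>"
      using push_add[OF ty(1,1,3) ip ty(6)] 1 2 by simp
    also have "\<dots> = \<one>\<^bsub>Ext K C A\<^esub>"
      using comm_group.axioms(1)[OF Ext_comm_group[OF ty(1,3)]]
      by (simp add: comm_monoid.axioms(1) monoid.r_one monoid.one_closed)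
    finally show False using ns by blast
  qed
  then obtain s where s: "s \<in> mor K A A" "s \<cdot> (j \<cdot> q) = Idn K A" unfolding is_section_def by blast
  have "i = s \<cdot> (j \<cdot> q) \<cdot> i" unfolding s(2) using bi(1,3) ty(1) by (simp add: mor_iff)
  also have "\<dots> = s \<cdot> (j \<cdot> (q \<cdot> i))" using s(1) bi(1-6) ty(1) by (simp add: mor_iff comp_assoc_arr)
  also have "\<dots> = zero Y A" unfolding bi(8) using s(1) bi(1-6) ty(1) by (simp add: mor_iff)
  finally have "p \<cdot> i = p \<cdot> zero Y A" by simp
  then have "Idn K Y = zero Y Y" using bi(1,5,7) ty(1) by (simp add: mor_iff)
  then show "zero_object K Y" by (rule zero_objectI[OF bi(1)])
qed

lemma almost_split_no_summand_right:
  assumes F: "F_triangle A x B y C \<delta>" and ns: "\<delta> \<noteq> \<one>\<^bsub>Ext K C A\<^esub>" and rf: "right_factoring HE B C y"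
  shows "no_summand_in K W C"
proof -
  interpret op: twin_heart "opp K" V U T S by (rule twin_heart_opp)
  have "left_factoring (heart_extri (opp K) V U T S) C B y"
    using rf unfolding left_factoring_def right_factoring_def heart_extri_sel opp_heart_obj by simp
  then show ?thesis
    using op.almost_split_no_summand[of C y B x A \<delta>] F ns by (simp add: opp_F_triangle Int_commute)
qed

lemma almost_split_triangles_iff:
  "((A, x, B, y, C), \<delta>) \<in> almost_split_triangles HE \<longleftrightarrow>
     F_triangle A x B y C \<delta> \<and> \<delta> \<noteq> \<one>\<^bsub>Ext K C A\<^esub> \<and> left_factoring HE A B x \<and> right_factoring HE B C y"
  unfolding almost_split_triangles_def by (simp add: heart_etriangle)

lemma image_almost_split:
  assumes "krull_schmidt K" "F_triangle A x B y C \<delta>"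
    and "no_summand_in K W A" "no_summand_in K W C"
  shows "((A, x, B, y, C), \<delta>) \<in> almost_split_triangles HE \<longleftrightarrow>
    (A, Q A B x, B, Q B C y, C) \<in> heart_almost_split K S T U V"
  unfolding almost_split_triangles_iff heart_almost_split_def almost_split_ses_def heart_eq
  using assms F_triangle_image split_ses_image_iff left_factoring_quotient right_factoring_quotient
  by auto

text \<open>An endomorphism of \<open>C\<close> that is not a retraction factors through \<open>y\<close> and kills \<open>\<delta>\<close>. As
  \<open>c\<^sup>*\<delta>'\<close> is nonzero, \<open>c\<close> has a right inverse \<open>d\<close>. The complementary idempotents \<open>e = d c\<close> and
  \<open>f = 1 - e\<close> do not both kill \<open>\<delta>\<close>, and one that does not is a retraction, hence the identity. It is
  \<open>e\<close>, because \<open>c = c e\<close> is nonzero.\<close>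

lemma almost_split_end_iso:
  assumes F: "F_triangle A x B y C \<delta>" "\<delta> \<noteq> \<one>\<^bsub>Ext K C A\<^esub>" and rf: "right_factoring HE B C y"
    and F': "F_triangle A x' B' y' C \<delta>'" and rf': "right_factoring HE B' C y'"
    and c: "c \<in> mor K C C" "\<delta> = pull K c A \<delta>'"
  shows "is_iso K C C c"
proof -
  note D = F_triangleD[OF F(1)] and ty = etriangleD[OF F_triangleD(4)[OF F(1)]]
  note D' = F_triangleD[OF F'] and ty' = etriangleD[OF F_triangleD(4)[OF F']]
  have nonretr: "is_retraction K C C f" if f: "f \<in> mor K C C" and "pull K f A \<delta> \<noteq> \<one>\<^bsub>Ext K C A\<^esub>" for f
  proof (rule ccontr)
    assume "\<not> is_retraction K C C f"
    then obtain g where "g \<in> mor K C B" "f = y \<cdot> g"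
      using rf D(3) f unfolding right_factoring_def heart_extri_sel by blast
    then show False using pull_factor[OF D(4) ty(3)] that(2) by simp
  qed
  have "is_retraction K C C c"
  proof (rule ccontr)
    assume "\<not> is_retraction K C C c"
    then obtain g where "g \<in> mor K C B'" "c = y' \<cdot> g"
      using rf' D(3) c(1) unfolding right_factoring_def heart_extri_sel by blast
    then show False using pull_factor[OF D'(4) ty(3)] c(2) F(2) by simp
  qed
  then obtain d where d: "d \<in> mor K C C" "c \<cdot> d = Idn K C" unfolding is_retraction_def by blast
  have ar: "arr c" "src c = C" "trg c = C" "arr d" "src d = C" "trg d = C"
    using c(1) d(1) ty by (simp_all add: mor_iff)
  define e where "e = d \<cdot> c"
  define f where "f = Idn K C \<oplus> neg e"
  have e: "e \<in> mor K C C" and f: "f \<in> mor K C C" unfolding e_def f_def using ar ty by (simp_all add: mor_iff)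
  have are: "arr e" "src e = C" "trg e = C" "arr f" "src f = C" "trg f = C"
    using e f ty by (simp_all add: mor_iff)
  have ee: "e \<cdot> e = e"
  proof -
    have "e \<cdot> e = d \<cdot> ((c \<cdot> d) \<cdot> c)" unfolding e_def using ar by (simp add: comp_assoc_arr)
    then show ?thesis unfolding d(2) e_def using ar by simp
  qed
  have ef: "e \<oplus> f = Idn K C" unfolding f_def using are ty by (simp add: add_left_comm_arr)
  have fe: "f \<cdot> e = zero C C" unfolding f_def using are ee ty by simp
  have "e = Idn K C"
  proof (cases "pull K f A \<delta> = \<one>\<^bsub>Ext K C A\<^esub>")
    case False
    \<comment> \<open>In this case \<open>f\<close> would be the identity, so that \<open>e = 0\<close> and \<open>c = c e = 0\<close>.\<close>
    then obtain g where g: "g \<in> mor K C C" "f \<cdot> g = Idn K C"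
      using nonretr[OF f] unfolding is_retraction_def by blast
    have ff: "f \<cdot> f = f"
    proof -
      have "f \<cdot> f = f \<cdot> Idn K C \<oplus> neg (f \<cdot> e)" using are ty unfolding f_def by simp
      then show ?thesis using are fe ty by simp
    qed
    have arg: "arr g" "src g = C" "trg g = C" using g(1) ty by (simp_all add: mor_iff)
    have "f = f \<cdot> (f \<cdot> g)" unfolding g(2) using are by simp
    also have "\<dots> = (f \<cdot> f) \<cdot> g" using are arg by (simp add: comp_assoc_arr)
    also have "\<dots> = Idn K C" unfolding ff g(2) ..
    finally have "e = zero C C" using fe are by simp
    moreover have "c = (c \<cdot> d) \<cdot> c" unfolding d(2) using ar by simp
    then have "c = c \<cdot> e" unfolding e_def using ar by (simp add: comp_assoc_arr)
    ultimately have "c = zero C C" using ar ty by simp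
    then have "\<delta> = \<one>\<^bsub>Ext K C A\<^esub>" using c(2) pull_zero[OF ty'(1,3,3,6)] by simp
    then show ?thesis using F(2) by blast
  next
    case True
    have "\<delta> = pull K (e \<oplus> f) A \<delta>" unfolding ef using ExtMap_Idn[OF ty(1,3,6)] by simp
    also have "\<dots> = pull K e A \<delta> \<otimes>\<^bsub>Ext K C A\<^esub> pull K f A \<delta>"
      using ExtMap_add_left[OF ty(1,1,3,3) e f id_mor[OF ty(1)] ty(6)] hom_mult_eq_add[OF ty(3,3) e] by simp
    finally have "pull K e A \<delta> \<noteq> \<one>\<^bsub>Ext K C A\<^esub>"
      using True F(2) comm_group.axioms(1)[OF Ext_comm_group[OF ty(1,3)]]
      by (auto simp: comm_monoid.axioms(1) monoid.r_one monoid.one_closed)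
    then obtain g where g: "g \<in> mor K C C" "e \<cdot> g = Idn K C"
      using nonretr[OF e] unfolding is_retraction_def by blast
    have arg: "arr g" "src g = C" "trg g = C" using g(1) ty by (simp_all add: mor_iff)
    have "e = e \<cdot> (e \<cdot> g)" unfolding g(2) using are by simp
    also have "\<dots> = (e \<cdot> e) \<cdot> g" using are arg by (simp add: comp_assoc_arr)
    also have "\<dots> = Idn K C" unfolding ee g(2) ..
    finally show ?thesis .
  qed
  then show ?thesis using d c(1) ty unfolding e_def by (intro is_isoI[where l = d and r = d]) auto
qed

text \<open>The component on \<open>B\<close> of the equivalence in the heart is corrected so as to commute with
  \<open>x\<close> and \<open>x'\<close> in \<open>\<H>\<close>; the third axiom then supplies a component on \<open>C\<close> that respects the extensions.\<close>

lemma image_reflects_equiv: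
  assumes t: "t \<in> almost_split_triangles HE" and t': "t' \<in> almost_split_triangles HE"
    and eq: "(heart_image K S T U V t, heart_image K S T U V t') \<in> ses_equiv QK (heart_ses K S T U V)"
  shows "(t, t') \<in> triangle_equiv HE"
proof -
  obtain A x B y C \<delta> where q: "t = ((A, x, B, y, C), \<delta>)" by (cases t) auto
  obtain A' x' B' y' C' \<delta>' where q': "t' = ((A', x', B', y', C'), \<delta>')" by (cases t') auto
  have AC: "A' = A" "C' = C" using eq unfolding q q' heart_image_def prod.case QK.ses_equiv_iff by auto
  obtain b where b: "is_iso QK B B' b" "b \<bullet> Q A B x = Q A B' x'"
    using eq unfolding q q' heart_image_def prod.case QK.ses_equiv_iff by auto
  have F: "F_triangle A x B y C \<delta>" "\<delta> \<noteq> \<one>\<^bsub>Ext K C A\<^esub>" "right_factoring HE B C y"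
    and F': "F_triangle A x' B' y' C \<delta>'" "right_factoring HE B' C y'"
    using t t' unfolding q q' almost_split_triangles_iff AC by auto
  note D = F_triangleD[OF F(1)] and ty = etriangleD[OF F_triangleD(4)[OF F(1)]]
  note D' = F_triangleD[OF F'(1)] and ty' = etriangleD[OF F_triangleD(4)[OF F'(1)]]
  have "b \<in> mor QK B B'" using b(1) unfolding is_iso_def by blast
  then obtain b0 where b0: "b0 \<in> mor K B B'" "b = Q B B' b0" by (rule mor_quotientE)
  have "Q A B' x' = Q A B' (b0 \<cdot> x)" using b(2) b0 Cmp_quotient[OF D(1,2) D'(2) ty(4)] by simp
  then obtain b1 where b1: "b1 \<in> mor K B B'" "x' = b1 \<cdot> x"
    using W_monic_factor[OF ty(1,2) ty'(2) ty(4) D(5) ty'(4) b0(1)] by blast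
  have "b1 \<cdot> x = x' \<cdot> Idn K A" using b1(2) ty' by (simp add: mor_iff)
  then obtain c where c: "c \<in> mor K C C" "c \<cdot> y = y' \<cdot> b1" "push K C (Idn K A) \<delta> = pull K c A \<delta>'"
    using ET3[OF D(4) D'(4) id_mor[OF ty(1)] b1(1)] by blast
  have \<delta>: "\<delta> = pull K c A \<delta>'" using c(3) ExtMap_Idn[OF ty(1,3,6)] by simp
  have iso: "is_iso K C C c" using almost_split_end_iso[OF F(1-3) F'(1,2) c(1) \<delta>] .
  have "is_iso K B B' b1"
    using etriangle_morphism_iso[OF D(4) D'(4) b1(1) _ _ iso \<delta>] b1(2) c(2) by simp
  then show ?thesis
    unfolding q q' triangle_equiv_iff AC using F(1) F'(1) b1(2) c(2) iso \<delta> by metis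
qed

text \<open>The given sequence is isomorphic in the heart to the image of an \<open>\<F>\<close>-triangle with end
  terms \<open>A0\<close> and \<open>C0\<close>, which are replaced by \<open>A\<close> and \<open>C\<close> one after the other.\<close>

lemma heart_ses_lifts:
  assumes "krull_schmidt K" and X: "(A, X, B, Y, C) \<in> heart_ses K S T U V"
    and ns: "no_summand_in K W A" "no_summand_in K W C"
  shows "\<exists>x B' y \<delta>. F_triangle A x B' y C \<delta> \<and>
    ((A, X, B, Y, C), (A, Q A B' x, B', Q B' C y, C)) \<in> ses_equiv QK (heart_ses K S T U V)"
proof -
  have AC: "A \<in> H" "C \<in> H" "B \<in> H" and XY: "X \<in> mor QK A B" "Y \<in> mor QK B C"
    using X heart_ses_short unfolding QK.short_sequences_def by auto
  obtain A0 x0 B0 y0 C0 \<delta>0 a b c where F0: "F_triangle A0 x0 B0 y0 C0 \<delta>0"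
    and iso: "is_iso QK A0 A a" "is_iso QK B0 B b" "is_iso QK C0 C c"
    and sq: "b \<bullet> Q A0 B0 x0 = X \<bullet> a" "c \<bullet> Q B0 C0 y0 = Y \<bullet> b"
    using X by (rule heart_ses_cases)
  note D0 = F_triangleD[OF F0] and ty0 = etriangleD[OF F_triangleD(4)[OF F0]]
  have ob: "A \<in> Obj K" "B \<in> Obj K" "C \<in> Obj K" using AC H_Obj by auto
  \<comment> \<open>The isomorphism \<open>a\<close> lives in the heart only; as \<open>A\<close> has no nonzero summand in \<open>W\<close>, it is represented
    by a retraction \<open>r\<close> with section \<open>e\<close> in \<open>\<H>\<close>.\<close>
  obtain a' where a': "a \<in> mor QK A0 A" "a' \<in> mor QK A A0" "a' \<bullet> a = Idn QK A0" "a \<bullet> a' = Idn QK A"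
    using iso(1) by (rule QK.is_isoE)
  obtain r where r: "r \<in> mor K A0 A" "a = Q A0 A r" using a'(1) by (rule mor_quotientE)
  obtain e0 where e0: "e0 \<in> mor K A A0" "a' = Q A A0 e0" using a'(2) by (rule mor_quotientE)
  have "Q A A (r \<cdot> e0) = Q A A (Idn K A)"
    using a'(4) r e0 Cmp_quotient[OF AC(1) D0(1) AC(1) e0(1) r(1)] by (simp add: Idn_quotient)
  then obtain e where e: "e \<in> mor K A A0" "r \<cdot> e = Idn K A" "Q A A0 e = a'"
    using heart_retract_lifts[OF assms(1) ob(1) ty0(1) ns(1) r(1) e0(1)] e0(2) by auto
  have "Q A0 A0 (e \<cdot> r) = Q A0 A0 (Idn K A0)"
    using a'(3) r(2) e(3) Cmp_quotient[OF D0(1) AC(1) D0(1) r(1) e(1)] by (simp add: Idn_quotient)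
  then obtain x1 B1 y1 \<delta>1 b1 l l' where F1: "F_triangle A x1 B1 y1 C0 \<delta>1"
    and b1: "b1 \<in> mor K B0 B1" "l \<in> mor K B1 B0" "l' \<in> mor K B1 B0"
      "b1 \<cdot> x0 = x1 \<cdot> r" "y1 \<cdot> b1 = y0"
      "Q B0 B0 (l \<cdot> b1) = Q B0 B0 (Idn K B0)" "Q B1 B1 (b1 \<cdot> l') = Q B1 B1 (Idn K B1)"
    using F_triangle_push[OF F0 AC(1) r(1) e(1,2)] by blast
  note D1 = F_triangleD[OF F1] and ty1 = etriangleD[OF F_triangleD(4)[OF F1]]
  have iso1: "is_iso QK B0 B1 (Q B0 B1 b1)"
    using is_iso_quotientI[OF D0(2) D1(2) b1(1,2,6,3,7)] .
  \<comment> \<open>Likewise \<open>c\<close> is represented by a retraction \<open>s\<close>, and the extension is pulled back along its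
    section \<open>f\<close>.\<close>
  obtain c' where c': "c \<in> mor QK C0 C" "c' \<in> mor QK C C0" "c' \<bullet> c = Idn QK C0" "c \<bullet> c' = Idn QK C"
    using iso(3) by (rule QK.is_isoE)
  obtain s where s: "s \<in> mor K C0 C" "c = Q C0 C s" using c'(1) by (rule mor_quotientE)
  obtain f0 where f0: "f0 \<in> mor K C C0" "c' = Q C C0 f0" using c'(2) by (rule mor_quotientE)
  have "Q C C (s \<cdot> f0) = Q C C (Idn K C)"
    using c'(4) s f0 Cmp_quotient[OF AC(2) D0(3) AC(2) f0(1) s(1)] by (simp add: Idn_quotient)
  then obtain f where f: "f \<in> mor K C C0" "s \<cdot> f = Idn K C" "Q C C0 f = c'"
    using heart_retract_lifts[OF assms(1) ob(3) ty0(3) ns(2) s(1) f0(1)] f0(2) by auto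
  have "Q C0 C0 (f \<cdot> s) = Q C0 C0 (Idn K C0)"
    using c'(3) s(2) f(3) Cmp_quotient[OF D0(3) AC(2) D0(3) s(1) f(1)] by (simp add: Idn_quotient)
  then obtain x2 B2 y2 \<delta>2 b2 m m' where F2: "F_triangle A x2 B2 y2 C \<delta>2"
    and b2: "b2 \<in> mor K B2 B1" "m \<in> mor K B1 B2" "m' \<in> mor K B1 B2"
      "y1 \<cdot> b2 = f \<cdot> y2" "b2 \<cdot> x2 = x1"
      "Q B1 B1 (b2 \<cdot> m) = Q B1 B1 (Idn K B1)" "Q B2 B2 (m' \<cdot> b2) = Q B2 B2 (Idn K B2)"
    using F_triangle_pull[OF F1 AC(2) s(1) f(1,2)] by blast
  note D2 = F_triangleD[OF F2] and ty2 = etriangleD[OF F_triangleD(4)[OF F2]]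
  have iso2: "is_iso QK B2 B1 (Q B2 B1 b2)"
    using is_iso_quotientI[OF D2(2) D1(2) b2(1,3,7,2,6)] .
  \<comment> \<open>The comparison map \<open>b2\<close> points back towards the old middle term, so its inverse \<open>\<gamma>\<close> enters.\<close>
  obtain \<beta> where \<beta>: "b \<in> mor QK B0 B" "\<beta> \<in> mor QK B B0" "\<beta> \<bullet> b = Idn QK B0" "b \<bullet> \<beta> = Idn QK B"
    "is_iso QK B B0 \<beta>" using iso(2) by (rule QK.is_isoE)
  obtain \<gamma> where \<gamma>: "\<gamma> \<in> mor QK B1 B2" "\<gamma> \<bullet> Q B2 B1 b2 = Idn QK B2" "Q B2 B1 b2 \<bullet> \<gamma> = Idn QK B1"
    "is_iso QK B1 B2 \<gamma>" using iso2 by (rule QK.is_isoE)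
  define \<Phi> where "\<Phi> = \<gamma> \<bullet> (Q B0 B1 b1 \<bullet> \<beta>)"
  have iso\<Phi>: "is_iso QK B B2 \<Phi>"
    unfolding \<Phi>_def
    using QK.is_iso_comp[OF _ _ _ QK.is_iso_comp[OF _ _ _ \<beta>(5) iso1] \<gamma>(4)] AC(3) D0(2) D1(2) D2(2) by simp
  have q1: "Q B0 B1 b1 \<bullet> Q A0 B0 x0 = Q A B1 x1 \<bullet> a" "Q B1 C0 y1 \<bullet> Q B0 B1 b1 = Q B0 C0 y0"
    "Q B1 C0 y1 \<bullet> Q B2 B1 b2 = c' \<bullet> Q B2 C y2" "Q B2 B1 b2 \<bullet> Q A B2 x2 = Q A B1 x1"
    using Cmp_quotient[OF D0(1,2) D1(2) ty0(4) b1(1)] Cmp_quotient[OF D0(1) D1(1,2) r(1) ty1(4)]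
      Cmp_quotient[OF D0(2) D1(2,3) b1(1) ty1(5)] Cmp_quotient[OF D2(2) D1(2,3) b2(1) ty1(5)]
      Cmp_quotient[OF D2(2,3) D1(3) ty2(5) f(1)] Cmp_quotient[OF D2(1,2) D1(2) ty2(4) b2(1)]
      b1(4,5) b2(4,5) r(2) f(3) by simp_all
  have ar: "QK.arr X" "QK.src X = A" "QK.trg X = B" "QK.arr Y" "QK.src Y = B" "QK.trg Y = C"
    "QK.arr a" "QK.src a = A0" "QK.trg a = A" "QK.arr a'" "QK.src a' = A" "QK.trg a' = A0"
    "QK.arr b" "QK.src b = B0" "QK.trg b = B" "QK.arr \<beta>" "QK.src \<beta> = B" "QK.trg \<beta> = B0"
    "QK.arr c" "QK.src c = C0" "QK.trg c = C" "QK.arr c'" "QK.src c' = C" "QK.trg c' = C0"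
    "QK.arr \<gamma>" "QK.src \<gamma> = B1" "QK.trg \<gamma> = B2"
    "QK.arr (Q B0 B1 b1)" "QK.src (Q B0 B1 b1) = B0" "QK.trg (Q B0 B1 b1) = B1"
    "QK.arr (Q B2 B1 b2)" "QK.src (Q B2 B1 b2) = B2" "QK.trg (Q B2 B1 b2) = B1"
    "QK.arr (Q A0 B0 x0)" "QK.src (Q A0 B0 x0) = A0" "QK.trg (Q A0 B0 x0) = B0"
    "QK.arr (Q B0 C0 y0)" "QK.src (Q B0 C0 y0) = B0" "QK.trg (Q B0 C0 y0) = C0"
    "QK.arr (Q A B1 x1)" "QK.src (Q A B1 x1) = A" "QK.trg (Q A B1 x1) = B1"
    "QK.arr (Q B1 C0 y1)" "QK.src (Q B1 C0 y1) = B1" "QK.trg (Q B1 C0 y1) = C0"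
    "QK.arr (Q A B2 x2)" "QK.src (Q A B2 x2) = A" "QK.trg (Q A B2 x2) = B2"
    "QK.arr (Q B2 C y2)" "QK.src (Q B2 C y2) = B2" "QK.trg (Q B2 C y2) = C"
    using XY a'(1,2) \<beta>(1,2) c'(1,2) \<gamma>(1) Q_mor[OF b1(1)] Q_mor[OF b2(1)] Q_mor[OF ty0(4)]
      Q_mor[OF ty0(5)] Q_mor[OF ty1(4)] Q_mor[OF ty1(5)] Q_mor[OF ty2(4)] Q_mor[OF ty2(5)]
      QK.mor_iff AC D0(1-3) D1(1-3) D2(1-3) by simp_all
  have "\<Phi> \<bullet> X = \<gamma> \<bullet> (Q B0 B1 b1 \<bullet> (\<beta> \<bullet> ((X \<bullet> a) \<bullet> a')))"
    unfolding \<Phi>_def using ar a'(4) by (simp add: QK.comp_assoc_arr)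
  also have "\<dots> = \<gamma> \<bullet> (Q B0 B1 b1 \<bullet> (((\<beta> \<bullet> b) \<bullet> Q A0 B0 x0) \<bullet> a'))"
    unfolding sq(1)[symmetric] using ar by (simp add: QK.comp_assoc_arr)
  also have "\<dots> = \<gamma> \<bullet> ((Q B0 B1 b1 \<bullet> Q A0 B0 x0) \<bullet> a')"
    unfolding \<beta>(3) using ar by (simp add: QK.comp_assoc_arr)
  also have "\<dots> = \<gamma> \<bullet> (Q A B1 x1 \<bullet> (a \<bullet> a'))"
    unfolding q1(1) using ar by (simp add: QK.comp_assoc_arr)
  also have "\<dots> = \<gamma> \<bullet> (Q B2 B1 b2 \<bullet> Q A B2 x2)"
    unfolding a'(4) q1(4) using ar by simp
  also have "\<dots> = (\<gamma> \<bullet> Q B2 B1 b2) \<bullet> Q A B2 x2" using ar by (simp add: QK.comp_assoc_arr)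
  also have "\<dots> = Q A B2 x2" unfolding \<gamma>(2) using ar by simp
  finally have left: "\<Phi> \<bullet> X = Q A B2 x2" .
  have "Q B2 C y2 \<bullet> \<Phi> = (c \<bullet> c') \<bullet> (Q B2 C y2 \<bullet> \<Phi>)"
    unfolding c'(4) \<Phi>_def using ar by simp
  also have "\<dots> = c \<bullet> ((c' \<bullet> Q B2 C y2) \<bullet> \<Phi>)"
    unfolding \<Phi>_def using ar by (simp add: QK.comp_assoc_arr)
  also have "\<dots> = c \<bullet> (Q B1 C0 y1 \<bullet> ((Q B2 B1 b2 \<bullet> \<gamma>) \<bullet> (Q B0 B1 b1 \<bullet> \<beta>)))"
    unfolding \<Phi>_def q1(3)[symmetric] using ar by (simp add: QK.comp_assoc_arr)
  also have "\<dots> = c \<bullet> ((Q B1 C0 y1 \<bullet> Q B0 B1 b1) \<bullet> \<beta>)"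
    unfolding \<gamma>(3) using ar by (simp add: QK.comp_assoc_arr)
  also have "\<dots> = (c \<bullet> Q B0 C0 y0) \<bullet> \<beta>" unfolding q1(2) using ar by (simp add: QK.comp_assoc_arr)
  also have "\<dots> = Y \<bullet> (b \<bullet> \<beta>)" unfolding sq(2) using ar by (simp add: QK.comp_assoc_arr)
  also have "\<dots> = Idn QK C \<bullet> Y" unfolding \<beta>(4) using ar by simp
  finally have right: "Q B2 C y2 \<bullet> \<Phi> = Idn QK C \<bullet> Y" .
  have "is_iso QK C C (Idn QK C)" using QK.is_iso_Idn[of C] AC(2) by simp
  then have "((A, X, B, Y, C), (A, Q A B2 x2, B2, Q B2 C y2, C)) \<in> ses_equiv QK (heart_ses K S T U V)"
    unfolding QK.ses_equiv_iff using X F_triangle_image[OF F2] iso\<Phi> left right by blast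
  then show ?thesis using F2 by blast
qed

lemma heart_almost_split_iff:
  "(A, X, B, Y, C) \<in> heart_almost_split K S T U V \<longleftrightarrow>
     (A, X, B, Y, C) \<in> almost_split_ses QK (heart_ses K S T U V) \<and>
     no_summand_in K W A \<and> no_summand_in K W C"
  unfolding heart_almost_split_def heart_eq by simp

lemma image_in_heart_almost_split:
  assumes "krull_schmidt K" "t \<in> almost_split_triangles HE"
  shows "heart_image K S T U V t \<in> heart_almost_split K S T U V"
proof -
  obtain A x B y C \<delta> where t: "t = ((A, x, B, y, C), \<delta>)" by (cases t) auto
  have as: "F_triangle A x B y C \<delta>" "\<delta> \<noteq> \<one>\<^bsub>Ext K C A\<^esub>" "left_factoring HE A B x" "right_factoring HE B C y"
    using assms(2) unfolding t almost_split_triangles_iff by auto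
  show ?thesis
    using image_almost_split[OF assms(1) as(1) almost_split_no_summand[OF as(1-3)]
        almost_split_no_summand_right[OF as(1,2,4)]] assms(2)
    unfolding t heart_image_def by simp
qed

lemma heart_almost_split_lifts:
  assumes "krull_schmidt K" "q \<in> heart_almost_split K S T U V"
  shows "\<exists>t\<in>almost_split_triangles HE. (q, heart_image K S T U V t) \<in> ses_equiv QK (heart_ses K S T U V)"
proof -
  obtain A X B Y C where q: "q = (A, X, B, Y, C)" by (cases q) auto
  have as: "q \<in> almost_split_ses QK (heart_ses K S T U V)" and ns: "no_summand_in K W A" "no_summand_in K W C"
    using assms(2) unfolding q heart_almost_split_iff by auto
  have "(A, X, B, Y, C) \<in> heart_ses K S T U V" using as unfolding q almost_split_ses_def by simp
  then obtain x B' y \<delta> where F: "F_triangle A x B' y C \<delta>"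
    and equ: "(q, (A, Q A B' x, B', Q B' C y, C)) \<in> ses_equiv QK (heart_ses K S T U V)"
    using heart_ses_lifts[OF assms(1) _ ns] unfolding q by blast
  have "(A, Q A B' x, B', Q B' C y, C) \<in> heart_almost_split K S T U V"
    unfolding heart_almost_split_iff
    using QK.almost_split_ses_equiv[OF heart_ses_short equ as] ns by simp
  then have "((A, x, B', y, C), \<delta>) \<in> almost_split_triangles HE"
    using image_almost_split[OF assms(1) F ns] by simp
  moreover have "heart_image K S T U V ((A, x, B', y, C), \<delta>) = (A, Q A B' x, B', Q B' C y, C)"
    unfolding heart_image_def by simp
  ultimately show ?thesis using equ by metis
qed

end

lemma quotient_bij_betw:
  assumes refl: "\<And>t. t \<in> P \<Longrightarrow> (t, t) \<in> r" "\<And>q. q \<in> R \<Longrightarrow> (q, q) \<in> s"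
    and sym: "\<And>t t'. (t, t') \<in> r \<Longrightarrow> (t', t) \<in> r" "\<And>q q'. (q, q') \<in> s \<Longrightarrow> (q', q) \<in> s"
    and trans: "\<And>t t' t''. (t, t') \<in> r \<Longrightarrow> (t', t'') \<in> r \<Longrightarrow> (t, t'') \<in> r"
      "\<And>q q' q''. (q, q') \<in> s \<Longrightarrow> (q', q'') \<in> s \<Longrightarrow> (q, q'') \<in> s"
    and map: "\<And>t. t \<in> P \<Longrightarrow> \<phi> t \<in> R"
    and cong: "\<And>t t'. (t, t') \<in> r \<Longrightarrow> (\<phi> t, \<phi> t') \<in> s"
    and inj: "\<And>t t'. t \<in> P \<Longrightarrow> t' \<in> P \<Longrightarrow> (\<phi> t, \<phi> t') \<in> s \<Longrightarrow> (t, t') \<in> r"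
    and surj: "\<And>q. q \<in> R \<Longrightarrow> \<exists>t\<in>P. (q, \<phi> t) \<in> s"
  shows "bij_betw (\<lambda>X. s `` (\<phi> ` X)) (P // r) (R // s)"
proof -
  have cls: "s `` (\<phi> ` (r `` {t})) = s `` {\<phi> t}" if "t \<in> P" for t
    using refl(1)[OF that] cong trans(2) by blast
  have eqI: "s `` {q} = s `` {q'}" if "(q, q') \<in> s" for q q'
    using that sym(2) trans(2) by blast
  have eqI': "r `` {t} = r `` {t'}" if "(t, t') \<in> r" for t t'
    using that sym(1) trans(1) by blast
  show ?thesis
    unfolding bij_betw_def
  proof
    show "inj_on (\<lambda>X. s `` (\<phi> ` X)) (P // r)"
    proof (rule inj_onI)
      fix X Y assume "X \<in> P // r" "Y \<in> P // r" and eq: "s `` (\<phi> ` X) = s `` (\<phi> ` Y)"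
      then obtain t t' where t: "t \<in> P" "X = r `` {t}" "t' \<in> P" "Y = r `` {t'}"
        by (auto elim!: quotientE)
      then have "s `` {\<phi> t} = s `` {\<phi> t'}" using eq cls by simp
      then have "(\<phi> t, \<phi> t') \<in> s" using refl(2) map t(3) by blast
      then show "X = Y" using inj t eqI' by simp
    qed
    show "(\<lambda>X. s `` (\<phi> ` X)) ` (P // r) = R // s"
    proof
      show "(\<lambda>X. s `` (\<phi> ` X)) ` (P // r) \<subseteq> R // s"
        using cls map by (auto elim!: quotientE intro!: quotientI)
      show "R // s \<subseteq> (\<lambda>X. s `` (\<phi> ` X)) ` (P // r)"
      proof
        fix Z assume "Z \<in> R // s"
        then obtain q where q: "q \<in> R" "Z = s `` {q}" by (rule quotientE)
        obtain t where t: "t \<in> P" "(q, \<phi> t) \<in> s" using surj q(1) by blast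
        have "Z = s `` (\<phi> ` (r `` {t}))" using q(2) eqI[OF t(2)] cls[OF t(1)] by simp
        then show "Z \<in> (\<lambda>X. s `` (\<phi> ` X)) ` (P // r)" using quotientI[OF t(1)] by blast
      qed
    qed
  qed
qed

context twin_heart
begin

lemma almost_split_correspondence:
  assumes "krull_schmidt K"
  shows "bij_betw
    (\<lambda>X. ses_equiv QK (heart_ses K S T U V) `` (heart_image K S T U V ` X))
    (almost_split_triangles HE // triangle_equiv HE)
    (heart_almost_split K S T U V // ses_equiv QK (heart_ses K S T U V))"
proof (rule quotient_bij_betw)
  show "(t, t) \<in> triangle_equiv HE" if "t \<in> almost_split_triangles HE" for t
    using that triangle_equiv_refl by (cases t) (auto simp: almost_split_triangles_iff)
  show "(q, q) \<in> ses_equiv QK (heart_ses K S T U V)" if "q \<in> heart_almost_split K S T U V" for q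
    using that QK.ses_equiv_refl[OF heart_ses_short]
    unfolding heart_almost_split_def almost_split_ses_def by auto
qed (use triangle_equiv_sym QK.ses_equiv_sym[OF heart_ses_short] triangle_equiv_trans
    QK.ses_equiv_trans[OF heart_ses_short] image_in_heart_almost_split[OF assms]
    image_equiv image_reflects_equiv heart_almost_split_lifts[OF assms] in blast)+

end

theorem theorem1p4:
  fixes K :: "('o, 'm, 'e) extricat" and S T U V :: "'o set"
  assumes "extriangulated_category K"
    and "krull_schmidt K"
    and "twin_cotorsion_pair K S T U V"
  shows "bij_betw
    (\<lambda>X. ses_equiv (heart K S T U V) (heart_ses K S T U V) `` (heart_image K S T U V ` X))
    (almost_split_triangles (heart_extri K S T U V) // triangle_equiv (heart_extri K S T U V))
    (heart_almost_split K S T U V // ses_equiv (heart K S T U V) (heart_ses K S T U V))"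
proof -
  interpret twin_heart K S T U V
    using assms(1,3) by (intro twin_heart.intro extriangulated.intro)
  show ?thesis unfolding heart_eq by (rule almost_split_correspondence[OF assms(2)])
qed

end
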